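(* Let $\varphi>\frac12$, let $\vartheta\in\mathbb N_+$ (a positive integer), let $g$ be analytic everywhere on $[-1,1]$, and suppose that $u$ has weak singularities at the endpoints as $$u(x)=u(x;\varphi,\vartheta)=g(x)\,(1-x^2)^{\varphi}\,\ln^{\vartheta}(1-x^2),\quad x\in[-1,1],\qquad u(\pm1;\varphi,\vartheta)=\lim_{x\to\pm1}u(x;\varphi,\vartheta)=0.$$ Let $a_n,b_n,c_n$ be the coefficients of the infinite expansions of $u$ in the Chebyshev, difference and quadratic-factor bases, respectively. Then, for $n\gg1$, $$a_n\sim\frac{A(n)}{n^{2\varphi+1}},\qquad b_n\sim\frac{A(n)}{4\varphi}\,\frac1{n^{2\varphi}},\qquad c_n\sim-\frac{A(n)}{(2\varphi-1)(2\varphi)}\,\frac1{n^{2\varphi-1}},$$ where $A(n)$ varies more slowly than a power of $n$, such as a logarithm, or a constant. Specifically, $A(n)=\mathcal O(\ln^{\vartheta-1}(n))$ when $\varphi\in\mathbb N$, and $A(n)=\mathcal O(\ln^{\vartheta}(n))$ when $\varphi\notin\mathbb N$. Moreover, $A(n)$ has the following expressions. (i) If $\vartheta=1$, $$A(n)=-\frac{2\Gamma(2\varphi+1)}{\pi}\,\big\{(-1)^ng(-1)+g(1)\big\}\,\big\{(\gamma_1-\ln2)\sin(\varphi\pi)+\pi\cos(\varphi\pi)\big\},$$ where $\gamma_1=2\psi_0(2\varphi+1)-\psi_0(n-\varphi)-\psi_0(n+\varphi+1)$. (ii) If $\vartheta=2$, $$A(n)=-\frac{2\Gamma(2\varphi+1)}{\pi}\,\big\{(-1)^ng(-1)+g(1)\big\}\,\big\{\big(\gamma_1^2+\gamma_2-2\ln(2)\gamma_1+\ln^2(2)-\pi^2\big)\sin(\varphi\pi)+2\pi\big(\gamma_1-\ln(2)\big)\cos(\varphi\pi)\big\},$$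 where $\gamma_2=4\psi_1(2\varphi+1)+\psi_1(n-\varphi)-\psi_1(n+\varphi+1)$. (iii) If $\vartheta\in\mathbb N_+$, one has the general formula $$A(n)=-\frac2\pi\,\gamma_3\,n^{2\varphi+1}\sum_{k=0}^{\vartheta}\sum_{j=0}^{k}\binom kj\,\pi^j\sin\Big(\frac j2\pi+\varphi\pi\Big)\ln^{k-j}\Big(\frac12\Big)\frac{d^{\vartheta-k}}{d\varphi^{\vartheta-k}}\mathrm B(2\varphi+1,n-\varphi)$$ $$\sim-\frac{2\Gamma(2\varphi+1)}{\pi}\,\gamma_3\,\big\{\ln^{\vartheta}(n)\sin(\varphi\pi)+\ln^{\vartheta-1}(n)\cos(\varphi\pi)\big\},$$ where $\gamma_3=(-1)^ng(-1)+g(1)$.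
   Context: $T_n$ is the Chebyshev polynomial of the first kind of degree $n$. The Chebyshev coefficients are $a_0=\frac1\pi\int_{-1}^1\frac{T_0(x)u(x)}{\sqrt{1-x^2}}dx$, $a_n=\frac2\pi\int_{-1}^1\frac{T_n(x)u(x)}{\sqrt{1-x^2}}dx$ $(n>0)$, so $u=\sum_{n\ge0}a_nT_n$. The difference-basis coefficients $b_n$ in $u=\sum_{n\ge0}b_n(T_{n+2}-T_n)$ are given by $b_0=-a_0$, $b_1=-a_1$, $b_{n-2}-b_n=a_n$ $(n\ge2)$. The quadratic-factor coefficients $c_n$ in $u=\sum_{n\ge0}c_n(1-x^2)T_n$ are the Chebyshev coefficients of $v=u/(1-x^2)$. $\Gamma$ is the Gamma function, $\mathrm B$ the Beta function, and $\psi_n$ $(n\in\mathbb N)$ the polygamma function of order $n$ (so $\psi_0$ is the digamma and $\psi_1$ the trigamma function). The symbol $\sim$ denotes asymptotic behaviour as $n\to\infty$.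
   Formalization: ∼ is taken along n with γ₃≠0, plus o-error bounds for all n; the sum in (iii) gets the missing factor binom(ϑ,k); the last ∼ in (iii) is proved as same order, and as ∼ with constants (−2)^ϑ and ϑπ(−2)^(ϑ−1) restored. *)

theory Defs
  imports "HOL-Analysis.Analysis" "HOL-Library.Landau_Symbols" "HOL-Real_Asymp.Real_Asymp"
begin

fun cheb_T :: "nat \<Rightarrow> real \<Rightarrow> real" where
  "cheb_T 0 x = 1"
| "cheb_T (Suc 0) x = x"
| "cheb_T (Suc (Suc n)) x = 2 * x * cheb_T (Suc n) x - cheb_T n x"

definition cheb_coeff :: "(real \<Rightarrow> real) \<Rightarrow> nat \<Rightarrow> real" where
  "cheb_coeff u n =
     (if n = 0 then 1 / pi else 2 / pi) *
     integral {-1..1} (\<lambda>x. cheb_T n x * u x / sqrt (1 - x\<^sup>2))"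

(* Coefficients b_n of u in the basis T_(n+2) - T_n: with a_n the Chebyshev coefficients,
   b_0 = -a_0, b_1 = -a_1 and b_(n-2) - b_n = a_n for n >= 2. *)
fun diff_coeff :: "(real \<Rightarrow> real) \<Rightarrow> nat \<Rightarrow> real" where
  "diff_coeff u 0 = - cheb_coeff u 0"
| "diff_coeff u (Suc 0) = - cheb_coeff u 1"
| "diff_coeff u (Suc (Suc n)) = diff_coeff u n - cheb_coeff u (Suc (Suc n))"

(* Coefficients of u in the basis (1 - x^2) T_n.  The quotient takes the value 0 at x = -1 and
   x = 1 (division by zero), which does not affect the integral. *)
definition quad_coeff :: "(real \<Rightarrow> real) \<Rightarrow> nat \<Rightarrow> real" where
  "quad_coeff u = cheb_coeff (\<lambda>x. u x / (1 - x\<^sup>2))"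

definition weak_sing :: "(real \<Rightarrow> real) \<Rightarrow> real \<Rightarrow> nat \<Rightarrow> real \<Rightarrow> real" where
  "weak_sing g \<phi> \<theta> x =
     (if x = -1 \<or> x = 1 then 0 else g x * (1 - x\<^sup>2) powr \<phi> * ln (1 - x\<^sup>2) ^ \<theta>)"

(* The value 0 at the endpoints is the limit from inside the interval. *)
lemma weak_sing_continuous_on:
  assumes "\<phi> > 0" and g: "continuous_on {-1..1} g"
  shows "continuous_on {-1..1} (weak_sing g \<phi> \<theta>)"
proof -
  define h where "h t = (if t = 0 then 0 else t powr \<phi> * ln t ^ \<theta>)" for t :: real
  have "((\<lambda>t. t powr \<phi> * ln t ^ \<theta>) \<longlongrightarrow> 0) (at_right 0)"
    using assms(1) by real_asymp
  then have h0: "(h \<longlongrightarrow> 0) (at_right 0)"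
    by (rule Lim_transform_eventually)
      (auto simp: h_def eventually_at_filter)
  have "continuous_on {0..1} h"
    unfolding continuous_on_def
  proof
    fix t :: real assume t: "t \<in> {0..1}"
    show "(h \<longlongrightarrow> h t) (at t within {0..1})"
    proof (cases "t = 0")
      case True
      have "at (0::real) within {0..1} \<le> at_right 0"
        by (metis at_within_Icc_at_right order_refl zero_less_one)
      with h0 True show ?thesis
        by (auto simp: h_def intro: tendsto_mono)
    next
      case False
      with t have "t > 0" by simp
      then have "((\<lambda>t. t powr \<phi> * ln t ^ \<theta>) \<longlongrightarrow> t powr \<phi> * ln t ^ \<theta>) (at t within {0..1})"
        by (intro tendsto_intros) auto
      moreover have "\<forall>\<^sub>F s in at t within {0..1}. s powr \<phi> * ln s ^ \<theta> = h s"
      proof -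
        have "\<forall>\<^sub>F s in nhds t. s > 0" using \<open>t > 0\<close>
          by (rule eventually_nhds_in_open[of "{0<..}" t, simplified])
        then show ?thesis
          by (auto simp: eventually_at_filter h_def elim!: eventually_mono)
      qed
      ultimately show ?thesis
        using False by (auto simp: h_def intro: Lim_transform_eventually)
    qed
  qed
  then have "continuous_on {-1..1} (\<lambda>x. h (1 - x\<^sup>2))"
    by (rule continuous_on_compose2)
      (auto intro!: continuous_intros simp: abs_square_le_1 abs_le_iff)
  then have "continuous_on {-1..1} (\<lambda>x. g x * h (1 - x\<^sup>2))"
    using g by (intro continuous_intros)
  moreover have "g x * h (1 - x\<^sup>2) = weak_sing g \<phi> \<theta> x" for x
    by (auto simp: weak_sing_def h_def power2_eq_1_iff)
  ultimately show ?thesis by simp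
qed

definition gamma1 :: "real \<Rightarrow> nat \<Rightarrow> real" where
  "gamma1 \<phi> n = 2 * Polygamma 0 (2 * \<phi> + 1) - Polygamma 0 (real n - \<phi>) - Polygamma 0 (real n + \<phi> + 1)"

definition gamma2 :: "real \<Rightarrow> nat \<Rightarrow> real" where
  "gamma2 \<phi> n = 4 * Polygamma 1 (2 * \<phi> + 1) + Polygamma 1 (real n - \<phi>) - Polygamma 1 (real n + \<phi> + 1)"

definition gamma3 :: "(real \<Rightarrow> real) \<Rightarrow> nat \<Rightarrow> real" where
  "gamma3 g n = (-1) ^ n * g (-1) + g 1"

definition amp_one :: "(real \<Rightarrow> real) \<Rightarrow> real \<Rightarrow> nat \<Rightarrow> real" where
  "amp_one g \<phi> n =
     - (2 * Gamma (2 * \<phi> + 1) / pi) * gamma3 g n *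
       ((gamma1 \<phi> n - ln 2) * sin (\<phi> * pi) + pi * cos (\<phi> * pi))"

definition amp_two :: "(real \<Rightarrow> real) \<Rightarrow> real \<Rightarrow> nat \<Rightarrow> real" where
  "amp_two g \<phi> n =
     - (2 * Gamma (2 * \<phi> + 1) / pi) * gamma3 g n *
       (((gamma1 \<phi> n)\<^sup>2 + gamma2 \<phi> n - 2 * ln 2 * gamma1 \<phi> n + (ln 2)\<^sup>2 - pi\<^sup>2) * sin (\<phi> * pi)
        + 2 * pi * (gamma1 \<phi> n - ln 2) * cos (\<phi> * pi))"

(* The double sum is 2 powr \<phi> times the \<theta>-th derivative in \<phi> of
   sin (\<phi> pi) * (1/2) powr \<phi> * B(2 \<phi> + 1, n - \<phi>), expanded by the Leibniz rule twice.
   The outer expansion contributes the factor (\<theta> choose k), which is needed for agreement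
   with amp_two at \<theta> = 2. *)
definition amp_gen :: "(real \<Rightarrow> real) \<Rightarrow> real \<Rightarrow> nat \<Rightarrow> nat \<Rightarrow> real" where
  "amp_gen g \<phi> \<theta> n =
     - (2 / pi) * gamma3 g n * real n powr (2 * \<phi> + 1) *
       (\<Sum>k=0..\<theta>. \<Sum>j=0..k.
          real (\<theta> choose k) * real (k choose j) * pi ^ j * sin (real j / 2 * pi + \<phi> * pi) *
          ln (1 / 2) ^ (k - j) * (deriv ^^ (\<theta> - k)) (\<lambda>t. Beta (2 * t + 1) (real n - t)) \<phi>)"

(* sin (\<phi> pi) vanishes when \<phi> is an integer, which lowers the power of the logarithm by one. *)
definition amp_scale :: "real \<Rightarrow> nat \<Rightarrow> nat \<Rightarrow> real" where
  "amp_scale \<phi> \<theta> n = ln (real n) ^ (if \<phi> \<in> \<nat> then \<theta> - 1 else \<theta>)"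

(* n tends to infinity through the indices with gamma3 g n \<noteq> 0.  If gamma3 g n = 0 then all
   the amplitudes above vanish at n, and a quotient by them is meaningless. *)
definition nondeg :: "(real \<Rightarrow> real) \<Rightarrow> nat filter" where
  "nondeg g = inf sequentially (principal {n. gamma3 g n \<noteq> 0})"

end

theory Submission
  imports Defs "HOL-Complex_Analysis.Complex_Analysis" "HOL-Probability.Characteristic_Functions"
begin

text \<open>
  With \<open>x = cos t\<close> all coefficients become cosine moments on \<open>[0, \<pi>]\<close> of \<open>g (cos t)\<close> times a power
  of \<open>sin t\<close> times a power of \<open>2 ln (sin t)\<close>. If the \<open>j\<close>-th derivative of \<open>f\<close> is of order \<open>s - j\<close>
  at both endpoints, cutting at distance \<open>1/n\<close> from the endpoints and integrating by parts in the
  middle shows that the \<open>n\<close>-th moment of \<open>f\<close> is \<open>O(1/n\<^sup>s\<^sup>+\<^sup>1)\<close>. Hence \<open>g\<close> may be replaced by its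
  affine interpolant at \<open>\<plusminus>1\<close>, i.e. essentially by \<open>1\<close>. For \<open>g = 1\<close> the moments satisfy
  a two-term recurrence in \<open>n\<close>, which is explicitly solvable for \<open>\<theta> = 0\<close> and for larger \<open>\<theta>\<close> is
  solved asymptotically by the Stolz--Cesaro theorem. The derivatives of the Beta function in \<open>amp_gen\<close> obey
  the same recurrence. Finally \<open>c\<^sub>n - c\<^sub>n\<^sub>+\<^sub>2 = -4 b\<^sub>n\<close>, \<open>b\<^sub>n - b\<^sub>n\<^sub>+\<^sub>2 = a\<^sub>n\<^sub>+\<^sub>2\<close> and \<open>b\<^sub>n, c\<^sub>n \<rightarrow> 0\<close>,
  so \<open>b\<close> and \<open>c\<close> follow from \<open>a\<close> by summation in steps of two.
\<close>

subsection \<open>Difference equations and Gamma quotients\<close>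

text \<open>On (0, \<pi>) the function \<open>sinlog (2 * \<phi>) \<theta>\<close> is the
  \<theta>-th \<phi>-derivative of the pure power, so formally everything follows by differentiating
  the case without logarithm. Asymptotic relations cannot in general be differentiated in a
  parameter, whereas exact recurrences in n can; hence each further logarithm is gained from one
  more inhomogeneous recurrence. Two inhomogeneous terms of relative size 1/n in each of them
  produce a factor -2 ln n per logarithm.

  The obstacle is that the coefficient sin (\<phi> \<pi>) of the case without logarithm vanishes for
  integer \<phi>. The induction over the logarithms then starts one level higher, from a constant
  with \<pi> cos (\<phi> \<pi>) that no limit at the lower level reveals. \<open>log_order\<close>
  and \<open>lead_const\<close> carry this distinction.

  Errors are kept as o-estimates of differences because \<open>gamma3\<close> may vanish on a parity
  class; equivalences for the coefficients are drawn only along \<open>nondeg\<close>. The short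
  form of A gives the order of magnitude; it becomes an equivalence with the constants (-2)^\<theta>
  and \<theta> \<pi> (-2)^(\<theta>-1) inserted.\<close>

lemma smallo_step_vanishing:
  fixes x w :: "nat \<Rightarrow> real"
  assumes x: "x \<longlonglongrightarrow> 0" and w: "w \<longlonglongrightarrow> 0"
    and mono: "\<forall>\<^sub>F n in sequentially. w (n + 2) \<le> w n"
    and diff: "(\<lambda>n. x n - x (n + 2)) \<in> o(\<lambda>n. w n - w (n + 2))"
  shows "x \<in> o(w)"
proof (rule landau_o.smallI)
  fix e :: real assume e: "e > 0"
  from landau_o.smallD[OF diff e] mono
  have "\<forall>\<^sub>F n in sequentially. \<bar>x n - x (n + 2)\<bar> \<le> e * (w n - w (n + 2))"
    by eventually_elim auto
  then obtain N where N: "\<And>n. n \<ge> N \<Longrightarrow> \<bar>x n - x (n + 2)\<bar> \<le> e * (w n - w (n + 2))"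
    by (auto simp: eventually_sequentially)
  have "\<bar>x n\<bar> \<le> e * w n" if n: "n \<ge> N" for n
  proof -
    \<comment> \<open>Telescoping from n to n + 2j; letting j tend to infinity removes both far
      ends, since x and w vanish there.\<close>
    have *: "\<bar>x n - x (n + 2 * j)\<bar> \<le> e * (w n - w (n + 2 * j))" for j
    proof (induction j)
      case (Suc j)
      have "\<bar>x (n + 2 * j) - x (n + 2 * j + 2)\<bar> \<le> e * (w (n + 2 * j) - w (n + 2 * j + 2))"
        using n by (intro N) auto
      with Suc show ?case by (simp add: algebra_simps)
    qed simp
    have sub: "filterlim (\<lambda>j. n + 2 * j) at_top sequentially"
      by (intro filterlim_subseq strict_monoI) auto
    have l1: "(\<lambda>j. \<bar>x n - x (n + 2 * j)\<bar>) \<longlonglongrightarrow> \<bar>x n - 0\<bar>"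
      by (intro tendsto_intros filterlim_compose[OF x sub])
    have l2: "(\<lambda>j. e * (w n - w (n + 2 * j))) \<longlonglongrightarrow> e * (w n - 0)"
      by (intro tendsto_intros filterlim_compose[OF w sub])
    show ?thesis using LIMSEQ_le[OF l1 l2] * by simp
  qed
  then have "\<forall>\<^sub>F n in sequentially. \<bar>x n\<bar> \<le> e * w n"
    using eventually_sequentially by blast
  then show "\<forall>\<^sub>F n in sequentially. norm (x n) \<le> e * norm (w n)"
  proof eventually_elim
    case (elim n)
    \<comment> \<open>Nonnegativity of w comes for free from the bound just obtained.\<close>
    then have "0 \<le> e * w n" by linarith
    with e have "w n \<ge> 0" by (simp add: zero_le_mult_iff)
    with elim show ?case by simp
  qed
qed

text \<open>The increments of x - L w are eventually at most e/2 times those of w. Summed from a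
  fixed N they give |x n - L w n| \<le> C + (e/2) w n, and C is swallowed because w tends to
  infinity.\<close>

lemma stolz_cesaro_at_top:
  fixes x w :: "nat \<Rightarrow> real"
  assumes w: "filterlim w at_top sequentially"
    and mono: "\<forall>\<^sub>F n in sequentially. w n < w (Suc n)"
    and lim: "(\<lambda>n. (x (Suc n) - x n) / (w (Suc n) - w n)) \<longlonglongrightarrow> L"
  shows "(\<lambda>n. x n / w n) \<longlonglongrightarrow> L"
proof (rule tendstoI)
  fix e :: real assume e: "e > 0"
  from tendstoD[OF lim half_gt_zero[OF e]] mono
  have "\<forall>\<^sub>F n in sequentially.
      \<bar>(x (Suc n) - L * w (Suc n)) - (x n - L * w n)\<bar> \<le> e / 2 * (w (Suc n) - w n)"
  proof eventually_elim
    case (elim n)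
    then have "\<bar>(x (Suc n) - x n) / (w (Suc n) - w n) - L\<bar> * (w (Suc n) - w n)
        \<le> e / 2 * (w (Suc n) - w n)"
      by (intro mult_right_mono) (auto simp: dist_real_def)
    also have "\<bar>(x (Suc n) - x n) / (w (Suc n) - w n) - L\<bar> * (w (Suc n) - w n) =
        \<bar>((x (Suc n) - x n) / (w (Suc n) - w n) - L) * (w (Suc n) - w n)\<bar>"
      using elim by (simp add: abs_mult)
    also have "((x (Suc n) - x n) / (w (Suc n) - w n) - L) * (w (Suc n) - w n) =
        (x (Suc n) - L * w (Suc n)) - (x n - L * w n)"
      using elim by (simp add: field_simps)
    finally show ?case .
  qed
  then obtain N where N: "\<And>n. n \<ge> N \<Longrightarrow>
      \<bar>(x (Suc n) - L * w (Suc n)) - (x n - L * w n)\<bar> \<le> e / 2 * (w (Suc n) - w n)"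
    by (auto simp: eventually_sequentially)
  define C where "C = \<bar>x N - L * w N\<bar> + e / 2 * \<bar>w N\<bar>"
  have *: "\<bar>(x n - L * w n) - (x N - L * w N)\<bar> \<le> e / 2 * (w n - w N)" if "n \<ge> N" for n
    using that
  proof (induction n rule: dec_induct)
    case (step n)
    have "e / 2 * (w (Suc n) - w N) = e / 2 * (w (Suc n) - w n) + e / 2 * (w n - w N)"
      by (simp flip: distrib_left)
    with step N[of n] show ?case by linarith
  qed simp
  have "\<forall>\<^sub>F n in sequentially. w n > 0" "\<forall>\<^sub>F n in sequentially. w n > 2 * C / e"
    using w by (auto simp: filterlim_at_top_dense)
  then show "\<forall>\<^sub>F n in sequentially. dist (x n / w n) L < e"
    using eventually_ge_at_top[of N]
  proof eventually_elim
    case (elim n)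
    have "e / 2 * (- w N) \<le> e / 2 * \<bar>w N\<bar>" using e by (intro mult_left_mono) auto
    then have "\<bar>x n - L * w n\<bar> \<le> C + e / 2 * w n"
    proof -
      have "e / 2 * (w n - w N) = e / 2 * w n + e / 2 * (- w N)"
        by (simp add: right_diff_distrib diff_divide_distrib)
      with \<open>e / 2 * (- w N) \<le> _\<close> *[OF elim(3)] show ?thesis unfolding C_def by linarith
    qed
    also have "\<dots> < e * w n" using elim e by (simp add: field_simps)
    finally have "\<bar>x n - L * w n\<bar> / w n < e" using elim by (simp add: field_simps)
    moreover have "x n / w n - L = (x n - L * w n) / w n" using elim by (simp add: field_simps)
    ultimately show ?case using elim by (simp add: dist_real_def abs_divide)
  qed
qed

text \<open>This quotient is the homogeneous solution of the recurrences for the moments and for the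
  Beta function; dividing by it turns them into plain difference equations.\<close>

lemma Gamma_ratio_rec:
  assumes "real m > \<phi>" "\<phi> > 0"
  shows "Gamma (real (Suc m) - \<phi>) / Gamma (real (Suc m) + \<phi> + 1) * (real m + 1 + \<phi>) =
    Gamma (real m - \<phi>) / Gamma (real m + \<phi> + 1) * (real m - \<phi>)"
proof -
  have "Gamma (real (Suc m) - \<phi>) = (real m - \<phi>) * Gamma (real m - \<phi>)"
    using Gamma_plus1[of "real m - \<phi>"] assms nonpos_Ints_nonpos[of "real m - \<phi>"]
    by (auto simp: algebra_simps)
  moreover have "Gamma (real (Suc m) + \<phi> + 1) = (real m + \<phi> + 1) * Gamma (real m + \<phi> + 1)"
    using Gamma_plus1[of "real m + \<phi> + 1"] assms nonpos_Ints_nonpos[of "real m + \<phi> + 1"]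
    by (auto simp: algebra_simps)
  moreover have "Gamma (real m + \<phi> + 1) > 0" using assms by (intro Gamma_real_pos) auto
  ultimately show ?thesis using assms by (simp add: divide_simps)
qed

lemma pochhammer_ratio_limit:
  fixes z z' :: real
  assumes z': "z' > 0"
  shows "(\<lambda>n. pochhammer z (n + 1) / pochhammer z' (n + 1) * real n powr (z' - z))
    \<longlonglongrightarrow> rGamma z / rGamma z'"
proof -
  have nz: "rGamma z' \<noteq> 0" using z' nonpos_Ints_nonpos[of z'] by (auto simp: rGamma_eq_zero_iff)
  have "(\<lambda>n. rGamma_series z n / rGamma_series z' n) \<longlonglongrightarrow> rGamma z / rGamma z'"
    by (intro tendsto_divide rGamma_series_LIMSEQ nz)
  moreover have "\<forall>\<^sub>F n in sequentially. rGamma_series z n / rGamma_series z' n =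
      pochhammer z (n + 1) / pochhammer z' (n + 1) * real n powr (z' - z)"
    using eventually_gt_at_top[of 0]
  proof eventually_elim
    case (elim n)
    have "pochhammer z' (n + 1) > 0" using z' by (rule pochhammer_pos)
    with elim show ?case
      by (simp add: rGamma_series_def powr_def exp_diff ring_distribs field_simps)
  qed
  ultimately show ?thesis by (rule Lim_transform_eventually)
qed

lemma Gamma_ratio_limit:
  fixes \<phi> :: real
  assumes \<phi>: "\<phi> > 0"
  shows "(\<lambda>m. Gamma (real m - \<phi>) / Gamma (real m + \<phi> + 1) * real m powr (2 * \<phi> + 1)) \<longlonglongrightarrow> 1"
proof -
  \<comment> \<open>The shift by M makes both Gamma arguments positive, so that they become
    Pochhammer symbols over the fixed base points z and z'. \<open>LIMSEQ_offset\<close> undoes it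
    at the end.\<close>
  define M where "M = Suc (nat \<lfloor>\<phi>\<rfloor>)"
  have M: "real M > \<phi>" using \<phi> unfolding M_def by linarith
  define z z' where "z = real M - \<phi>" and "z' = real M + \<phi> + 1"
  have z: "z > 0" "z' > 0" "z' - z = 2 * \<phi> + 1" using M \<phi> by (auto simp: z_def z'_def)
  then have ni: "z \<notin> \<int>\<^sub>\<le>\<^sub>0" "z' \<notin> \<int>\<^sub>\<le>\<^sub>0" using nonpos_Ints_nonpos by force+
  have "(\<lambda>n. (pochhammer z (n + 1) / pochhammer z' (n + 1) * real n powr (z' - z)) *
      ((real n + real (M + 1)) / real n) powr (2 * \<phi> + 1)) \<longlonglongrightarrow> rGamma z / rGamma z' * 1 powr (2 * \<phi> + 1)"
  proof (rule tendsto_mult[OF pochhammer_ratio_limit[OF z(2)]])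
    have "(\<lambda>n. (real n + real (M + 1)) / real n) \<longlonglongrightarrow> 1" by real_asymp
    then show "(\<lambda>n. ((real n + real (M + 1)) / real n) powr (2 * \<phi> + 1)) \<longlonglongrightarrow> 1 powr (2 * \<phi> + 1)"
      by (intro tendsto_powr tendsto_const) auto
  qed
  then have "(\<lambda>n. (pochhammer z (n + 1) / pochhammer z' (n + 1) * real n powr (z' - z)) *
      ((real n + real (M + 1)) / real n) powr (2 * \<phi> + 1) * (Gamma z / Gamma z'))
        \<longlonglongrightarrow> rGamma z / rGamma z' * 1 powr (2 * \<phi> + 1) * (Gamma z / Gamma z')"
    by (rule tendsto_mult) (rule tendsto_const)
  also have "rGamma z / rGamma z' * 1 powr (2 * \<phi> + 1) * (Gamma z / Gamma z') = 1"
    using ni by (simp add: Gamma_def rGamma_eq_zero_iff)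
  finally have "(\<lambda>n. (pochhammer z (n + 1) / pochhammer z' (n + 1) * real n powr (z' - z)) *
      ((real n + real (M + 1)) / real n) powr (2 * \<phi> + 1) * (Gamma z / Gamma z')) \<longlonglongrightarrow> 1" .
  moreover have "\<forall>\<^sub>F n in sequentially. (pochhammer z (n + 1) / pochhammer z' (n + 1) * real n powr (z' - z)) *
      ((real n + real (M + 1)) / real n) powr (2 * \<phi> + 1) * (Gamma z / Gamma z') =
      Gamma (real (n + (M + 1)) - \<phi>) / Gamma (real (n + (M + 1)) + \<phi> + 1) * real (n + (M + 1)) powr (2 * \<phi> + 1)"
    using eventually_gt_at_top[of 0]
  proof eventually_elim
    case (elim n)
    have "Gamma z > 0" "Gamma z' > 0" using z by (auto intro: Gamma_real_pos)
    moreover have "z + real (n + 1) = real (n + (M + 1)) - \<phi>" "z' + real (n + 1) = real (n + (M + 1)) + \<phi> + 1"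
      by (auto simp: z_def z'_def)
    moreover have "pochhammer z (n + 1) = Gamma (z + real (n + 1)) / Gamma z"
      "pochhammer z' (n + 1) = Gamma (z' + real (n + 1)) / Gamma z'"
      by (rule pochhammer_Gamma[OF ni(1)], rule pochhammer_Gamma[OF ni(2)])
    moreover have "real n + real (M + 1) = real (n + (M + 1))" by simp
    ultimately show ?case
      using elim by (simp only: z(3) powr_divide of_nat_0_le_iff) simp
  qed
  ultimately have "(\<lambda>n. Gamma (real (n + (M + 1)) - \<phi>) / Gamma (real (n + (M + 1)) + \<phi> + 1) *
      real (n + (M + 1)) powr (2 * \<phi> + 1)) \<longlonglongrightarrow> 1"
    by (rule Lim_transform_eventually)
  then show ?thesis by (rule LIMSEQ_offset)
qed

text \<open>Variation of constants: for X = Y / y with the Gamma quotient y, the increment of X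
  (j+1) is -(j+1) times the sum of X j (m+1) / (m+1+\<phi>) and X j m / (m-\<phi>), about -2 (j+1) X
  j m / m, while ln^(j+1) grows by about (j+1) ln^j m / m. Stolz-Cesaro therefore yields one factor
  -2 for each step in j.\<close>

lemma log_recurrence_limit:
  fixes \<phi> \<kappa> :: real and Y :: "nat \<Rightarrow> nat \<Rightarrow> real"
  assumes \<phi>: "\<phi> > 0"
    and rec: "\<And>j. \<forall>\<^sub>F m in sequentially.
      Y (Suc j) (Suc m) * (real m + 1 + \<phi>) + real (Suc j) * Y j (Suc m) =
      Y (Suc j) m * (real m - \<phi>) - real (Suc j) * Y j m"
    and base: "(\<lambda>m. Y 0 m * real m powr (2 * \<phi> + 1)) \<longlonglongrightarrow> \<kappa>"
  shows "(\<lambda>m. Y j m * real m powr (2 * \<phi> + 1) / ln (real m) ^ j) \<longlonglongrightarrow> \<kappa> * (-2) ^ j"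
proof -
  define y where "y m = Gamma (real m - \<phi>) / Gamma (real m + \<phi> + 1)" for m
  define X where "X j m = Y j m / y m" for j m
  note y_lim = Gamma_ratio_limit[OF \<phi>, folded y_def]
  have large: "\<forall>\<^sub>F m in sequentially. real m > \<phi>"
    using filterlim_real_sequentially by (simp add: filterlim_at_top_dense)
  have y_pos: "y m > 0" if "real m > \<phi>" for m
    using that \<phi> unfolding y_def by (intro divide_pos_pos Gamma_real_pos) auto
  have X_lim: "(\<lambda>m. X j m / ln (real m) ^ j) \<longlonglongrightarrow> \<kappa> * (-2) ^ j" for j
  proof (induction j)
    case 0
    have "(\<lambda>m. (Y 0 m * real m powr (2 * \<phi> + 1)) / (y m * real m powr (2 * \<phi> + 1))) \<longlonglongrightarrow> \<kappa> / 1"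
      by (intro tendsto_divide base y_lim) auto
    moreover have "\<forall>\<^sub>F m in sequentially.
        (Y 0 m * real m powr (2 * \<phi> + 1)) / (y m * real m powr (2 * \<phi> + 1)) = X 0 m / ln (real m) ^ 0"
      using eventually_gt_at_top[of 0] by eventually_elim (auto simp: X_def)
    ultimately show ?case by (auto intro: Lim_transform_eventually)
  next
    case (Suc j)
    show ?case
    proof (rule stolz_cesaro_at_top)
      show "filterlim (\<lambda>n. ln (real n) ^ Suc j) at_top sequentially" by real_asymp
      show "\<forall>\<^sub>F n in sequentially. ln (real n) ^ Suc j < ln (real (Suc n)) ^ Suc j"
        using eventually_gt_at_top[of 1] by eventually_elim (intro power_strict_mono, auto)
      have a1: "(\<lambda>m. ln (real (Suc m)) ^ j / (real m + 1 + \<phi>) / (ln (real (Suc m)) ^ Suc j - ln (real m) ^ Suc j)) \<longlonglongrightarrow> inverse (1 + real j)"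
        by real_asymp
      have a2: "(\<lambda>m. ln (real m) ^ j / (real m - \<phi>) / (ln (real (Suc m)) ^ Suc j - ln (real m) ^ Suc j)) \<longlonglongrightarrow> inverse (1 + real j)"
        by real_asymp
      have "(\<lambda>m. - real (Suc j) * (X j (Suc m) / ln (real (Suc m)) ^ j * (ln (real (Suc m)) ^ j / (real m + 1 + \<phi>) / (ln (real (Suc m)) ^ Suc j - ln (real m) ^ Suc j))
         + X j m / ln (real m) ^ j * (ln (real m) ^ j / (real m - \<phi>) / (ln (real (Suc m)) ^ Suc j - ln (real m) ^ Suc j))))
        \<longlonglongrightarrow> - real (Suc j) * (\<kappa> * (-2) ^ j * inverse (1 + real j) + \<kappa> * (-2) ^ j * inverse (1 + real j))"
        by (intro tendsto_intros a1 a2 Suc LIMSEQ_Suc[OF Suc])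
      also have "- real (Suc j) * (\<kappa> * (-2) ^ j * inverse (1 + real j) + \<kappa> * (-2) ^ j * inverse (1 + real j)) = \<kappa> * (- 2) ^ Suc j"
      proof -
        have "real (Suc j) * inverse (1 + real j) = 1" by simp
        then have "- real (Suc j) * (c * inverse (1 + real j) + c * inverse (1 + real j)) = - 2 * c" for c
          by algebra
        from this[of "\<kappa> * (-2) ^ j"] show ?thesis by (simp only: power_Suc mult_ac)
      qed
      finally have lim: "(\<lambda>m. - real (Suc j) * (X j (Suc m) / ln (real (Suc m)) ^ j * (ln (real (Suc m)) ^ j / (real m + 1 + \<phi>) / (ln (real (Suc m)) ^ Suc j - ln (real m) ^ Suc j))
         + X j m / ln (real m) ^ j * (ln (real m) ^ j / (real m - \<phi>) / (ln (real (Suc m)) ^ Suc j - ln (real m) ^ Suc j))))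
        \<longlonglongrightarrow> \<kappa> * (- 2) ^ Suc j" .
      show "(\<lambda>n. (X (Suc j) (Suc n) - X (Suc j) n) / (ln (real (Suc n)) ^ Suc j - ln (real n) ^ Suc j)) \<longlonglongrightarrow> \<kappa> * (- 2) ^ Suc j"
      proof (rule Lim_transform_eventually[OF lim])
        show "\<forall>\<^sub>F m in sequentially. - real (Suc j) * (X j (Suc m) / ln (real (Suc m)) ^ j * (ln (real (Suc m)) ^ j / (real m + 1 + \<phi>) / (ln (real (Suc m)) ^ Suc j - ln (real m) ^ Suc j))
         + X j m / ln (real m) ^ j * (ln (real m) ^ j / (real m - \<phi>) / (ln (real (Suc m)) ^ Suc j - ln (real m) ^ Suc j)))
         = (X (Suc j) (Suc m) - X (Suc j) m) / (ln (real (Suc m)) ^ Suc j - ln (real m) ^ Suc j)"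
          using rec[of j] large eventually_gt_at_top[of 1]
        proof eventually_elim
          case (elim m)
          define p where "p = real m + 1 + \<phi>"
          define q where "q = real m - \<phi>"
          define v where "v = y (Suc m)"
          have pos: "p > 0" "q > 0" "v > 0" using elim \<phi> y_pos[of "Suc m"] by (auto simp: p_def q_def v_def)
          \<comment> \<open>The homogeneous recurrence eliminates y m, so that the increment of X
            gets the common denominator v * p and the recurrence for Y applies to its
            numerator.\<close>
          have "v * p = y m * q"
            unfolding v_def p_def q_def y_def by (rule Gamma_ratio_rec) (use elim \<phi> in auto)
          then have yq: "y m = v * p / q" using pos by (simp add: field_simps)
          have L: "ln (real (Suc m)) > 0" "ln (real m) > 0" using elim by auto
          have r: "Y (Suc j) (Suc m) * p = Y (Suc j) m * q - real (Suc j) * (Y j m + Y j (Suc m))"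
            using elim by (simp add: p_def q_def algebra_simps)
          have "X (Suc j) (Suc m) - X (Suc j) m = (Y (Suc j) (Suc m) * p - Y (Suc j) m * q) / (v * p)"
            using pos by (simp add: X_def yq v_def[symmetric] field_simps)
          also have "\<dots> = - real (Suc j) * (Y j (Suc m) + Y j m) / (v * p)" unfolding r by (simp add: algebra_simps)
          also have "\<dots> = - real (Suc j) * (X j (Suc m) / p + X j m / q)"
            using pos by (simp add: X_def yq v_def[symmetric] field_simps)
          finally have *: "X (Suc j) (Suc m) - X (Suc j) m = - real (Suc j) * (X j (Suc m) / p + X j m / q)" .
          define D where "D = ln (real (Suc m)) ^ Suc j - ln (real m) ^ Suc j"
          have "x / ln (real (Suc m)) ^ j * (ln (real (Suc m)) ^ j / p / D) = x / p / D"
            "x / ln (real m) ^ j * (ln (real m) ^ j / q / D) = x / q / D" for x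
            using L by auto
          then show ?case unfolding * p_def[symmetric] q_def[symmetric] D_def[symmetric]
            by (simp only: times_divide_eq_right) (simp only: add_divide_distrib[symmetric] times_divide_eq_right)
        qed
      qed
    qed
  qed
  have "(\<lambda>m. X j m / ln (real m) ^ j * (y m * real m powr (2 * \<phi> + 1))) \<longlonglongrightarrow> \<kappa> * (-2) ^ j * 1"
    by (intro tendsto_mult X_lim y_lim)
  moreover have "\<forall>\<^sub>F m in sequentially. X j m / ln (real m) ^ j * (y m * real m powr (2 * \<phi> + 1)) =
      Y j m * real m powr (2 * \<phi> + 1) / ln (real m) ^ j"
    using large by eventually_elim (use y_pos in \<open>force simp: X_def\<close>)
  ultimately show ?thesis by (auto intro: Lim_transform_eventually)
qed

subsection \<open>Functions with controlled endpoint behaviour\<close>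

definition edge :: "real \<Rightarrow> real" where
  "edge t = min t (pi - t)"

lemma edge_pos: "t \<in> {0<..<pi} \<Longrightarrow> edge t > 0"
  and edge_le_pi: "t \<in> {0<..<pi} \<Longrightarrow> edge t \<le> pi"
  by (auto simp: edge_def)

lemma sin_le_edge: "t \<in> {0<..<pi} \<Longrightarrow> sin t \<le> edge t"
  using sin_x_le_x[of t] sin_x_le_x[of "pi - t"] by (auto simp: edge_def)

text \<open>Up to \<pi>/3 the mean value theorem gives sin x = x cos z with cos z \<ge> 1/2 \<ge>
  1/\<pi>; from there to \<pi>/2 the sine is at least 1/2 \<ge> x/\<pi>. The right half follows by
  reflection. The constant is not sharp; only its positivity matters.\<close>

lemma sin_ge_edge:
  assumes t: "t \<in> {0<..<pi}"
  shows "sin t \<ge> edge t / pi"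
proof -
  have *: "sin x \<ge> x / pi" if x: "0 < x" "x \<le> pi / 2" for x
  proof (cases "x \<le> pi / 3")
    case True
    have "\<exists>z. 0 < z \<and> z < x \<and> sin x - sin 0 = (x - 0) * cos z"
      using x by (intro MVT2) (auto intro!: derivative_eq_intros)
    then obtain z where z: "0 < z" "z < x" "sin x = x * cos z" by auto
    have "cos z \<ge> cos (pi / 3)" using z True x by (intro cos_monotone_0_pi_le) auto
    then have "cos z \<ge> 1 / 2" by (simp add: cos_60)
    moreover have "1 / pi \<le> 1 / 2" using pi_gt3 by (intro divide_left_mono) auto
    ultimately have "cos z \<ge> 1 / pi" by linarith
    then have "x * (1 / pi) \<le> x * cos z" using x by (intro mult_left_mono) auto
    with z show ?thesis by simp
  next
    case False
    have "sin (pi / 6) \<le> sin x" using x False by (intro sin_monotone_2pi_le) auto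
    moreover have "x / pi \<le> 1 / 2" using x by (simp add: field_simps)
    ultimately show ?thesis unfolding sin_30 by linarith
  qed
  show ?thesis using t *[of t] *[of "pi - t"] by (auto simp: edge_def min_def)
qed

text \<open>A symbol class: K derivatives are controlled, and each may lose one order at the
  endpoints. The derivative is an existential witness, so closure properties are shown by exhibiting
  a formula for it. Continuity is demanded only at level 0 because at higher levels
  differentiability supplies it.\<close>

primrec endpoint_class :: "nat \<Rightarrow> real \<Rightarrow> (real \<Rightarrow> real) \<Rightarrow> bool" where
  "endpoint_class 0 s f \<longleftrightarrow> continuous_on {0<..<pi} f \<and>
     (\<exists>C. \<forall>t\<in>{0<..<pi}. \<bar>f t\<bar> \<le> C * edge t powr s)"
| "endpoint_class (Suc K) s f \<longleftrightarrow> (\<exists>C. \<forall>t\<in>{0<..<pi}. \<bar>f t\<bar> \<le> C * edge t powr s) \<and>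
     (\<exists>f'. (\<forall>t\<in>{0<..<pi}. (f has_real_derivative f' t) (at t)) \<and> endpoint_class K (s - 1) f')"

lemma endpoint_class_SucI:
  assumes "\<exists>C. \<forall>t\<in>{0<..<pi}. \<bar>f t\<bar> \<le> C * edge t powr s"
    and "\<And>t. t \<in> {0<..<pi} \<Longrightarrow> (f has_real_derivative f' t) (at t)"
    and "endpoint_class K (s - 1) f'"
  shows "endpoint_class (Suc K) s f"
  unfolding endpoint_class.simps using assms by blast

lemma endpoint_class_SucE:
  assumes "endpoint_class (Suc K) s f"
  obtains C f' where "\<forall>t\<in>{0<..<pi}. \<bar>f t\<bar> \<le> C * edge t powr s"
    "\<And>t. t \<in> {0<..<pi} \<Longrightarrow> (f has_real_derivative f' t) (at t)" "endpoint_class K (s - 1) f'"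
  using assms unfolding endpoint_class.simps by blast

lemma endpoint_class_0I:
  assumes "continuous_on {0<..<pi} f" "\<exists>C. \<forall>t\<in>{0<..<pi}. \<bar>f t\<bar> \<le> C * edge t powr s"
  shows "endpoint_class 0 s f"
  unfolding endpoint_class.simps using assms by blast

lemma endpoint_class_bound:
  assumes "endpoint_class K s f"
  obtains C where "C \<ge> 0" "\<And>t. t \<in> {0<..<pi} \<Longrightarrow> \<bar>f t\<bar> \<le> C * edge t powr s"
proof -
  from assms have "\<exists>C. \<forall>t\<in>{0<..<pi}. \<bar>f t\<bar> \<le> C * edge t powr s"
    by (cases K) auto
  then obtain C where C: "\<And>t. t \<in> {0<..<pi} \<Longrightarrow> \<bar>f t\<bar> \<le> C * edge t powr s"
    by blast
  have "0 \<le> C * edge (pi / 2) powr s" using C[of "pi / 2"] by force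
  moreover have "edge (pi / 2) powr s > 0" using edge_pos[of "pi / 2"] by simp
  ultimately have "C \<ge> 0" by (simp add: zero_le_mult_iff)
  with C that show thesis by blast
qed

lemma endpoint_class_continuous:
  assumes "endpoint_class K s f"
  shows "continuous_on {0<..<pi} f"
proof (cases K)
  case (Suc K')
  with assms have "endpoint_class (Suc K') s f" by simp
  then show ?thesis
    by (elim endpoint_class_SucE) (meson DERIV_isCont continuous_at_imp_continuous_on)
qed (use assms in auto)

text \<open>The interval is bounded, so surplus powers of \<open>edge\<close> are absorbed by a
  power of \<pi> in the constant. This serves to forget orders when a derivative is better than the
  class asks for.\<close>

lemma endpoint_class_mono:
  assumes "endpoint_class K s f" "s' \<le> s"
  shows "endpoint_class K s' f"
  using assms
proof (induction K arbitrary: s s' f)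
  have bd: "\<exists>C. \<forall>t\<in>{0<..<pi}. \<bar>f t\<bar> \<le> C * edge t powr s'"
    if "s' \<le> s" "\<forall>t\<in>{0<..<pi}. \<bar>f t\<bar> \<le> C * edge t powr s" for f C s s'
  proof (intro exI ballI)
    fix t assume t: "t \<in> {0<..<pi}"
    have "\<bar>f t\<bar> \<le> \<bar>C\<bar> * edge t powr s"
      using that(2) t by (meson abs_ge_self mult_right_mono order_trans powr_ge_zero)
    also have "edge t powr s = edge t powr (s - s') * edge t powr s'"
      using edge_pos[OF t] by (simp flip: powr_add)
    also have "\<dots> \<le> pi powr (s - s') * edge t powr s'"
      using t that by (intro mult_right_mono powr_mono2 edge_le_pi) (auto intro!: less_imp_le edge_pos)
    finally have "\<bar>f t\<bar> \<le> \<bar>C\<bar> * (pi powr (s - s') * edge t powr s')"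
      by (simp add: mult_left_mono)
    then show "\<bar>f t\<bar> \<le> (\<bar>C\<bar> * pi powr (s - s')) * edge t powr s'"
      by (simp add: mult_ac)
  qed
  {
    case 0
    then obtain C where "\<forall>t\<in>{0<..<pi}. \<bar>f t\<bar> \<le> C * edge t powr s" by auto
    with 0(2) show ?case by (intro endpoint_class_0I bd endpoint_class_continuous[OF 0(1)])
  next
    case (Suc K)
    obtain C f' where C: "\<forall>t\<in>{0<..<pi}. \<bar>f t\<bar> \<le> C * edge t powr s"
      and f': "\<And>t. t \<in> {0<..<pi} \<Longrightarrow> (f has_real_derivative f' t) (at t)" "endpoint_class K (s - 1) f'"
      using endpoint_class_SucE[OF Suc.prems(1)] by blast
    have "endpoint_class K (s' - 1) f'" using Suc.IH[OF f'(2)] Suc.prems by auto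
    show ?case by (rule endpoint_class_SucI[OF bd[OF Suc.prems(2) C]]) fact+
  }
qed

lemma endpoint_class_Suc: "endpoint_class (Suc K) s f \<Longrightarrow> endpoint_class K s f"
proof (induction K arbitrary: s f)
  case 0
  then show ?case
    by (intro endpoint_class_0I endpoint_class_continuous[OF 0]) (auto elim: endpoint_class_SucE)
next
  case (Suc K)
  obtain C f' where f': "\<forall>t\<in>{0<..<pi}. \<bar>f t\<bar> \<le> C * edge t powr s"
      "\<And>t. t \<in> {0<..<pi} \<Longrightarrow> (f has_real_derivative f' t) (at t)" "endpoint_class (Suc K) (s - 1) f'"
    using endpoint_class_SucE[OF Suc.prems] by blast
  show ?case by (rule endpoint_class_SucI[of _ _ f']) (use f' Suc.IH in blast)+
qed

lemma endpoint_class_cong: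
  assumes "endpoint_class K s f" "\<And>t. t \<in> {0<..<pi} \<Longrightarrow> f t = g t"
  shows "endpoint_class K s g"
proof -
  have d: "(g has_real_derivative d) (at t)" if "(f has_real_derivative d) (at t)" "t \<in> {0<..<pi}" for d t
    using that assms(2) by (auto intro: has_field_derivative_transform_within_open)
  show ?thesis
  proof (cases K)
    case 0
    have "continuous_on {0<..<pi} f \<longleftrightarrow> continuous_on {0<..<pi} g"
      by (rule continuous_on_cong[OF refl assms(2)])
    with 0 show ?thesis using assms by auto
  next
    case (Suc K')
    obtain C f' where f': "\<forall>t\<in>{0<..<pi}. \<bar>f t\<bar> \<le> C * edge t powr s"
      "\<And>t. t \<in> {0<..<pi} \<Longrightarrow> (f has_real_derivative f' t) (at t)" "endpoint_class K' (s - 1) f'"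
      using endpoint_class_SucE[OF assms(1)[unfolded Suc]] by blast
    have "\<forall>t\<in>{0<..<pi}. \<bar>g t\<bar> \<le> C * edge t powr s" using f'(1) assms(2) by simp
    then show ?thesis unfolding Suc by (intro endpoint_class_SucI[of _ _ f']) (use f' d in blast)+
  qed
qed

lemma endpoint_class_add:
  assumes "endpoint_class K s f" "endpoint_class K s g"
  shows "endpoint_class K s (\<lambda>t. f t + g t)"
  using assms
proof (induction K arbitrary: s f g)
  have bd: "\<exists>C. \<forall>t\<in>{0<..<pi}. \<bar>f t + g t\<bar> \<le> C * edge t powr s"
    if fg: "endpoint_class K s f" "endpoint_class K s g" for f g K s
  proof -
    obtain C where C: "C \<ge> 0" "\<And>t. t \<in> {0<..<pi} \<Longrightarrow> \<bar>f t\<bar> \<le> C * edge t powr s"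
      using endpoint_class_bound[OF fg(1)] by blast
    obtain D where D: "D \<ge> 0" "\<And>t. t \<in> {0<..<pi} \<Longrightarrow> \<bar>g t\<bar> \<le> D * edge t powr s"
      using endpoint_class_bound[OF fg(2)] by blast
    have "\<bar>f t + g t\<bar> \<le> (C + D) * edge t powr s" if "t \<in> {0<..<pi}" for t
      using C(2)[OF that] D(2)[OF that] by (simp add: algebra_simps)
    then show ?thesis by blast
  qed
  {
    case 0
    then show ?case
      by (intro endpoint_class_0I continuous_on_add bd[OF 0] endpoint_class_continuous[OF 0(1)] endpoint_class_continuous[OF 0(2)])
  next
    case (Suc K)
    obtain Cf f' where "\<forall>t\<in>{0<..<pi}. \<bar>f t\<bar> \<le> Cf * edge t powr s"
      and f': "\<And>t. t \<in> {0<..<pi} \<Longrightarrow> (f has_real_derivative f' t) (at t)"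
      "endpoint_class K (s - 1) f'" using endpoint_class_SucE[OF Suc.prems(1)] by blast
    obtain Cg g' where "\<forall>t\<in>{0<..<pi}. \<bar>g t\<bar> \<le> Cg * edge t powr s"
      and g': "\<And>t. t \<in> {0<..<pi} \<Longrightarrow> (g has_real_derivative g' t) (at t)"
      "endpoint_class K (s - 1) g'" using endpoint_class_SucE[OF Suc.prems(2)] by blast
    show ?case
      by (rule endpoint_class_SucI[OF bd[OF Suc.prems], of "\<lambda>t. f' t + g' t"]) (rule DERIV_add f' g' Suc.IH | assumption)+
  }
qed

lemma endpoint_class_mult:
  assumes "endpoint_class K s f" "endpoint_class K s' g"
  shows "endpoint_class K (s + s') (\<lambda>t. f t * g t)"
  using assms
proof (induction K arbitrary: s s' f g)
  have bd: "\<exists>C. \<forall>t\<in>{0<..<pi}. \<bar>f t * g t\<bar> \<le> C * edge t powr (s + s')"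
    if fg: "endpoint_class K s f" "endpoint_class K s' g" for f g K s s'
  proof -
    obtain C where C: "C \<ge> 0" "\<And>t. t \<in> {0<..<pi} \<Longrightarrow> \<bar>f t\<bar> \<le> C * edge t powr s"
      using endpoint_class_bound[OF fg(1)] by blast
    obtain D where D: "D \<ge> 0" "\<And>t. t \<in> {0<..<pi} \<Longrightarrow> \<bar>g t\<bar> \<le> D * edge t powr s'"
      using endpoint_class_bound[OF fg(2)] by blast
    have "\<bar>f t * g t\<bar> \<le> (C * D) * edge t powr (s + s')" if "t \<in> {0<..<pi}" for t
    proof -
      have "\<bar>f t * g t\<bar> \<le> (C * edge t powr s) * (D * edge t powr s')"
        unfolding abs_mult using C D that by (intro mult_mono) auto
      then show ?thesis by (simp add: powr_add mult_ac)
    qed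
    then show ?thesis by blast
  qed
  {
    case 0
    then show ?case
      by (intro endpoint_class_0I continuous_on_mult bd[OF 0] endpoint_class_continuous[OF 0(1)] endpoint_class_continuous[OF 0(2)])
  next
    case (Suc K)
    obtain Cf f' where "\<forall>t\<in>{0<..<pi}. \<bar>f t\<bar> \<le> Cf * edge t powr s"
      and f': "\<And>t. t \<in> {0<..<pi} \<Longrightarrow> (f has_real_derivative f' t) (at t)"
      "endpoint_class K (s - 1) f'" using endpoint_class_SucE[OF Suc.prems(1)] by blast
    obtain Cg g' where "\<forall>t\<in>{0<..<pi}. \<bar>g t\<bar> \<le> Cg * edge t powr s'"
      and g': "\<And>t. t \<in> {0<..<pi} \<Longrightarrow> (g has_real_derivative g' t) (at t)"
      "endpoint_class K (s' - 1) g'" using endpoint_class_SucE[OF Suc.prems(2)] by blast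
    have "endpoint_class K (s - 1 + s') (\<lambda>t. f' t * g t)" "endpoint_class K (s + (s' - 1)) (\<lambda>t. f t * g' t)"
      by (rule Suc.IH f' g' Suc.prems[THEN endpoint_class_Suc])+
    then have "endpoint_class K (s + s' - 1) (\<lambda>t. f' t * g t + f t * g' t)"
      by (intro endpoint_class_add) (simp_all add: algebra_simps)
    moreover have "((\<lambda>t. f t * g t) has_real_derivative f' t * g t + f t * g' t) (at t)"
      if "t \<in> {0<..<pi}" for t
      using f'(1)[OF that] g'(1)[OF that] by (auto intro!: derivative_eq_intros)
    show ?case by (rule endpoint_class_SucI[OF bd[OF Suc.prems]], fact+)
  }
qed

lemma endpoint_class_const: "endpoint_class K 0 (\<lambda>t. c)"
proof -
  \<comment> \<open>The zero function has every order, so it can serve as the derivative of a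
    constant, for which order -1 and below is required.\<close>
  have zero: "endpoint_class K s (\<lambda>t. 0)" for s K
    by (induction K arbitrary: s) (auto intro!: exI[of _ 0] exI[of _ "\<lambda>_. 0"])
  have bd: "\<exists>C. \<forall>t\<in>{0<..<pi}. \<bar>c\<bar> \<le> C * edge t powr 0"
    using edge_pos by (intro exI[of _ "\<bar>c\<bar>"]) force
  show ?thesis
  proof (cases K)
    case 0
    then show ?thesis using bd by (auto simp only: intro!: endpoint_class_0I continuous_on_const)
  next
    case (Suc K')
    show ?thesis unfolding Suc
      by (rule endpoint_class_SucI[OF bd DERIV_const]) (rule zero)
  qed
qed

lemma endpoint_class_cmult: "endpoint_class K s f \<Longrightarrow> endpoint_class K s (\<lambda>t. c * f t)"
  using endpoint_class_mult[OF endpoint_class_const, of K s f c] by simp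

text \<open>Proved jointly because each function is, up to sign, the derivative of the other. The
  derivative of cos has order 1 where only -1 is needed.\<close>

lemma endpoint_class_cos_sin: "endpoint_class K 0 cos \<and> endpoint_class K 1 sin"
proof (induction K)
  have "\<bar>cos t\<bar> \<le> 1 * edge t powr 0" if "t \<in> {0<..<pi}" for t
    using edge_pos[OF that] by simp
  then have cos_bd: "\<exists>C. \<forall>t\<in>{0<..<pi}. \<bar>cos t\<bar> \<le> C * edge t powr 0" by blast
  have "\<bar>sin t\<bar> \<le> 1 * edge t powr 1" if "t \<in> {0<..<pi}" for t
    using edge_pos[OF that] sin_le_edge[OF that] that sin_gt_zero[of t] by simp
  then have sin_bd: "\<exists>C. \<forall>t\<in>{0<..<pi}. \<bar>sin t\<bar> \<le> C * edge t powr 1" by blast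
  {
    case 0
    show ?case by (intro conjI endpoint_class_0I cos_bd sin_bd continuous_intros)
  next
    case (Suc K)
    have "endpoint_class K (0 - 1) (\<lambda>t. - 1 * sin t)"
      by (intro endpoint_class_mono[OF endpoint_class_cmult[OF conjunct2[OF Suc]]]) simp
    then have "endpoint_class (Suc K) 0 cos"
      by (intro endpoint_class_SucI[OF cos_bd, of "\<lambda>t. - 1 * sin t"])
        (auto intro!: derivative_eq_intros)
    moreover have "endpoint_class (Suc K) 1 sin"
      using Suc by (intro endpoint_class_SucI[OF sin_bd DERIV_sin]) simp
    ultimately show ?case ..
  }
qed

lemmas endpoint_class_cos = conjunct1[OF endpoint_class_cos_sin]
lemmas endpoint_class_sin = conjunct2[OF endpoint_class_cos_sin]

text \<open>The derivative is cos times the next lower power, which is why s is general in the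
  induction. For negative s the bound rests on the lower estimate
  \<open>sin_ge_edge\<close>.\<close>

lemma endpoint_class_sin_powr: "endpoint_class K s (\<lambda>t. sin t powr s)"
proof (induction K arbitrary: s)
  have bd: "\<exists>C. \<forall>t\<in>{0<..<pi}. \<bar>sin t powr s\<bar> \<le> C * edge t powr s" for s
  proof (cases "s \<ge> 0")
    case True
    have "\<bar>sin t powr s\<bar> \<le> 1 * edge t powr s" if "t \<in> {0<..<pi}" for t
      using sin_le_edge[OF that] that True by (auto intro: powr_mono2 simp: sin_ge_zero)
    then show ?thesis by blast
  next
    case False
    have "\<bar>sin t powr s\<bar> \<le> (1 / pi) powr s * edge t powr s" if t: "t \<in> {0<..<pi}" for t
    proof -
      have "sin t powr s \<le> (1 / pi * edge t) powr s"
        using sin_ge_edge[OF t] edge_pos[OF t] False by (intro powr_mono2') auto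
      also have "\<dots> = (1 / pi) powr s * edge t powr s"
        using edge_pos[OF t] by (subst powr_mult) auto
      finally show ?thesis by simp
    qed
    then show ?thesis by blast
  qed
  {
    case 0
    show ?case by (intro endpoint_class_0I bd continuous_intros) (use sin_gt_zero in fastforce)
  next
    case (Suc K)
    have "endpoint_class K (0 + (s - 1)) (\<lambda>t. cos t * sin t powr (s - 1))"
      by (intro endpoint_class_mult endpoint_class_cos Suc)
    then have "endpoint_class K (s - 1) (\<lambda>t. s * (cos t * sin t powr (s - 1)))"
      by (intro endpoint_class_cmult) simp
    moreover have "((\<lambda>t. sin t powr s) has_real_derivative s * (cos t * sin t powr (s - 1))) (at t)"
      if "t \<in> {0<..<pi}" for t
      using that by (auto intro!: derivative_eq_intros simp: sin_gt_zero)
    show ?case by (rule endpoint_class_SucI[OF bd], fact+)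
  }
qed

text \<open>A logarithm costs an arbitrarily small order e, by ln y \<le> y^e / e at y = 1 / sin t.
  Its derivative cos / sin has order -1, which is better than the required -e - 1.\<close>

lemma endpoint_class_ln_sin:
  assumes e: "e > 0"
  shows "endpoint_class K (- e) (\<lambda>t. ln (sin t))"
proof -
  obtain C where C: "C \<ge> 0" "\<And>t. t \<in> {0<..<pi} \<Longrightarrow> \<bar>sin t powr (-e)\<bar> \<le> C * edge t powr (-e)"
    using endpoint_class_bound[OF endpoint_class_sin_powr[of 0 "-e"]] by blast
  have bd: "\<forall>t\<in>{0<..<pi}. \<bar>ln (sin t)\<bar> \<le> (C / e) * edge t powr (-e)"
  proof
    fix t assume t: "t \<in> {0<..<pi}"
    then have s: "sin t > 0" by (simp add: sin_gt_zero)
    have "\<bar>ln (sin t)\<bar> = ln (1 / sin t)" using s by (simp add: ln_div)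
    also have "\<dots> \<le> (1 / sin t) powr e / e" using s e by (intro ln_powr_bound) auto
    also have "\<dots> = sin t powr (-e) / e" using s by (simp add: powr_minus powr_divide field_simps)
    also have "\<dots> \<le> (C * edge t powr (-e)) / e" using C(2)[OF t] e by (intro divide_right_mono) auto
    finally show "\<bar>ln (sin t)\<bar> \<le> (C / e) * edge t powr (-e)" by simp
  qed
  show ?thesis
  proof (cases K)
    case 0
    have "continuous_on {0<..<pi} (\<lambda>t. ln (sin t))"
      by (intro continuous_intros) (use sin_gt_zero in fastforce)
    then show ?thesis unfolding 0 by (rule endpoint_class_0I) (use bd in blast)
  next
    case (Suc K')
    have "endpoint_class K' (0 + (-1)) (\<lambda>t. cos t * sin t powr (-1))"
      by (intro endpoint_class_mult endpoint_class_cos endpoint_class_sin_powr)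
    then have "endpoint_class K' (- e - 1) (\<lambda>t. cos t * sin t powr (-1))"
      by (rule endpoint_class_mono) (use e in auto)
    moreover have "((\<lambda>t. ln (sin t)) has_real_derivative cos t * sin t powr (-1)) (at t)"
      if "t \<in> {0<..<pi}" for t
    proof -
      have "sin t > 0" using that by (simp add: sin_gt_zero)
      then show ?thesis by (auto intro!: derivative_eq_intros simp: powr_minus divide_inverse)
    qed
    show ?thesis unfolding Suc by (rule endpoint_class_SucI, rule exI, rule bd, fact+)
  qed
qed

lemma endpoint_class_ln_sin_power:
  assumes e: "e > 0"
  shows "endpoint_class K (- e) (\<lambda>t. (2 * ln (sin t)) ^ k)"
proof (cases "k = 0")
  case True
  then show ?thesis using endpoint_class_mono[OF endpoint_class_const[of K 1], of "-e"] e by simp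
next
  case False
  have "endpoint_class K (- (real k * d)) (\<lambda>t. (2 * ln (sin t)) ^ k)" if "d > 0" for k d
  proof (induction k)
    case (Suc k)
    have "endpoint_class K (- d + - (real k * d)) (\<lambda>t. 2 * ln (sin t) * (2 * ln (sin t)) ^ k)"
      by (intro endpoint_class_mult endpoint_class_cmult endpoint_class_ln_sin Suc that)
    moreover have "- d + - (real k * d) = - (real (Suc k) * d)" by (simp add: algebra_simps)
    ultimately show ?case by (simp only: power_Suc)
  qed (simp add: endpoint_class_const)
  \<comment> \<open>The total loss e is shared equally among the k logarithmic factors.\<close>
  from this[of "e / real k" k] show ?thesis using e False by simp
qed

text \<open>Differentiating through the cosine produces a factor sin t of order 1 where order -1
  would do, so boundedness of all derivatives on [-1, 1] suffices at every level.\<close>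

lemma endpoint_class_smooth_cos:
  fixes D :: "nat \<Rightarrow> real \<Rightarrow> real"
  assumes D: "\<And>k x. x \<in> {-1..1} \<Longrightarrow> (D k has_real_derivative D (Suc k) x) (at x within {-1..1})"
  shows "endpoint_class K 0 (\<lambda>t. D k (cos t))"
proof (induction K arbitrary: k)
  have cont: "continuous_on {-1..1} (D k)" for k
    by (rule DERIV_continuous_on[OF D])
  have bd: "\<exists>C. \<forall>t\<in>{0<..<pi}. \<bar>D k (cos t)\<bar> \<le> C * edge t powr 0" for k
  proof -
    have "bounded (D k ` {-1..1})"
      by (intro compact_imp_bounded compact_continuous_image cont) auto
    then have "\<exists>B. \<forall>x\<in>{-1..1}. \<bar>D k x\<bar> \<le> B" by (auto simp: bounded_iff)
    then obtain B where B: "\<And>x. x \<in> {-1..1} \<Longrightarrow> \<bar>D k x\<bar> \<le> B" by blast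
    have "\<bar>D k (cos t)\<bar> \<le> B * edge t powr 0" if "t \<in> {0<..<pi}" for t
      using edge_pos[OF that] B[of "cos t"] by simp
    then show ?thesis by blast
  qed
  {
    case 0
    have "continuous_on {0<..<pi} (\<lambda>t. D k (cos t))"
      by (rule continuous_on_compose2[OF cont]) (auto intro: continuous_intros)
    then show ?case by (intro endpoint_class_0I bd)
  next
    case (Suc K)
    have "endpoint_class K (1 + 0) (\<lambda>t. - 1 * sin t * D (Suc k) (cos t))"
      by (intro endpoint_class_mult endpoint_class_cmult endpoint_class_sin Suc)
    then have "endpoint_class K (0 - 1) (\<lambda>t. - 1 * sin t * D (Suc k) (cos t))"
      by (rule endpoint_class_mono) simp
    moreover have "((\<lambda>t. D k (cos t)) has_real_derivative - 1 * sin t * D (Suc k) (cos t)) (at t)"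
      if t: "t \<in> {0<..<pi}" for t
    proof -
      have "cos t \<in> {-1<..<1}"
        using t cos_monotone_0_pi[of 0 t] cos_monotone_0_pi[of t pi] by auto
      then have "(D k has_real_derivative D (Suc k) (cos t)) (at (cos t))"
        using D[of "cos t" k] at_within_Icc_at[of "-1" "cos t" 1] by auto
      from DERIV_chain2[OF this DERIV_cos] show ?thesis by (simp add: mult_ac)
    qed
    show ?case by (rule endpoint_class_SucI[OF bd], fact+)
  }
qed

text \<open>Vanishing at both endpoints \<open>\<plusminus>1\<close> is worth two orders, because \<open>1 - x\<^sup>2\<close> becomes \<open>sin\<^sup>2 t\<close>.\<close>

lemma endpoint_class_smooth_cos_vanishing:
  fixes D :: "nat \<Rightarrow> real \<Rightarrow> real"
  assumes D: "\<And>k x. x \<in> {-1..1} \<Longrightarrow> (D k has_real_derivative D (Suc k) x) (at x within {-1..1})"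
    and zero: "D 0 (-1) = 0" "D 0 1 = 0"
  shows "endpoint_class K 2 (\<lambda>t. D 0 (cos t))"
proof -
  have cont: "continuous_on {-1..1} (D k)" for k
    by (rule DERIV_continuous_on[OF D])
  have "bounded (D 1 ` {-1..1})"
    by (intro compact_imp_bounded compact_continuous_image cont) auto
  then have "\<exists>B. \<forall>x\<in>{-1..1}. \<bar>D 1 x\<bar> \<le> B" by (auto simp: bounded_iff)
  then obtain B where B: "\<And>x. x \<in> {-1..1} \<Longrightarrow> \<bar>D 1 x\<bar> \<le> B" by blast
  have B0: "B \<ge> 0" using B[of 0] by force
  have lip: "\<bar>D 0 x - D 0 y\<bar> \<le> B * \<bar>x - y\<bar>" if "x \<in> {-1..1}" "y \<in> {-1..1}" for x y
    using field_differentiable_bound[of "{-1..1}" "D 0" "D 1" B x y] D[of _ 0] B that by auto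
  have sq: "\<bar>D 0 (cos t)\<bar> \<le> B * edge t powr 2" if t: "t \<in> {0<..<pi}" for t
  proof -
    have c: "cos t \<in> {-1..1}" by auto
    have s: "sin t ^ 2 = (1 - cos t) * (1 + cos t)" by (simp add: sin_squared_eq power2_eq_square algebra_simps)
    have "\<bar>D 0 (cos t)\<bar> \<le> B * sin t ^ 2"
    \<comment> \<open>The Lipschitz bound is taken from the nearer zero of \<open>D 0\<close>; the
      factor of 1 - x^2 belonging to the other endpoint is then at least 1 and may be
      inserted.\<close>
    proof (cases "cos t \<ge> 0")
      case True
      have "\<bar>D 0 (cos t)\<bar> \<le> B * (1 - cos t) * 1" using lip[OF c, of 1] zero by simp
      also have "\<dots> \<le> B * (1 - cos t) * (1 + cos t)" using True B0 by (intro mult_left_mono) auto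
      finally show ?thesis by (simp add: s)
    next
      case False
      have "0 \<le> 1 + cos t" using cos_ge_minus_one[of t] by linarith
      have "\<bar>D 0 (cos t)\<bar> \<le> B * (1 + cos t) * 1" using lip[OF c, of "-1"] zero cos_ge_minus_one[of t] by (simp add: add.commute)
      also have "\<dots> \<le> B * (1 + cos t) * (1 - cos t)" using False B0 \<open>0 \<le> 1 + cos t\<close>
        by (intro mult_left_mono mult_nonneg_nonneg) auto
      finally show ?thesis by (simp add: s mult_ac)
    qed
    also have "\<dots> \<le> B * edge t ^ 2"
      using sin_le_edge[OF t] t B0 by (intro mult_left_mono power_mono) (auto simp: sin_ge_zero)
    finally show ?thesis using edge_pos[OF t] by simp
  qed
  show ?thesis
  proof (cases K)
    case 0
    have "continuous_on {0<..<pi} (\<lambda>t. D 0 (cos t))"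
      by (rule endpoint_class_continuous[OF endpoint_class_smooth_cos[of D, OF D]])
    then show ?thesis unfolding 0 by (rule endpoint_class_0I) (use sq in blast)
  next
    case (Suc K')
    \<comment> \<open>Here the factor sin t supplies exactly the order 2 - 1 of the derivative, so
      \<open>D 1\<close> itself may be nonzero at the endpoints.\<close>
    have "endpoint_class K' (1 + 0) (\<lambda>t. - 1 * sin t * D 1 (cos t))"
      by (intro endpoint_class_mult endpoint_class_cmult endpoint_class_sin endpoint_class_smooth_cos D)
    then have "endpoint_class K' (2 - 1) (\<lambda>t. - 1 * sin t * D 1 (cos t))" by simp
    moreover have "((\<lambda>t. D 0 (cos t)) has_real_derivative - 1 * sin t * D 1 (cos t)) (at t)"
      if t: "t \<in> {0<..<pi}" for t
    proof -
      have "cos t \<in> {-1<..<1}"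
        using t cos_monotone_0_pi[of 0 t] cos_monotone_0_pi[of t pi] by auto
      then have "(D 0 has_real_derivative D 1 (cos t)) (at (cos t))"
        using D[of "cos t" 0] at_within_Icc_at[of "-1" "cos t" 1] by auto
      from DERIV_chain2[OF this DERIV_cos] show ?thesis by (simp add: mult_ac)
    qed
    show ?thesis unfolding Suc by (rule endpoint_class_SucI, rule exI, rule ballI, erule sq, fact+)
  qed
qed

subsection \<open>Oscillatory integrals\<close>

text \<open>Each integration by parts gains 1/n and lowers the order s by one. At distance 1/n from
  the endpoints these two effects balance: every boundary term has the same size n^(-s-1). Once the
  order is below -1, the absolute integral over the middle is itself dominated by the cut points and
  is of the matching size. The phase c lets sines and cosines be treated alike.\<close>

lemma oscillatory_integral_middle:
  assumes "endpoint_class K s f" "s - real K < -1"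
  shows "\<exists>C. \<forall>n\<ge>1. \<bar>integral {1 / real n..pi - 1 / real n} (\<lambda>t. cos (real n * t + c) * f t)\<bar>
    \<le> C * real n powr (- s - 1)"
  using assms
proof (induction K arbitrary: s f c)
  case 0
  obtain C where C: "C \<ge> 0" "\<And>t. t \<in> {0<..<pi} \<Longrightarrow> \<bar>f t\<bar> \<le> C * edge t powr s"
    using endpoint_class_bound[OF 0(1)] by blast
  have s: "s + 1 < 0" using 0 by simp
  show ?case
  proof (intro exI allI impI)
    fix n :: nat assume n: "n \<ge> 1"
    define d where "d = 1 / real n"
    have d01: "d > 0" "d \<le> 1" using n by (auto simp: d_def)
    with pi_gt3 have d: "d > 0" "d \<le> 1" "d < pi - d" by linarith+
    have sub: "{d..pi - d} \<subseteq> {0<..<pi}" using d by auto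
    define F where "F t = (t powr (s + 1) - (pi - t) powr (s + 1)) / (s + 1)" for t
    have int: "((\<lambda>t. C * (t powr s + (pi - t) powr s)) has_integral C * (F (pi - d) - F d)) {d..pi - d}"
    proof (intro has_integral_mult_right fundamental_theorem_of_calculus)
      fix t assume t: "t \<in> {d..pi - d}"
      have "(F has_real_derivative t powr s + (pi - t) powr s) (at t)"
      proof -
        have "((\<lambda>t. t powr (s + 1) - (pi - t) powr (s + 1)) has_real_derivative
            (s + 1) * (t powr s + (pi - t) powr s)) (at t)"
          using t d by (auto intro!: derivative_eq_intros simp: algebra_simps)
        from DERIV_cdivide[OF this, of "s + 1"] show ?thesis unfolding F_def using s by simp
      qed
      then show "(F has_vector_derivative t powr s + (pi - t) powr s) (at t within {d..pi - d})"
        by (simp add: has_real_derivative_iff_has_vector_derivative has_vector_derivative_at_within)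
    qed (use d in auto)
    have "\<bar>integral {d..pi - d} (\<lambda>t. cos (real n * t + c) * f t)\<bar> \<le> C * (F (pi - d) - F d)"
    proof -
      have "norm (integral {d..pi - d} (\<lambda>t. cos (real n * t + c) * f t))
          \<le> integral {d..pi - d} (\<lambda>t. C * (t powr s + (pi - t) powr s))"
      proof (rule integral_norm_bound_integral)
      show "(\<lambda>t. cos (real n * t + c) * f t) integrable_on {d..pi - d}"
        by (intro integrable_continuous_real continuous_intros
            continuous_on_subset[OF endpoint_class_continuous[OF 0(1)] sub])
      show "(\<lambda>t. C * (t powr s + (pi - t) powr s)) integrable_on {d..pi - d}" using int by blast
      fix t assume t: "t \<in> {d..pi - d}"
      then have "t \<in> {0<..<pi}" using sub by auto
      have "norm (cos (real n * t + c) * f t) \<le> 1 * (C * edge t powr s)"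
        unfolding norm_mult using C(2)[OF \<open>t \<in> {0<..<pi}\<close>] by (intro mult_mono) auto
      also have "edge t powr s \<le> t powr s + (pi - t) powr s" by (auto simp: edge_def min_def)
      finally show "norm (cos (real n * t + c) * f t) \<le> C * (t powr s + (pi - t) powr s)"
        using C by (simp add: mult_left_mono)
      qed
      then show ?thesis by (simp only: integral_unique[OF int] real_norm_def)
    qed
    also have "F (pi - d) - F d = 2 * (d powr (s + 1) - (pi - d) powr (s + 1)) / (- (s + 1))"
    proof -
      have "(X - Y) / q - (Y - X) / q = 2 * (Y - X) / (- q)" for X Y q :: real
        by (cases "q = 0") (auto simp: field_simps)
      moreover have "pi - (pi - d) = d" by simp
      ultimately show ?thesis unfolding F_def by (simp only:)
    qed
    \<comment> \<open>As s + 1 is negative, the power at d dominates and the one at \<pi> - d is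
      dropped.\<close>
    also have "\<dots> \<le> 2 * (d powr (s + 1)) / (- (s + 1))"
      using s by (intro divide_right_mono mult_left_mono) auto
    also have "d powr (s + 1) = real n powr (- s - 1)"
      using n by (simp add: d_def powr_divide powr_minus_divide[symmetric])
    finally show "\<bar>integral {1 / real n..pi - 1 / real n} (\<lambda>t. cos (real n * t + c) * f t)\<bar>
        \<le> (C * 2 / (- (s + 1))) * real n powr (- s - 1)"
      using C(1) by (simp add: d_def mult_right_mono C(1) mult_ac)
  qed
next
  case (Suc K)
  obtain C where C: "C \<ge> 0" "\<And>t. t \<in> {0<..<pi} \<Longrightarrow> \<bar>f t\<bar> \<le> C * edge t powr s"
    using endpoint_class_bound[OF Suc.prems(1)] by blast
  obtain Cf f' where "\<forall>t\<in>{0<..<pi}. \<bar>f t\<bar> \<le> Cf * edge t powr s"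
      and f': "\<And>t. t \<in> {0<..<pi} \<Longrightarrow> (f has_real_derivative f' t) (at t)" "endpoint_class K (s - 1) f'"
    using endpoint_class_SucE[OF Suc.prems(1)] by blast
  \<comment> \<open>A quarter-period shift writes the antiderivative sin (n t + c) as a cosine
    again, so the induction hypothesis applies with phase c'.\<close>
  define c' where "c' = c - pi / 2"
  have c': "cos (x + c') = sin (x + c)" for x
    unfolding c'_def using cos_sin_eq[of "x + c - pi / 2"] by (simp add: algebra_simps sin_diff cos_diff)
  have "s - 1 - real K < -1" using Suc.prems(2) by simp
  from Suc.IH[OF f'(2) this, of c'] obtain C' where
    C': "\<And>n. n \<ge> 1 \<Longrightarrow> \<bar>integral {1 / real n..pi - 1 / real n} (\<lambda>t. cos (real n * t + c') * f' t)\<bar>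
      \<le> C' * real n powr (- (s - 1) - 1)" by blast
  show ?case
  proof (intro exI allI impI)
    fix n :: nat assume n: "n \<ge> 1"
    define d where "d = 1 / real n"
    have d01: "d > 0" "d \<le> 1" using n by (auto simp: d_def)
    with pi_gt3 have d: "d > 0" "d \<le> 1" "d < pi - d" by linarith+
    have sub: "{d..pi - d} \<subseteq> {0<..<pi}" using d by auto
    define F where "F t = cos (real n * t + c') * f t / real n" for t
    have der: "((\<lambda>t. cos (real n * t + c) * f t + cos (real n * t + c') * f' t / real n) has_integral F (pi - d) - F d) {d..pi - d}"
    proof (rule fundamental_theorem_of_calculus)
      fix t assume t: "t \<in> {d..pi - d}"
      have "(F has_real_derivative cos (real n * t + c) * f t + cos (real n * t + c') * f' t / real n) (at t)"
        unfolding F_def c' using t d sub n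
        by (auto intro!: derivative_eq_intros f'(1) simp: field_simps)
      then show "(F has_vector_derivative cos (real n * t + c) * f t + cos (real n * t + c') * f' t / real n) (at t within {d..pi - d})"
        by (simp add: has_real_derivative_iff_has_vector_derivative has_vector_derivative_at_within)
    qed (use d in auto)
    have "(\<lambda>t. cos (real n * t + c') * f' t) integrable_on {d..pi - d}"
      by (intro integrable_continuous_real continuous_intros
            continuous_on_subset[OF endpoint_class_continuous[OF f'(2)] sub])
    then have "((\<lambda>t. cos (real n * t + c') * f' t / real n) has_integral
        integral {d..pi - d} (\<lambda>t. cos (real n * t + c') * f' t) / real n) {d..pi - d}"
      by (intro has_integral_divide) (simp add: has_integral_integral)
    from has_integral_diff[OF der this]
    have "integral {d..pi - d} (\<lambda>t. cos (real n * t + c) * f t) =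
      F (pi - d) - F d - integral {d..pi - d} (\<lambda>t. cos (real n * t + c') * f' t) / real n"
      by (simp add: integral_unique)
    also have "\<bar>\<dots>\<bar> \<le> \<bar>F (pi - d)\<bar> + \<bar>F d\<bar> + \<bar>integral {d..pi - d} (\<lambda>t. cos (real n * t + c') * f' t)\<bar> / real n"
    proof -
      have "\<bar>x - y - z / real n\<bar> \<le> \<bar>x\<bar> + \<bar>y\<bar> + \<bar>z\<bar> / real n" for x y z :: real
        using abs_divide[of z "real n"] unfolding abs_of_nat by linarith
      then show ?thesis .
    qed
    also have "\<dots> \<le> C * d powr s / real n + C * d powr s / real n + C' * real n powr (- (s - 1) - 1) / real n"
    proof (intro add_mono divide_right_mono)
      have Fb: "\<bar>F t\<bar> \<le> C * d powr s / real n" if "t \<in> {0<..<pi}" "edge t = d" for t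
      proof -
        have "\<bar>F t\<bar> = \<bar>cos (real n * t + c')\<bar> * \<bar>f t\<bar> / real n" by (simp add: F_def abs_mult)
        also have "\<dots> \<le> 1 * (C * edge t powr s) / real n"
          using C(2)[OF that(1)] by (intro divide_right_mono mult_mono) auto
        finally show ?thesis using that by simp
      qed
      show "\<bar>F (pi - d)\<bar> \<le> C * d powr s / real n" "\<bar>F d\<bar> \<le> C * d powr s / real n"
        using d by (auto intro!: Fb simp: edge_def)
      show "\<bar>integral {d..pi - d} (\<lambda>t. cos (real n * t + c') * f' t)\<bar> \<le> C' * real n powr (- (s - 1) - 1)"
        using C'[OF n] by (simp add: d_def)
    qed auto
    also have "d powr s = real n powr (- s)" using n by (simp add: d_def powr_divide powr_minus_divide[symmetric])
    also have "real n powr (- (s - 1) - 1) = real n powr (- s)" by simp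
    also have "C * real n powr (- s) / real n + C * real n powr (- s) / real n + C' * real n powr (- s) / real n
        = (2 * C + C') * real n powr (- s - 1)"
      using n by (simp add: powr_diff field_simps)
    finally show "\<bar>integral {1 / real n..pi - 1 / real n} (\<lambda>t. cos (real n * t + c) * f t)\<bar>
        \<le> (2 * C + C') * real n powr (- s - 1)" by (simp add: d_def)
  qed
qed

lemma has_integral_powr_right_end:
  assumes "s > (-1::real)" "d \<ge> 0"
  shows "((\<lambda>t. (b - t) powr s) has_integral d powr (s + 1) / (s + 1)) {b - d..b}"
proof -
  define F where "F t = - ((b - t) powr (s + 1) / (s + 1))" for t
  have "((\<lambda>t. (b - t) powr s) has_integral F b - F (b - d)) {b - d..b}"
  proof (rule fundamental_theorem_of_calculus_interior)
    show "continuous_on {b - d..b} F" unfolding F_def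
      using assms by (intro continuous_on_minus continuous_on_divide continuous_on_powr' continuous_intros) auto
    fix t assume "t \<in> {b - d<..<b}"
    then have "(F has_real_derivative (b - t) powr s) (at t)"
      unfolding F_def using assms by (auto intro!: derivative_eq_intros)
    then show "(F has_vector_derivative (b - t) powr s) (at t)"
      by (simp add: has_real_derivative_iff_has_vector_derivative)
  qed (use assms in auto)
  then show ?thesis using assms by (simp add: F_def)
qed

lemma endpoint_class_absolutely_integrable:
  assumes f: "endpoint_class K s f" and s: "s > -1" and h: "continuous_on {0..pi} h"
  shows "(\<lambda>t. h t * f t) absolutely_integrable_on {0..pi}"
proof -
  obtain C where C: "C \<ge> 0" "\<And>t. t \<in> {0<..<pi} \<Longrightarrow> \<bar>f t\<bar> \<le> C * edge t powr s"
    using endpoint_class_bound[OF f] by blast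
  have "bounded (h ` {0..pi})" using h by (intro compact_imp_bounded compact_continuous_image) auto
  then have "\<exists>B. \<forall>x\<in>{0..pi}. \<bar>h x\<bar> \<le> B" by (auto simp: bounded_iff)
  then obtain B where B: "\<And>x. x \<in> {0..pi} \<Longrightarrow> \<bar>h x\<bar> \<le> B" by blast
  have B0: "B \<ge> 0" using B[of 0] by force
  have "(\<lambda>t. h t * f t) absolutely_integrable_on {0<..<pi}"
  proof (rule measurable_bounded_by_integrable_imp_absolutely_integrable)
    show "(\<lambda>t. h t * f t) \<in> borel_measurable (lebesgue_on {0<..<pi})"
      by (intro continuous_imp_measurable_on_sets_lebesgue continuous_on_mult
          continuous_on_subset[OF h] endpoint_class_continuous[OF f]) auto
    have "(\<lambda>t. t powr s) integrable_on {0..pi}" "(\<lambda>t. (pi - t) powr s) integrable_on {0..pi}"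
      using has_integral_powr_from_0[of s pi] has_integral_powr_right_end[of s pi pi] s by auto
    then have "(\<lambda>t. B * (C * (t powr s + (pi - t) powr s))) integrable_on {0..pi}"
      by (intro integrable_on_mult_right integrable_add)
    then show "(\<lambda>t. B * (C * (t powr s + (pi - t) powr s))) integrable_on {0<..<pi}"
      by (simp only: integrable_on_Icc_iff_Ioo)
    fix t assume t: "t \<in> {0<..<pi}"
    have "norm (h t * f t) \<le> B * (C * edge t powr s)"
      unfolding norm_mult using C(2)[OF t] B[of t] B0 t by (intro mult_mono) auto
    also have "edge t powr s \<le> t powr s + (pi - t) powr s" by (auto simp: edge_def min_def)
    finally show "norm (h t * f t) \<le> B * (C * (t powr s + (pi - t) powr s))"
      using C B0 by (simp add: mult_left_mono)
  qed auto
  then show ?thesis by (simp add: absolutely_integrable_on_Icc_iff_Ioo)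
qed

lemma oscillatory_integral_bound:
  assumes f: "\<And>K. endpoint_class K s f" and s: "s > -1"
  shows "\<exists>C. \<forall>n\<ge>1. \<bar>integral {0..pi} (\<lambda>t. cos (real n * t) * f t)\<bar> \<le> C * real n powr (- s - 1)"
proof -
  \<comment> \<open>Enough derivatives to bring the order down to at most -2, below the threshold -1
    of the middle estimate.\<close>
  define K where "K = nat \<lceil>s\<rceil> + 2"
  have K: "s - real K < -1" unfolding K_def by linarith
  from oscillatory_integral_middle[OF f K, of 0] obtain C1 where
    C1: "\<And>n. n \<ge> 1 \<Longrightarrow> \<bar>integral {1 / real n..pi - 1 / real n} (\<lambda>t. cos (real n * t) * f t)\<bar>
      \<le> C1 * real n powr (- s - 1)" by auto
  obtain C where C: "C \<ge> 0" "\<And>t. t \<in> {0<..<pi} \<Longrightarrow> \<bar>f t\<bar> \<le> C * edge t powr s"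
    using endpoint_class_bound[OF f] by blast
  show ?thesis
  proof (intro exI allI impI)
    fix n :: nat assume n: "n \<ge> 1"
    define d where "d = 1 / real n"
    have d01: "d > 0" "d \<le> 1" using n by (auto simp: d_def)
    with pi_gt3 have d: "d > 0" "d \<le> 1" "d < pi - d" by linarith+
    define h where "h t = cos (real n * t) * f t" for t
    have "h absolutely_integrable_on {0..pi}" unfolding h_def
      by (intro endpoint_class_absolutely_integrable[OF f s] continuous_intros)
    then have hi: "h integrable_on {0..pi}" by (rule set_lebesgue_integral_eq_integral)
    have hsub: "h integrable_on {a..b}" if "0 \<le> a" "b \<le> pi" for a b
      by (rule integrable_subinterval_real[OF hi]) (use that in auto)
    have "integral {0..pi} h = integral {0..d} h + (integral {d..pi - d} h + integral {pi - d..pi} h)"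
    proof -
      have "integral {0..d} h + integral {d..pi} h = integral {0..pi} h"
        using d by (intro Henstock_Kurzweil_Integration.integral_combine hi) auto
      moreover have "integral {d..pi - d} h + integral {pi - d..pi} h = integral {d..pi} h"
        using d by (intro Henstock_Kurzweil_Integration.integral_combine hsub) auto
      ultimately show ?thesis by simp
    qed
    moreover have hb: "\<bar>h t\<bar> \<le> C * edge t powr s" if "t \<in> {0<..<pi}" for t
    proof -
      have "\<bar>h t\<bar> \<le> 1 * (C * edge t powr s)"
        unfolding h_def abs_mult using C(2)[OF that] by (intro mult_mono) auto
      then show ?thesis by simp
    qed
    have "\<bar>integral {0..d} h\<bar> \<le> C * (d powr (s + 1) / (s + 1))"
    proof -
      have int: "((\<lambda>t. C * t powr s) has_integral C * (d powr (s + 1) / (s + 1))) {0..d}"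
        using has_integral_powr_from_0[of s d] d s by (intro has_integral_mult_right) auto
      have "norm (integral {0<..<d} h) \<le> integral {0<..<d} (\<lambda>t. C * t powr s)"
      proof (rule integral_norm_bound_integral)
        show "h integrable_on {0<..<d}" "(\<lambda>t. C * t powr s) integrable_on {0<..<d}"
          using hsub[of 0 d] int d by (auto simp flip: integrable_on_Icc_iff_Ioo)
        fix t assume "t \<in> {0<..<d}"
        then show "norm (h t) \<le> C * t powr s" using hb[of t] d by (simp add: edge_def min_def)
      qed
      then show ?thesis
        by (simp only: integral_open_interval_real[symmetric] integral_unique[OF int] real_norm_def)
    qed
    moreover have "\<bar>integral {pi - d..pi} h\<bar> \<le> C * (d powr (s + 1) / (s + 1))"
    proof -
      have int: "((\<lambda>t. C * (pi - t) powr s) has_integral C * (d powr (s + 1) / (s + 1))) {pi - d..pi}"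
        using has_integral_powr_right_end[of s d pi] d s by (intro has_integral_mult_right) auto
      have "norm (integral {pi - d<..<pi} h) \<le> integral {pi - d<..<pi} (\<lambda>t. C * (pi - t) powr s)"
      proof (rule integral_norm_bound_integral)
        show "h integrable_on {pi - d<..<pi}" "(\<lambda>t. C * (pi - t) powr s) integrable_on {pi - d<..<pi}"
          using hsub[of "pi - d" pi] int d by (auto simp flip: integrable_on_Icc_iff_Ioo)
        fix t assume "t \<in> {pi - d<..<pi}"
        then show "norm (h t) \<le> C * (pi - t) powr s" using hb[of t] d by (simp add: edge_def min_def)
      qed
      then show ?thesis
        by (simp only: integral_open_interval_real[symmetric] integral_unique[OF int] real_norm_def)
    qed
    moreover have "\<bar>integral {d..pi - d} h\<bar> \<le> C1 * real n powr (- s - 1)"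
      using C1[OF n] unfolding h_def d_def by (simp only:)
    ultimately have "\<bar>integral {0..pi} h\<bar> \<le> C * (d powr (s + 1) / (s + 1)) +
        (C1 * real n powr (- s - 1) + C * (d powr (s + 1) / (s + 1)))"
      by linarith
    also have "d powr (s + 1) = real n powr (- s - 1)"
      using n by (simp add: d_def powr_divide powr_minus_divide[symmetric])
    also have "C * (real n powr (- s - 1) / (s + 1)) +
        (C1 * real n powr (- s - 1) + C * (real n powr (- s - 1) / (s + 1))) =
        (2 * C / (s + 1) + C1) * real n powr (- s - 1)" by (simp add: algebra_simps)
    finally show "\<bar>integral {0..pi} (\<lambda>t. cos (real n * t) * f t)\<bar> \<le> (2 * C / (s + 1) + C1) * real n powr (- s - 1)"
      by (simp add: h_def)
  qed
qed

subsection \<open>Moments of powers of sines with logarithms\<close>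

text \<open>For x = cos t the factor 2 ln (sin t) is ln (1 - x^2). It is also the logarithmic
  \<phi>-derivative of sin t powr (2\<phi>), hence the 2 inside the power.\<close>

definition sinlog :: "real \<Rightarrow> nat \<Rightarrow> real \<Rightarrow> real" where
  "sinlog p \<theta> t = sin t powr p * (2 * ln (sin t)) ^ \<theta>"

lemma endpoint_class_sinlog:
  assumes "e > 0"
  shows "endpoint_class K (p - e) (sinlog p \<theta>)"
proof -
  have "endpoint_class K (p + - e) (\<lambda>t. sin t powr p * (2 * ln (sin t)) ^ \<theta>)"
    by (intro endpoint_class_mult endpoint_class_sin_powr endpoint_class_ln_sin_power assms)
  then show ?thesis by (simp add: sinlog_def[abs_def])
qed

lemma cos_in_open:
  assumes "t \<in> {0<..<pi}"
  shows "cos t \<in> {-1<..<1}"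
  using assms cos_monotone_0_pi[of 0 t] cos_monotone_0_pi[of t pi] by auto

lemma weak_sing_cos:
  assumes t: "t \<in> {0<..<pi}"
  shows "weak_sing g \<phi> \<theta> (cos t) = g (cos t) * sinlog (2 * \<phi>) \<theta> t"
proof -
  have s: "sin t > 0" using t by (simp add: sin_gt_zero)
  have "1 - (cos t)\<^sup>2 = (sin t)\<^sup>2" by (simp add: sin_squared_eq)
  moreover have "(sin t)\<^sup>2 powr \<phi> = sin t powr (2 * \<phi>)"
    using s by (simp add: powr_powr flip: powr_numeral)
  moreover have "ln ((sin t)\<^sup>2) = 2 * ln (sin t)" using s by (simp add: ln_realpow)
  ultimately show ?thesis
    using cos_in_open[OF t] by (simp add: weak_sing_def sinlog_def)
qed

text \<open>For p > 0 the power beats the logarithms, and the default value of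
  \<open>0 powr p\<close> agrees with the limit 0. The continuity of \<open>weak_sing\<close> with g
  = 1 and exponent p/2 is pulled back along the cosine.\<close>

lemma continuous_on_sinlog:
  assumes "p > 0"
  shows "continuous_on {0..pi} (sinlog p \<theta>)"
proof -
  have "continuous_on {0..pi} (\<lambda>t. weak_sing (\<lambda>_. 1) (p / 2) \<theta> (cos t))"
    using assms by (intro continuous_on_compose2[OF weak_sing_continuous_on]) (auto intro: continuous_intros)
  moreover have eq: "weak_sing (\<lambda>_. 1) (p / 2) \<theta> (cos t) = sinlog p \<theta> t" if "t \<in> {0..pi}" for t
  proof (cases "t \<in> {0<..<pi}")
    case False
    with that have "t = 0 \<or> t = pi" by auto
    then show ?thesis by (auto simp: weak_sing_def sinlog_def)
  qed (simp add: weak_sing_cos)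
  moreover have "continuous_on {0..pi} (\<lambda>t. weak_sing (\<lambda>_. 1) (p / 2) \<theta> (cos t)) \<longleftrightarrow>
      continuous_on {0..pi} (sinlog p \<theta>)"
    by (intro continuous_on_cong refl eq)
  ultimately show ?thesis by blast
qed

lemma sinlog_endpoint [simp]: "sinlog p \<theta> 0 = 0" "sinlog p \<theta> pi = 0"
  by (simp_all add: sinlog_def)

text \<open>At \<theta> = 0 the truncated index \<theta> - 1 is harmless, because its coefficient 2
  \<theta> is zero.\<close>

lemma DERIV_sinlog:
  assumes t: "t \<in> {0<..<pi}"
  shows "(sinlog (p + 1) \<theta> has_real_derivative
    cos t * ((p + 1) * sinlog p \<theta> t + 2 * real \<theta> * sinlog p (\<theta> - 1) t)) (at t)"
proof -
  have s: "sin t > 0" using t by (simp add: sin_gt_zero)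
  have "((\<lambda>t. sin t powr (p + 1)) has_real_derivative (p + 1) * sin t powr p * cos t) (at t)"
    using s by (auto intro!: derivative_eq_intros)
  moreover have "((\<lambda>t. 2 * ln (sin t)) has_real_derivative 2 * (cos t / sin t)) (at t)"
    using s by (auto intro!: derivative_eq_intros)
  ultimately have "(sinlog (p + 1) \<theta> has_real_derivative
      (p + 1) * sin t powr p * cos t * (2 * ln (sin t)) ^ \<theta> +
      real \<theta> * (2 * (cos t / sin t) * (2 * ln (sin t)) ^ (\<theta> - Suc 0)) * sin t powr (p + 1)) (at t)"
    unfolding sinlog_def[abs_def] by (intro DERIV_mult DERIV_power)
  also have "sin t powr (p + 1) = sin t powr p * sin t" using s by (simp add: powr_add)
  also have "(p + 1) * sin t powr p * cos t * (2 * ln (sin t)) ^ \<theta> +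
      real \<theta> * (2 * (cos t / sin t) * (2 * ln (sin t)) ^ (\<theta> - Suc 0)) * (sin t powr p * sin t) =
      cos t * ((p + 1) * sinlog p \<theta> t + 2 * real \<theta> * sinlog p (\<theta> - 1) t)"
    using s by (simp add: sinlog_def field_simps)
  finally show ?thesis .
qed

text \<open>The frequency is real so that the neighbours \<nu> - 1 and \<nu> + 1 can be formed
  without truncation, including \<nu> = -1.\<close>

definition cos_moment :: "real \<Rightarrow> nat \<Rightarrow> real \<Rightarrow> real" where
  "cos_moment p \<theta> \<nu> = integral {0..pi} (\<lambda>t. cos (\<nu> * t) * sinlog p \<theta> t)"

lemma cos_moment_has_integral:
  assumes "p > -1"
  shows "((\<lambda>t. cos (\<nu> * t) * sinlog p \<theta> t) has_integral cos_moment p \<theta> \<nu>) {0..pi}"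
proof -
  have "(\<lambda>t. cos (\<nu> * t) * sinlog p \<theta> t) absolutely_integrable_on {0..pi}"
    using assms by (intro endpoint_class_absolutely_integrable[OF endpoint_class_sinlog[of "(p + 1) / 2" 0 p]])
      (auto intro!: continuous_intros simp: field_simps)
  then show ?thesis
    unfolding cos_moment_def using set_lebesgue_integral_eq_integral(1) has_integral_integral by blast
qed

lemma cos_moment_minus: "cos_moment p \<theta> (- \<nu>) = cos_moment p \<theta> \<nu>"
  by (simp add: cos_moment_def)

text \<open>The derivative of \<open>cos (\<nu> t) sin\<^sup>p\<^sup>+\<^sup>1 t (2 ln (sin t))\<^sup>\<theta>\<close> integrates to zero.\<close>

lemma cos_moment_rec:
  assumes p: "p > -1"
  shows "(\<nu> + 1 + p) * cos_moment p \<theta> (\<nu> + 1) + 2 * real \<theta> * cos_moment p (\<theta> - 1) (\<nu> + 1) =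
    (\<nu> - 1 - p) * cos_moment p \<theta> (\<nu> - 1) - 2 * real \<theta> * cos_moment p (\<theta> - 1) (\<nu> - 1)"
proof -
  \<comment> \<open>This is F' after the product formulas have replaced cos (\<nu> t) cos t and sin
    (\<nu> t) sin t by cosines of frequency \<nu> + 1 and \<nu> - 1, so that its integral is a
    combination of moments.\<close>
  define f where "f t = (\<nu> + 1 + p) / 2 * (cos ((\<nu> + 1) * t) * sinlog p \<theta> t)
    + real \<theta> * (cos ((\<nu> + 1) * t) * sinlog p (\<theta> - 1) t)
    - ((\<nu> - 1 - p) / 2 * (cos ((\<nu> - 1) * t) * sinlog p \<theta> t)
    - real \<theta> * (cos ((\<nu> - 1) * t) * sinlog p (\<theta> - 1) t))" for t
  define F where "F t = cos (\<nu> * t) * sinlog (p + 1) \<theta> t" for t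
  have "(f has_integral F pi - F 0) {0..pi}"
  proof (rule fundamental_theorem_of_calculus_interior)
    show "continuous_on {0..pi} F"
      unfolding F_def using p by (intro continuous_intros continuous_on_sinlog) auto
    fix t assume t: "t \<in> {0<..<pi}"
    have "sin t > 0" using t by (simp add: sin_gt_zero)
    then have e1: "sinlog (p + 1) \<theta> t = sin t * sinlog p \<theta> t"
      by (simp add: sinlog_def powr_add)
    have e2: "cos ((\<nu> + 1) * t) = cos (\<nu> * t) * cos t - sin (\<nu> * t) * sin t"
      "cos ((\<nu> - 1) * t) = cos (\<nu> * t) * cos t + sin (\<nu> * t) * sin t"
      by (simp_all add: ring_distribs cos_add cos_diff)
    have "(F has_real_derivative - sin (\<nu> * t) * \<nu> * sinlog (p + 1) \<theta> t +
        cos (\<nu> * t) * (cos t * ((p + 1) * sinlog p \<theta> t + 2 * real \<theta> * sinlog p (\<theta> - 1) t))) (at t)"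
      unfolding F_def using t by (auto intro!: derivative_eq_intros DERIV_sinlog simp: mult_ac)
    also have "- sin (\<nu> * t) * \<nu> * sinlog (p + 1) \<theta> t +
        cos (\<nu> * t) * (cos t * ((p + 1) * sinlog p \<theta> t + 2 * real \<theta> * sinlog p (\<theta> - 1) t)) = f t"
      unfolding f_def e1 e2 by (simp add: field_simps)
    finally have "(F has_real_derivative f t) (at t)" .
    then show "(F has_vector_derivative f t) (at t)"
      by (simp add: has_real_derivative_iff_has_vector_derivative)
  qed auto
  moreover have "(f has_integral (\<nu> + 1 + p) / 2 * cos_moment p \<theta> (\<nu> + 1) + real \<theta> * cos_moment p (\<theta> - 1) (\<nu> + 1)
      - ((\<nu> - 1 - p) / 2 * cos_moment p \<theta> (\<nu> - 1) - real \<theta> * cos_moment p (\<theta> - 1) (\<nu> - 1))) {0..pi}"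
    unfolding f_def
    by (intro has_integral_diff has_integral_add has_integral_mult_right cos_moment_has_integral p)
  ultimately have "F pi - F 0 = (\<nu> + 1 + p) / 2 * cos_moment p \<theta> (\<nu> + 1) + real \<theta> * cos_moment p (\<theta> - 1) (\<nu> + 1)
      - ((\<nu> - 1 - p) / 2 * cos_moment p \<theta> (\<nu> - 1) - real \<theta> * cos_moment p (\<theta> - 1) (\<nu> - 1))"
    by (rule has_integral_unique)
  then show ?thesis by (simp add: F_def field_simps)
qed

text \<open>This is the antisymmetry of odd cosines about \<pi>/2, obtained here from the
  recurrence: at \<nu> = 0 evenness in \<nu> makes the moment of frequency 1 equal to its own
  negative up to lower logarithms, and at \<nu> = 2m + 2 the vanishing is passed on.\<close>

lemma cos_moment_odd:
  assumes p: "p > -1"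
  shows "cos_moment p \<theta> (2 * real m + 1) = 0"
proof (induction \<theta> arbitrary: m)
  case 0
  show ?case
  proof (induction m)
    case 0
    show ?case using cos_moment_rec[OF p, of 0 0] cos_moment_minus[of p 0 1] p by simp
  next
    case (Suc m)
    then show ?case using cos_moment_rec[OF p, of "2 * real m + 2" 0] p by (simp add: add_ac)
  qed
next
  case (Suc \<theta>)
  show ?case
  proof (induction m)
    case 0
    have "(1 + p) * cos_moment p (Suc \<theta>) 1 = 0"
      using cos_moment_rec[OF p, of 0 "Suc \<theta>"] cos_moment_minus[of p _ 1] Suc[of 0]
      by (simp add: algebra_simps)
    then show ?case using p by simp
  next
    case (Suc m)
    then show ?case
      using cos_moment_rec[OF p, of "2 * real m + 2" "Suc \<theta>"] Suc.IH \<open>\<And>m. cos_moment p \<theta> (2 * real m + 1) = 0\<close>[of "Suc m"]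
        \<open>\<And>m. cos_moment p \<theta> (2 * real m + 1) = 0\<close>[of m] p by (simp add: add_ac)
  qed
qed

text \<open>The substitution y = (1 + cos t) / 2 gives sin^2 t = 4 y (1 - y) and dy = -(sin t / 2)
  dt, so the integral becomes a symmetric Beta integral with exponents \<phi> - 1/2.\<close>

lemma cos_moment_zero:
  assumes \<phi>: "\<phi> > - (1 / 2)"
  shows "cos_moment (2 * \<phi>) 0 0 = 4 powr \<phi> * Beta (\<phi> + 1 / 2) (\<phi> + 1 / 2)"
proof -
  define a where "a = \<phi> + 1 / 2"
  define f where "f x = x powr (a - 1) * (1 - x) powr (a - 1)" for x :: real
  define g where "g t = (1 + cos t) / 2" for t :: real
  have a: "a > 0" using \<phi> by (simp add: a_def)
  have img: "g ` {0<..<pi} = {0<..<1}"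
  proof (intro equalityI subsetI)
    fix x assume "x \<in> g ` {0<..<pi}"
    then show "x \<in> {0<..<1}" using cos_in_open by (force simp: g_def)
  next
    fix x :: real assume x: "x \<in> {0<..<1}"
    then have "arccos (2 * x - 1) \<in> {0<..<pi}"
      using arccos_lt_bounded[of "2 * x - 1"] by auto
    moreover have "g (arccos (2 * x - 1)) = x" using x by (simp add: g_def)
    ultimately show "x \<in> g ` {0<..<pi}" by (metis image_eqI)
  qed
  have "(\<lambda>x. \<bar>- sin x / 2\<bar> * f (g x)) absolutely_integrable_on {0<..<pi} \<and>
      integral {0<..<pi} (\<lambda>x. \<bar>- sin x / 2\<bar> * f (g x)) = Beta a a
    \<longleftrightarrow> f absolutely_integrable_on (g ` {0<..<pi}) \<and> integral (g ` {0<..<pi}) f = Beta a a"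
  proof (rule has_absolute_integral_change_of_variables_1')
    show "inj_on g {0<..<pi}"
      using cos_inj_pi by (auto simp: inj_on_def g_def)
    show "(g has_real_derivative - sin t / 2) (at t within {0<..<pi})" for t
      unfolding g_def by (auto intro!: derivative_eq_intros)
  qed auto
  moreover have int: "(f has_integral Beta a a) {0<..<1}"
    using has_integral_Beta_real[OF a a] unfolding f_def by (simp only: has_integral_Icc_iff_Ioo)
  moreover have "f absolutely_integrable_on {0<..<1}"
    by (intro nonnegative_absolutely_integrable_1) (use int in \<open>auto simp: f_def\<close>)
  ultimately have "integral {0<..<pi} (\<lambda>x. \<bar>- sin x / 2\<bar> * f (g x)) = Beta a a"
    unfolding img by (auto dest: integral_unique)
  moreover have "integral {0<..<pi} (\<lambda>x. \<bar>- sin x / 2\<bar> * f (g x)) =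
      integral {0<..<pi} (\<lambda>t. 4 powr (- \<phi>) * (cos (0 * t) * sinlog (2 * \<phi>) 0 t))"
  proof (rule integral_cong)
    fix t assume t: "t \<in> {0<..<pi}"
    have s: "sin t > 0" using t by (simp add: sin_gt_zero)
    have "g t > 0" "1 - g t > 0" using cos_in_open[OF t] by (auto simp: g_def)
    then have "f (g t) = (g t * (1 - g t)) powr (a - 1)" by (simp add: f_def powr_mult)
    also have "g t * (1 - g t) = (1 - (cos t)\<^sup>2) / 4"
      by (simp add: g_def field_simps power2_eq_square)
    also have "1 - (cos t)\<^sup>2 = (sin t)\<^sup>2" by (simp add: sin_squared_eq)
    also have "((sin t)\<^sup>2 / 4) powr (a - 1) = sin t powr (2 * (a - 1)) / 4 powr (a - 1)"
      using s by (simp add: powr_divide powr_powr flip: powr_numeral)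
    also have "2 * (a - 1) = 2 * \<phi> - 1" by (simp add: a_def)
    also have "4 powr (a - 1) = 4 powr \<phi> / (2::real)"
    proof -
      have "a - 1 = \<phi> - 1 / 2" by (simp add: a_def)
      then have "4 powr (a - 1) = 4 powr \<phi> / (4::real) powr (1 / 2)" by (simp only: powr_diff)
      also have "(4::real) powr (1 / 2) = 2" by (simp add: powr_half_sqrt)
      finally show ?thesis .
    qed
    finally show "\<bar>- sin t / 2\<bar> * f (g t) = 4 powr (- \<phi>) * (cos (0 * t) * sinlog (2 * \<phi>) 0 t)"
      using s by (simp add: sinlog_def powr_diff powr_minus field_simps)
  qed
  moreover have "integral {0<..<pi} (\<lambda>t. 4 powr (- \<phi>) * (cos (0 * t) * sinlog (2 * \<phi>) 0 t)) =
      4 powr (- \<phi>) * cos_moment (2 * \<phi>) 0 0"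
    using has_integral_mult_right[OF cos_moment_has_integral[of "2 * \<phi>" 0 0]] \<phi>
    unfolding has_integral_Icc_iff_Ioo by (intro integral_unique) simp
  ultimately have "Beta a a = 4 powr (- \<phi>) * cos_moment (2 * \<phi>) 0 0" by (simp only:)
  then show ?thesis by (simp add: a_def powr_minus field_simps)
qed

lemma Gamma_legendre_duplication_real:
  assumes "\<phi> > - (1 / 2)"
  shows "Gamma (\<phi> + 1 / 2) * Gamma (\<phi> + 1) = 4 powr (- \<phi>) * sqrt pi * Gamma (2 * \<phi> + 1 :: real)"
proof -
  define z where "z = complex_of_real (\<phi> + 1 / 2)"
  have z: "z + 1 / 2 = complex_of_real (\<phi> + 1)" "2 * z = complex_of_real (2 * \<phi> + 1)" "1 - 2 * z = complex_of_real (- 2 * \<phi>)"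
    by (simp_all add: z_def)
  have e: "exp ((1 - 2 * z) * of_real (ln 2)) = complex_of_real (exp (- 2 * \<phi> * ln 2))"
    unfolding z(3) by (simp only: of_real_mult[symmetric] exp_of_real)
  have "z \<notin> \<int>\<^sub>\<le>\<^sub>0" "z + 1 / 2 \<notin> \<int>\<^sub>\<le>\<^sub>0"
    using assms by (auto simp: z_def elim!: nonpos_Ints_cases simp del: of_real_add simp flip: of_real_add)
      (auto simp: complex_eq_iff)
  from Gamma_legendre_duplication[OF this]
  have "complex_of_real (Gamma (\<phi> + 1 / 2) * Gamma (\<phi> + 1)) =
      complex_of_real (exp (- 2 * \<phi> * ln 2) * sqrt pi * Gamma (2 * \<phi> + 1))"
    unfolding e unfolding z(1,2) by (simp only: z_def Gamma_complex_of_real of_real_mult)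
  then have "Gamma (\<phi> + 1 / 2) * Gamma (\<phi> + 1) = exp (- 2 * \<phi> * ln 2) * sqrt pi * Gamma (2 * \<phi> + 1)"
    by (simp only: of_real_eq_iff)
  also have "exp (- 2 * \<phi> * ln 2) = 4 powr (- \<phi>)"
    using ln_realpow[of 2 2] by (simp add: powr_def)
  finally show ?thesis .
qed

text \<open>In terms of \<open>rGamma\<close> the reflection formula needs no exception at integers,
  where both sides are 0.\<close>

lemma rGamma_reflection_real: "rGamma (- \<phi>) * rGamma (\<phi> + 1) = - sin (\<phi> * pi) / (pi :: real)"
proof -
  have "complex_of_real (rGamma (- \<phi>) * rGamma (\<phi> + 1)) = complex_of_real (- sin (\<phi> * pi) / pi)"
  proof -
    have "1 - complex_of_real (- \<phi>) = complex_of_real (\<phi> + 1)"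
      "complex_of_real pi * complex_of_real (- \<phi>) = complex_of_real (- (\<phi> * pi))" by simp_all
    with rGamma_reflection_complex[of "complex_of_real (- \<phi>)"] show ?thesis
      by (simp only: rGamma_complex_of_real sin_of_real of_real_mult of_real_divide sin_minus)
  qed
  then show ?thesis by (simp only: of_real_eq_iff)
qed

text \<open>The square of Gamma (\<phi> + 1) is what remains when rGamma (-\<phi>) / rGamma (\<phi>
  + 1) is rewritten as a product fit for the reflection formula; with it, duplication clears all
  half-integer arguments.\<close>

lemma cos_moment_zero_Gamma:
  assumes "\<phi> > 0"
  shows "cos_moment (2 * \<phi>) 0 0 * (Gamma (\<phi> + 1))\<^sup>2 = 4 powr (- \<phi>) * pi * Gamma (2 * \<phi> + 1)"
proof -
  define d where "d = Gamma (2 * \<phi> + 1)"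
  have d: "d > 0" using assms by (auto simp: d_def intro: Gamma_real_pos)
  have "\<phi> + 1 / 2 + (\<phi> + 1 / 2) = 2 * \<phi> + 1" by simp
  then have "cos_moment (2 * \<phi>) 0 0 = 4 powr \<phi> * (Gamma (\<phi> + 1 / 2) * Gamma (\<phi> + 1 / 2) / d)"
    using cos_moment_zero[of \<phi>] assms unfolding Beta_def d_def by simp
  then have "cos_moment (2 * \<phi>) 0 0 * (Gamma (\<phi> + 1))\<^sup>2 =
      4 powr \<phi> * (Gamma (\<phi> + 1 / 2) * Gamma (\<phi> + 1))\<^sup>2 / d"
    by (simp add: power2_eq_square)
  also have "(Gamma (\<phi> + 1 / 2) * Gamma (\<phi> + 1))\<^sup>2 = (4 powr (- \<phi>) * sqrt pi * d)\<^sup>2"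
    using assms by (subst Gamma_legendre_duplication_real) (auto simp: d_def)
  also have "4 powr \<phi> * (4 powr (- \<phi>) * sqrt pi * d)\<^sup>2 / d = 4 powr (- \<phi>) * (sqrt pi)\<^sup>2 * d"
    using d by (simp add: powr_minus power2_eq_square field_simps)
  finally show ?thesis by (simp add: d_def)
qed

text \<open>The moment recurrence at \<nu> = 2m + 1, halved; this is the form that
  \<open>log_recurrence_limit\<close> expects.\<close>

lemma cos_moment_even_rec:
  assumes "\<phi> > 0"
  shows "cos_moment (2 * \<phi>) (Suc j) (2 * real (Suc m)) * (real m + 1 + \<phi>) + real (Suc j) * cos_moment (2 * \<phi>) j (2 * real (Suc m)) =
    cos_moment (2 * \<phi>) (Suc j) (2 * real m) * (real m - \<phi>) - real (Suc j) * cos_moment (2 * \<phi>) j (2 * real m)"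
    and "cos_moment (2 * \<phi>) 0 (2 * real (Suc m)) * (real m + 1 + \<phi>) = cos_moment (2 * \<phi>) 0 (2 * real m) * (real m - \<phi>)"
  using cos_moment_rec[of "2 * \<phi>" "2 * real m + 1" "Suc j"] cos_moment_rec[of "2 * \<phi>" "2 * real m + 1" 0] assms
  by (simp_all add: algebra_simps)

lemma cos_moment_pochhammer:
  assumes \<phi>: "\<phi> > 0"
  shows "cos_moment (2 * \<phi>) 0 (2 * real m) =
    cos_moment (2 * \<phi>) 0 0 * (pochhammer (- \<phi>) m / pochhammer (\<phi> + 1) m)"
proof (induction m)
  case (Suc m)
  have "pochhammer (\<phi> + 1) m > 0" using \<phi> by (intro pochhammer_pos) auto
  moreover have "real m + 1 + \<phi> > 0" using \<phi> by simp
  moreover have "cos_moment (2 * \<phi>) 0 (2 * real (Suc m)) * (real m + 1 + \<phi>) = cos_moment (2 * \<phi>) 0 (2 * real m) * (real m - \<phi>)"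
    by (rule cos_moment_even_rec[OF \<phi>])
  ultimately have "cos_moment (2 * \<phi>) 0 (2 * real (Suc m)) = cos_moment (2 * \<phi>) 0 (2 * real m) * (real m - \<phi>) / (real m + 1 + \<phi>)"
    by (simp add: field_simps)
  then show ?case unfolding Suc pochhammer_Suc by (simp add: add_ac mult_ac)
qed simp

text \<open>The sine comes from the reflection formula and 4 powr (-\<phi>) from duplication. For
  integer \<phi> the limit is 0, and this level reveals nothing about the next one.\<close>

lemma cos_moment_limit_zero:
  assumes \<phi>: "\<phi> > 0"
  shows "(\<lambda>m. cos_moment (2 * \<phi>) 0 (2 * real m) * real m powr (2 * \<phi> + 1))
    \<longlonglongrightarrow> - (4 powr (- \<phi>)) * Gamma (2 * \<phi> + 1) * sin (\<phi> * pi)"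
proof -
  have ni: "\<phi> + 1 \<notin> \<int>\<^sub>\<le>\<^sub>0" using \<phi> nonpos_Ints_nonpos by force
  \<comment> \<open>The Pochhammer limit has n + 1 factors but the power of n; this ratio corrects
    the mismatch.\<close>
  have "(\<lambda>n. (real (Suc n) / real n) powr (2 * \<phi> + 1)) \<longlonglongrightarrow> 1 powr (2 * \<phi> + 1)"
    by (rule tendsto_powr) (real_asymp, auto)
  with pochhammer_ratio_limit[of "\<phi> + 1" "- \<phi>"] \<phi>
  have "(\<lambda>n. cos_moment (2 * \<phi>) 0 0 * (pochhammer (- \<phi>) (n + 1) / pochhammer (\<phi> + 1) (n + 1) * real n powr (\<phi> + 1 - - \<phi>)
      * (real (Suc n) / real n) powr (2 * \<phi> + 1)))
      \<longlonglongrightarrow> cos_moment (2 * \<phi>) 0 0 * (rGamma (- \<phi>) / rGamma (\<phi> + 1) * 1 powr (2 * \<phi> + 1))"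
    by (intro tendsto_mult tendsto_const) auto
  also have "cos_moment (2 * \<phi>) 0 0 * (rGamma (- \<phi>) / rGamma (\<phi> + 1) * 1 powr (2 * \<phi> + 1)) =
      (cos_moment (2 * \<phi>) 0 0 * (Gamma (\<phi> + 1))\<^sup>2) * (rGamma (- \<phi>) * rGamma (\<phi> + 1))"
  proof -
    have "rGamma (\<phi> + 1) \<noteq> 0" using ni by (simp add: rGamma_eq_zero_iff)
    then show ?thesis by (simp add: Gamma_def power2_eq_square field_simps)
  qed
  also have "\<dots> = - (4 powr (- \<phi>)) * Gamma (2 * \<phi> + 1) * sin (\<phi> * pi)"
    unfolding cos_moment_zero_Gamma[OF \<phi>] rGamma_reflection_real by simp
  finally have lim: "(\<lambda>n. cos_moment (2 * \<phi>) 0 0 * (pochhammer (- \<phi>) (n + 1) / pochhammer (\<phi> + 1) (n + 1) * real n powr (\<phi> + 1 - - \<phi>)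
      * (real (Suc n) / real n) powr (2 * \<phi> + 1)))
      \<longlonglongrightarrow> - (4 powr (- \<phi>)) * Gamma (2 * \<phi> + 1) * sin (\<phi> * pi)" .
  have "(\<lambda>n. cos_moment (2 * \<phi>) 0 (2 * real (Suc n)) * real (Suc n) powr (2 * \<phi> + 1))
    \<longlonglongrightarrow> - (4 powr (- \<phi>)) * Gamma (2 * \<phi> + 1) * sin (\<phi> * pi)"
  proof (rule Lim_transform_eventually[OF lim])
    show "\<forall>\<^sub>F n in sequentially. cos_moment (2 * \<phi>) 0 0 * (pochhammer (- \<phi>) (n + 1) / pochhammer (\<phi> + 1) (n + 1) * real n powr (\<phi> + 1 - - \<phi>)
      * (real (Suc n) / real n) powr (2 * \<phi> + 1)) = cos_moment (2 * \<phi>) 0 (2 * real (Suc n)) * real (Suc n) powr (2 * \<phi> + 1)"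
      using eventually_gt_at_top[of 0]
    proof eventually_elim
      case (elim n)
      have "\<phi> + 1 - - \<phi> = 2 * \<phi> + 1" by simp
      moreover have "real n powr (2 * \<phi> + 1) * (real (Suc n) / real n) powr (2 * \<phi> + 1) = real (Suc n) powr (2 * \<phi> + 1)"
        using elim by (simp add: powr_divide)
      ultimately show ?case unfolding cos_moment_pochhammer[OF \<phi>, of "Suc n"]
        by (simp only: Suc_eq_plus1 mult.assoc)
    qed
  qed
  then show ?thesis by (rule LIMSEQ_imp_Suc)
qed

text \<open>For integer \<open>\<phi>\<close> the unweighted moments vanish from some point on, and the moments with
  one logarithm satisfy the homogeneous recurrence from there.\<close>

lemma cos_moment_limit_one_nat:
  assumes k: "k > 0" and \<phi>: "\<phi> = real k"
  shows "(\<lambda>m. cos_moment (2 * \<phi>) 1 (2 * real m) * real m powr (2 * \<phi> + 1))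
    \<longlonglongrightarrow> - (4 powr (- \<phi>)) * Gamma (2 * \<phi> + 1) * (pi * cos (\<phi> * pi))"
proof -
  have \<phi>0: "\<phi> > 0" using k \<phi> by simp
  define Y where "Y j m = cos_moment (2 * \<phi>) j (2 * real m)" for j m
  define y where "y m = Gamma (real m - \<phi>) / Gamma (real m + \<phi> + 1)" for m
  \<comment> \<open>The rising factorial of -k contains the factor 0 as soon as m > k.\<close>
  have Y0: "Y 0 m = 0" if "m > k" for m
    using that unfolding Y_def cos_moment_pochhammer[OF \<phi>0] by (simp add: \<phi> pochhammer_of_nat_eq_0_iff)
  have G: "Gamma (real n + 1) = fact n" for n
    using Gamma_fact[of n, where 'a = real] by (simp add: add_ac)
  have Yk: "Y 0 k = Y 0 0 * ((-1) ^ k * fact k / (fact (2 * k) / fact k))"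
  proof -
    have "pochhammer (real k + 1) k = Gamma (real k + 1 + real k) / Gamma (real k + 1)"
      by (rule pochhammer_Gamma) (use nonpos_Ints_nonpos[of "real k + 1"] in auto)
    also have "real k + 1 + real k = real (2 * k) + 1" by simp
    finally have "pochhammer (real k + 1) k = fact (2 * k) / fact k" by (simp only: G)
    then show ?thesis unfolding Y_def cos_moment_pochhammer[OF \<phi>0, of k]
      by (simp add: \<phi> pochhammer_same)
  qed
  \<comment> \<open>At m = k the coefficient m - \<phi> is zero, so the history of Y 1 is erased:
    its value at k + 1 is determined by the last nonzero unweighted moment Y 0 k alone.\<close>
  have "Y 1 (Suc k) * (real k + 1 + \<phi>) + 1 * Y 0 (Suc k) = Y 1 k * (real k - \<phi>) - 1 * Y 0 k"
    using cos_moment_even_rec(1)[OF \<phi>0, of 0 k] by (simp add: Y_def)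
  then have Y1k: "Y 1 (Suc k) * (2 * real k + 1) = - Y 0 k" using Y0[of "Suc k"] by (simp add: \<phi>)
  have y_pos: "y m > 0" if "m > k" for m
    using that \<phi>0 unfolding y_def by (intro divide_pos_pos Gamma_real_pos) (auto simp: \<phi>)
  have yk: "y (Suc k) = 1 / fact (2 * k + 1)"
    using G[of "2 * k + 1"] G[of 0] by (simp add: y_def \<phi> add_ac)
  \<comment> \<open>Beyond k the inhomogeneous terms are absent, so Y 1 is an exact multiple of the
    Gamma quotient, and the factor can be read off at k + 1.\<close>
  have Y1: "Y 1 m = Y 1 (Suc k) / y (Suc k) * y m" if "m \<ge> Suc k" for m
    using that
  proof (induction m rule: dec_induct)
    case base
    show ?case using y_pos[of "Suc k"] by simp
  next
    case (step m)
    then have m: "real m > \<phi>" by (simp add: \<phi>)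
    have p: "real m + 1 + \<phi> > 0" using \<phi>0 by simp
    have "Y 1 (Suc m) * (real m + 1 + \<phi>) = Y 1 m * (real m - \<phi>)"
      using cos_moment_even_rec(1)[OF \<phi>0, of 0 m] Y0[of m] Y0[of "Suc m"] step by (simp add: Y_def)
    also have "\<dots> = Y 1 (Suc k) / y (Suc k) * (y m * (real m - \<phi>))" unfolding step(3) by simp
    also have "y m * (real m - \<phi>) = y (Suc m) * (real m + 1 + \<phi>)"
      unfolding y_def by (rule Gamma_ratio_rec[symmetric]) (use m \<phi>0 in auto)
    finally have "Y 1 (Suc m) * (real m + 1 + \<phi>) = Y 1 (Suc k) / y (Suc k) * y (Suc m) * (real m + 1 + \<phi>)"
      by (simp only: mult.assoc)
    then show ?case using p by (simp only: mult_right_cancel[OF less_imp_neq[OF p, symmetric]])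
  qed
  have c: "Y 1 (Suc k) / y (Suc k) = - (4 powr (- \<phi>)) * Gamma (2 * \<phi> + 1) * (pi * cos (\<phi> * pi))"
  proof -
    have f: "fact (2 * k + 1) = (2 * real k + 1) * fact (2 * k)" by simp
    have "Y 1 (Suc k) / y (Suc k) = (Y 1 (Suc k) * (2 * real k + 1)) * fact (2 * k)"
      unfolding yk f by simp
    also have "\<dots> = - (Y 0 0 * (fact k)\<^sup>2) * (-1) ^ k"
      unfolding Y1k Yk by (simp add: power2_eq_square)
    also have "Y 0 0 * (fact k)\<^sup>2 = 4 powr (- \<phi>) * pi * Gamma (2 * \<phi> + 1)"
      using cos_moment_zero_Gamma[OF \<phi>0] G[of k] by (simp add: Y_def \<phi>)
    also have "(-1) ^ k = cos (\<phi> * pi)" by (simp add: \<phi> cos_npi2 mult.commute)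
    finally show ?thesis by simp
  qed
  have "(\<lambda>m. Y 1 (Suc k) / y (Suc k) * (y m * real m powr (2 * \<phi> + 1))) \<longlonglongrightarrow> Y 1 (Suc k) / y (Suc k) * 1"
    unfolding y_def by (intro tendsto_mult tendsto_const Gamma_ratio_limit \<phi>0)
  moreover have "\<forall>\<^sub>F m in sequentially. Y 1 (Suc k) / y (Suc k) * (y m * real m powr (2 * \<phi> + 1)) =
      cos_moment (2 * \<phi>) 1 (2 * real m) * real m powr (2 * \<phi> + 1)"
    using eventually_ge_at_top[of "Suc k"]
  proof eventually_elim
    case (elim m)
    from Y1[OF elim] show ?case unfolding Y_def[symmetric] by (simp only: mult.assoc)
  qed
  ultimately show ?thesis unfolding c by (auto intro: Lim_transform_eventually)
qed

definition log_order :: "real \<Rightarrow> nat \<Rightarrow> nat" where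
  "log_order \<phi> \<theta> = (if \<phi> \<in> \<nat> then \<theta> - 1 else \<theta>)"

text \<open>Leading coefficient of the Leibniz expansion in \<phi>: each derivative falling on the
  Beta factor contributes -2 ln n. Where the sine vanishes, exactly one of the \<theta> derivatives
  must fall on it, giving \<theta> \<pi> cos (\<phi> \<pi>) and one logarithm less.\<close>

definition lead_const :: "real \<Rightarrow> nat \<Rightarrow> real" where
  "lead_const \<phi> \<theta> = (if \<phi> \<in> \<nat> then real \<theta> * pi * (-2) ^ (\<theta> - 1) * cos (\<phi> * pi)
     else (-2) ^ \<theta> * sin (\<phi> * pi))"

lemma cos_moment_limit:
  assumes \<phi>: "\<phi> > 0" and \<theta>: "\<theta> > 0"
  shows "(\<lambda>m. cos_moment (2 * \<phi>) \<theta> (2 * real m) * real m powr (2 * \<phi> + 1) / ln (real m) ^ log_order \<phi> \<theta>)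
    \<longlonglongrightarrow> - (4 powr (- \<phi>)) * Gamma (2 * \<phi> + 1) * lead_const \<phi> \<theta>"
proof (cases "\<phi> \<in> \<nat>")
  case False
  have "(\<lambda>m. cos_moment (2 * \<phi>) \<theta> (2 * real m) * real m powr (2 * \<phi> + 1) / ln (real m) ^ \<theta>)
      \<longlonglongrightarrow> - (4 powr (- \<phi>)) * Gamma (2 * \<phi> + 1) * sin (\<phi> * pi) * (-2) ^ \<theta>"
    by (rule log_recurrence_limit[where Y = "\<lambda>j m. cos_moment (2 * \<phi>) j (2 * real m)"])
      (intro \<phi> cos_moment_limit_zero always_eventually allI cos_moment_even_rec)+
  with False show ?thesis by (simp add: lead_const_def log_order_def mult_ac)
next
  case True
  then obtain k where k: "\<phi> = real k" by (auto elim: Nats_cases)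
  with \<phi> have k0: "k > 0" by simp
  \<comment> \<open>Dividing the moment with j + 1 logarithms by j + 1 restores the weights of the
    recurrence after the shift by one level, so the general limit applies with the one-logarithm
    moment as base.\<close>
  define Z where "Z j m = cos_moment (2 * \<phi>) (Suc j) (2 * real m) / real (Suc j)" for j m
  have "(\<lambda>m. Z (\<theta> - 1) m * real m powr (2 * \<phi> + 1) / ln (real m) ^ (\<theta> - 1))
      \<longlonglongrightarrow> - (4 powr (- \<phi>)) * Gamma (2 * \<phi> + 1) * (pi * cos (\<phi> * pi)) * (-2) ^ (\<theta> - 1)"
  proof (rule log_recurrence_limit[OF \<phi>])
    show "(\<lambda>m. Z 0 m * real m powr (2 * \<phi> + 1))
        \<longlonglongrightarrow> - (4 powr (- \<phi>)) * Gamma (2 * \<phi> + 1) * (pi * cos (\<phi> * pi))"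
      using cos_moment_limit_one_nat[OF k0 k] by (simp add: Z_def)
    have "Z (Suc j) (Suc m) * (real m + 1 + \<phi>) + real (Suc j) * Z j (Suc m) =
        Z (Suc j) m * (real m - \<phi>) - real (Suc j) * Z j m" for j m
    proof -
      have "(x * p + s * y = x' * q - s * y') \<Longrightarrow> s \<noteq> 0 \<Longrightarrow> x / s * p + y = x' / s * q - y'" for x p s y x' q y' :: real
        by (simp add: field_simps)
      from this[OF cos_moment_even_rec(1)[OF \<phi>, of "Suc j" m]]
      show ?thesis unfolding Z_def by simp
    qed
    then show "\<forall>\<^sub>F m in sequentially. Z (Suc j) (Suc m) * (real m + 1 + \<phi>) + real (Suc j) * Z j (Suc m) =
        Z (Suc j) m * (real m - \<phi>) - real (Suc j) * Z j m" for j by simp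
  qed
  then have lim: "(\<lambda>m. real \<theta> * (Z (\<theta> - 1) m * real m powr (2 * \<phi> + 1) / ln (real m) ^ (\<theta> - 1)))
      \<longlonglongrightarrow> real \<theta> * (- (4 powr (- \<phi>)) * Gamma (2 * \<phi> + 1) * (pi * cos (\<phi> * pi)) * (-2) ^ (\<theta> - 1))"
    by (intro tendsto_mult tendsto_const)
  have eq: "real \<theta> * (Z (\<theta> - 1) m * P / L) = cos_moment (2 * \<phi>) \<theta> (2 * real m) * P / L" for m P L
    using \<theta> by (simp add: Z_def)
  have "- (4 powr (- \<phi>)) * Gamma (2 * \<phi> + 1) * lead_const \<phi> \<theta> =
      real \<theta> * (- (4 powr (- \<phi>)) * Gamma (2 * \<phi> + 1) * (pi * cos (\<phi> * pi)) * (-2) ^ (\<theta> - 1))"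
    using True by (simp add: lead_const_def)
  with lim[unfolded eq] True show ?thesis by (simp only: log_order_def if_True)
qed

lemma amp_scale_eq: "amp_scale \<phi> \<theta> n = ln (real n) ^ log_order \<phi> \<theta>"
  by (simp add: amp_scale_def log_order_def)

text \<open>Passing from m to the frequency 2m multiplies by 2 powr (2\<phi> + 1), that is 2 times 4
  powr \<phi>, which cancels the factor from duplication; ln (2m) and ln m are asymptotically
  equal.\<close>

lemma cos_moment_even_limit:
  assumes \<phi>: "\<phi> > 0" and \<theta>: "\<theta> > 0"
  shows "(\<lambda>m. cos_moment (2 * \<phi>) \<theta> (2 * real m) * (2 * real m) powr (2 * \<phi> + 1) / ln (2 * real m) ^ log_order \<phi> \<theta>)
    \<longlonglongrightarrow> - 2 * Gamma (2 * \<phi> + 1) * lead_const \<phi> \<theta>"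
proof -
  define k where "k = log_order \<phi> \<theta>"
  have "(\<lambda>m. ln (real m) ^ k / ln (2 * real m) ^ k) \<longlonglongrightarrow> 1" by real_asymp
  then have "(\<lambda>m. 2 powr (2 * \<phi> + 1) * (cos_moment (2 * \<phi>) \<theta> (2 * real m) * real m powr (2 * \<phi> + 1) / ln (real m) ^ k) *
        (ln (real m) ^ k / ln (2 * real m) ^ k))
      \<longlonglongrightarrow> 2 powr (2 * \<phi> + 1) * (- (4 powr (- \<phi>)) * Gamma (2 * \<phi> + 1) * lead_const \<phi> \<theta>) * 1"
    unfolding k_def by (intro tendsto_mult tendsto_const cos_moment_limit assms)
  also have "2 powr (2 * \<phi> + 1) = 2 * (4::real) powr \<phi>"
    by (simp add: powr_add powr_powr[symmetric])
  also have "2 * 4 powr \<phi> * (- (4 powr (- \<phi>)) * Gamma (2 * \<phi> + 1) * lead_const \<phi> \<theta>) * 1 = - 2 * Gamma (2 * \<phi> + 1) * lead_const \<phi> \<theta>"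
    by (simp add: powr_minus field_simps)
  finally have lim: "(\<lambda>m. 2 * 4 powr \<phi> * (cos_moment (2 * \<phi>) \<theta> (2 * real m) * real m powr (2 * \<phi> + 1) / ln (real m) ^ k) *
        (ln (real m) ^ k / ln (2 * real m) ^ k)) \<longlonglongrightarrow> - 2 * Gamma (2 * \<phi> + 1) * lead_const \<phi> \<theta>" .
  show ?thesis unfolding k_def[symmetric]
  proof (rule Lim_transform_eventually[OF lim])
    show "\<forall>\<^sub>F m in sequentially. 2 * 4 powr \<phi> * (cos_moment (2 * \<phi>) \<theta> (2 * real m) * real m powr (2 * \<phi> + 1) / ln (real m) ^ k) *
        (ln (real m) ^ k / ln (2 * real m) ^ k) =
        cos_moment (2 * \<phi>) \<theta> (2 * real m) * (2 * real m) powr (2 * \<phi> + 1) / ln (2 * real m) ^ k"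
      using eventually_gt_at_top[of 1]
    proof eventually_elim
      case (elim m)
      have "(2 * real m) powr (2 * \<phi> + 1) = 2 * 4 powr \<phi> * real m powr (2 * \<phi> + 1)"
        by (simp add: powr_mult powr_add powr_powr[symmetric])
      moreover have "ln (real m) > 0" using elim by simp
      ultimately show ?case by simp
    qed
  qed
qed

subsection \<open>Chebyshev coefficients of weakly singular functions\<close>

lemma cheb_T_cos: "cheb_T n (cos t) = cos (real n * t)"
proof (induction n rule: less_induct)
  case (less n)
  consider "n = 0" | "n = 1" | m where "n = Suc (Suc m)" by (metis One_nat_def not0_implies_Suc)
  then show ?case
  proof cases
    case 3
    have "cos (real n * t) = 2 * cos t * cos (real (Suc m) * t) - cos (real m * t)"
    proof -
      have "cos (real n * t) = cos (real (Suc m) * t + t)" "cos (real m * t) = cos (real (Suc m) * t - t)"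
        by (simp_all add: 3 algebra_simps)
      then show ?thesis by (simp only: cos_add cos_diff) simp
    qed
    with less[of m] less[of "Suc m"] 3 show ?thesis by simp
  qed auto
qed

text \<open>The substitution x = cos t is made on the open intervals, so f and u may take arbitrary
  values at the endpoints; this covers the quotient u / (1 - x^2).\<close>

lemma cheb_coeff_cos:
  assumes f: "\<And>t. t \<in> {0<..<pi} \<Longrightarrow> u (cos t) = f t"
    and int: "(\<lambda>t. cos (real n * t) * f t) absolutely_integrable_on {0..pi}"
  shows "cheb_coeff u n = (if n = 0 then 1 / pi else 2 / pi) * integral {0..pi} (\<lambda>t. cos (real n * t) * f t)"
proof -
  define F where "F x = cheb_T n x * u x / sqrt (1 - x\<^sup>2)" for x
  have img: "cos ` {0<..<pi} = {-1<..<1::real}"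
  proof (intro equalityI subsetI)
    fix x :: real assume x: "x \<in> {-1<..<1}"
    then have "arccos x \<in> {0<..<pi}" using arccos_lt_bounded[of x] by auto
    moreover have "cos (arccos x) = x" using x by simp
    ultimately show "x \<in> cos ` {0<..<pi}" by (metis image_eqI)
  qed (use cos_in_open in auto)
  have eq: "\<bar>- sin t\<bar> * F (cos t) = cos (real n * t) * f t" if t: "t \<in> {0<..<pi}" for t
  proof -
    have s: "sin t > 0" using t by (simp add: sin_gt_zero)
    then have "sqrt (1 - (cos t)\<^sup>2) = sin t" by (simp add: sin_squared_eq[symmetric])
    then show ?thesis using s f[OF t] by (simp add: F_def cheb_T_cos)
  qed
  have "(\<lambda>t. cos (real n * t) * f t) absolutely_integrable_on {0<..<pi}"
    using int by (simp add: absolutely_integrable_on_Icc_iff_Ioo)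
  moreover have "(\<lambda>t. \<bar>- sin t\<bar> * F (cos t)) absolutely_integrable_on {0<..<pi} \<longleftrightarrow>
      (\<lambda>t. cos (real n * t) * f t) absolutely_integrable_on {0<..<pi}"
    by (intro set_integrable_cong refl eq)
  ultimately have "(\<lambda>t. \<bar>- sin t\<bar> * F (cos t)) absolutely_integrable_on {0<..<pi}" by blast
  moreover have "integral {0<..<pi} (\<lambda>t. \<bar>- sin t\<bar> * F (cos t)) = integral {0..pi} (\<lambda>t. cos (real n * t) * f t)"
    unfolding integral_open_interval_real using eq by (intro integral_cong)
  moreover have "(\<lambda>t. \<bar>- sin t\<bar> * F (cos t)) absolutely_integrable_on {0<..<pi} \<and>
      integral {0<..<pi} (\<lambda>t. \<bar>- sin t\<bar> * F (cos t)) = integral {0..pi} (\<lambda>t. cos (real n * t) * f t)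
    \<longleftrightarrow> F absolutely_integrable_on (cos ` {0<..<pi}) \<and>
      integral (cos ` {0<..<pi}) F = integral {0..pi} (\<lambda>t. cos (real n * t) * f t)"
  proof (rule has_absolute_integral_change_of_variables_1')
    show "inj_on cos {0<..<pi}" using cos_inj_pi by (auto simp: inj_on_def)
    show "(cos has_real_derivative - sin t) (at t within {0<..<pi})" for t
      by (auto intro!: derivative_eq_intros)
  qed auto
  ultimately have "integral {-1<..<1} F = integral {0..pi} (\<lambda>t. cos (real n * t) * f t)"
    unfolding img by blast
  then show ?thesis
    unfolding cheb_coeff_def F_def[symmetric] integral_open_interval_real by simp
qed

text \<open>Analyticity of g enters as the real family D of all its derivatives, one-sided at the
  endpoints.\<close>

locale weak_singularity =
  fixes g :: "real \<Rightarrow> real" and D :: "nat \<Rightarrow> real \<Rightarrow> real" and \<phi> :: real and \<theta> :: nat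
  assumes \<phi>: "\<phi> > 1 / 2" and \<theta>: "\<theta> > 0"
    and D0: "\<And>x. x \<in> {-1..1} \<Longrightarrow> D 0 x = g x"
    and D: "\<And>k x. x \<in> {-1..1} \<Longrightarrow> (D k has_real_derivative D (Suc k) x) (at x within {-1..1})"
begin

lemma endpoint_class_g: "endpoint_class K 0 (\<lambda>t. g (cos t))"
  by (rule endpoint_class_cong[OF endpoint_class_smooth_cos[of D K 0, OF D]]) (auto simp: D0)

lemma endpoint_class_g_sinlog:
  assumes "e > 0"
  shows "endpoint_class K (p - e) (\<lambda>t. g (cos t) * sinlog p \<theta> t)"
  using endpoint_class_mult[OF endpoint_class_g endpoint_class_sinlog[OF assms]] by simp

definition moment :: "real \<Rightarrow> real \<Rightarrow> real" where
  "moment p \<nu> = integral {0..pi} (\<lambda>t. cos (\<nu> * t) * (g (cos t) * sinlog p \<theta> t))"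

lemma moment_minus: "moment p (- \<nu>) = moment p \<nu>"
  by (simp add: moment_def)

lemma moment_integrable:
  assumes "p > -1"
  shows "(\<lambda>t. cos (\<nu> * t) * (g (cos t) * sinlog p \<theta> t)) absolutely_integrable_on {0..pi}"
  using assms by (intro endpoint_class_absolutely_integrable[OF endpoint_class_g_sinlog[of "(p + 1) / 2" 0 p]])
    (auto intro!: continuous_intros simp: field_simps)

lemma moment_has_integral:
  assumes "p > -1"
  shows "((\<lambda>t. cos (\<nu> * t) * (g (cos t) * sinlog p \<theta> t)) has_integral moment p \<nu>) {0..pi}"
  unfolding moment_def
  using set_lebesgue_integral_eq_integral(1)[OF moment_integrable[OF assms]] has_integral_integral by blast

lemma cheb_coeff_moment:
  "cheb_coeff (weak_sing g \<phi> \<theta>) n = (if n = 0 then 1 / pi else 2 / pi) * moment (2 * \<phi>) (real n)"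
  unfolding moment_def
proof (rule cheb_coeff_cos)
  show "weak_sing g \<phi> \<theta> (cos t) = g (cos t) * sinlog (2 * \<phi>) \<theta> t" if "t \<in> {0<..<pi}" for t
    using that by (rule weak_sing_cos)
  show "(\<lambda>t. cos (real n * t) * (g (cos t) * sinlog (2 * \<phi>) \<theta> t)) absolutely_integrable_on {0..pi}"
    by (rule moment_integrable) (use \<phi> in simp)
qed

text \<open>Division by 1 - x^2 = sin^2 t lowers the exponent by two; \<phi> > 1/2 is exactly the
  integrability condition 2\<phi> - 2 > -1.\<close>

lemma quad_coeff_moment:
  "quad_coeff (weak_sing g \<phi> \<theta>) n = (if n = 0 then 1 / pi else 2 / pi) * moment (2 * \<phi> - 2) (real n)"
  unfolding moment_def quad_coeff_def
proof (rule cheb_coeff_cos[OF _ moment_integrable])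
  fix t assume t: "t \<in> {0<..<pi}"
  have s: "sin t > 0" using t by (simp add: sin_gt_zero)
  have "sinlog (2 * \<phi>) \<theta> t = sinlog (2 * \<phi> - 2) \<theta> t * (sin t)\<^sup>2"
    using s by (simp add: sinlog_def powr_diff)
  then show "weak_sing g \<phi> \<theta> (cos t) / (1 - (cos t)\<^sup>2) = g (cos t) * sinlog (2 * \<phi> - 2) \<theta> t"
    using s weak_sing_cos[OF t, of g \<phi> \<theta>] by (simp add: sin_squared_eq[symmetric])
qed (use \<phi> in auto)

text \<open>Integrated form of 4 sin^2 t cos (\<nu> t) = 2 cos (\<nu> t) - cos ((\<nu>+2) t) - cos
  ((\<nu>-2) t).\<close>

lemma moment_second_difference:
  "4 * moment (2 * \<phi>) \<nu> = 2 * moment (2 * \<phi> - 2) \<nu> - moment (2 * \<phi> - 2) (\<nu> + 2) - moment (2 * \<phi> - 2) (\<nu> - 2)"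
proof -
  let ?f = "\<lambda>\<nu> t. cos (\<nu> * t) * (g (cos t) * sinlog (2 * \<phi> - 2) \<theta> t)"
  have "((\<lambda>t. 2 * ?f \<nu> t - ?f (\<nu> + 2) t - ?f (\<nu> - 2) t) has_integral
     2 * moment (2 * \<phi> - 2) \<nu> - moment (2 * \<phi> - 2) (\<nu> + 2) - moment (2 * \<phi> - 2) (\<nu> - 2)) {0<..<pi}"
    unfolding has_integral_Icc_iff_Ioo[symmetric]
    using \<phi> by (intro has_integral_diff has_integral_mult_right moment_has_integral) auto
  moreover have "2 * ?f \<nu> t - ?f (\<nu> + 2) t - ?f (\<nu> - 2) t = 4 * (cos (\<nu> * t) * (g (cos t) * sinlog (2 * \<phi>) \<theta> t))"
    if t: "t \<in> {0<..<pi}" for t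
  proof -
    have s: "sin t > 0" using t by (simp add: sin_gt_zero)
    have e1: "sinlog (2 * \<phi>) \<theta> t = sinlog (2 * \<phi> - 2) \<theta> t * (sin t)\<^sup>2"
      using s by (simp add: sinlog_def powr_diff)
    have e2: "cos ((\<nu> + 2) * t) = 2 * (cos (\<nu> * t) * cos (2 * t)) - cos ((\<nu> - 2) * t)"
      by (simp add: ring_distribs cos_add cos_diff)
    show ?thesis unfolding e1 e2 cos_double_sin by (simp add: algebra_simps)
  qed
  ultimately have "((\<lambda>t. 4 * (cos (\<nu> * t) * (g (cos t) * sinlog (2 * \<phi>) \<theta> t))) has_integral
     2 * moment (2 * \<phi> - 2) \<nu> - moment (2 * \<phi> - 2) (\<nu> + 2) - moment (2 * \<phi> - 2) (\<nu> - 2)) {0<..<pi}"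
    by (rule has_integral_eq[rotated])
  moreover have "((\<lambda>t. 4 * (cos (\<nu> * t) * (g (cos t) * sinlog (2 * \<phi>) \<theta> t))) has_integral 4 * moment (2 * \<phi>) \<nu>) {0<..<pi}"
    unfolding has_integral_Icc_iff_Ioo[symmetric] using \<phi>
    by (intro has_integral_mult_right moment_has_integral) auto
  ultimately show ?thesis by (rule has_integral_unique[symmetric])
qed

text \<open>As a is a second difference of the lower moments, its summation b is a first difference.
  The starting values fit because frequencies -2 and -1 fold back by evenness; at n = 0 this
  doubling compensates the halved normalization of the zeroth coefficient.\<close>

lemma diff_coeff_moment:
  "diff_coeff (weak_sing g \<phi> \<theta>) n = (moment (2 * \<phi> - 2) (real n + 2) - moment (2 * \<phi> - 2) (real n)) / (2 * pi)"
proof (induction n rule: induct_nat_012)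
  case 0
  have "4 * moment (2 * \<phi>) 0 = 2 * moment (2 * \<phi> - 2) 0 - 2 * moment (2 * \<phi> - 2) 2"
    using moment_second_difference[of 0] moment_minus[of _ 2] by simp
  then have "moment (2 * \<phi>) 0 = (moment (2 * \<phi> - 2) 0 - moment (2 * \<phi> - 2) 2) / 2" by simp
  then show ?case by (simp add: cheb_coeff_moment field_simps)
next
  case 1
  have "4 * moment (2 * \<phi>) 1 = moment (2 * \<phi> - 2) 1 - moment (2 * \<phi> - 2) 3"
    using moment_second_difference[of 1] moment_minus[of _ 1] by simp
  then have "moment (2 * \<phi>) 1 = (moment (2 * \<phi> - 2) 1 - moment (2 * \<phi> - 2) 3) / 4" by simp
  then show ?case by (simp add: cheb_coeff_moment field_simps)
next
  case (ge2 n)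
  have "4 * moment (2 * \<phi>) (real n + 2) = 2 * moment (2 * \<phi> - 2) (real n + 2) - moment (2 * \<phi> - 2) (real n + 4) - moment (2 * \<phi> - 2) (real n)"
    using moment_second_difference[of "real n + 2"] by (simp add: add_ac)
  then have "moment (2 * \<phi>) (real n + 2) = (2 * moment (2 * \<phi> - 2) (real n + 2) - moment (2 * \<phi> - 2) (real n + 4) - moment (2 * \<phi> - 2) (real n)) / 4"
    by simp
  then have "cheb_coeff (weak_sing g \<phi> \<theta>) (Suc (Suc n)) =
      2 / pi * ((2 * moment (2 * \<phi> - 2) (real n + 2) - moment (2 * \<phi> - 2) (real n + 4) - moment (2 * \<phi> - 2) (real n)) / 4)"
  proof -
    have "real (Suc (Suc n)) = real n + 2" by simp
    with cheb_coeff_moment[of "Suc (Suc n)"] show ?thesis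
      unfolding \<open>moment (2 * \<phi>) (real n + 2) = _\<close>[symmetric] by (simp add: add.commute)
  qed
  moreover have "diff_coeff (weak_sing g \<phi> \<theta>) (Suc (Suc n)) = diff_coeff (weak_sing g \<phi> \<theta>) n - cheb_coeff (weak_sing g \<phi> \<theta>) (Suc (Suc n))"
    by simp
  ultimately show ?case unfolding ge2(1) by (simp add: field_simps)
qed

text \<open>The index 0 is excluded on account of the different normalization of the zeroth
  coefficient.\<close>

lemma quad_coeff_diff:
  "n > 0 \<Longrightarrow> quad_coeff (weak_sing g \<phi> \<theta>) n - quad_coeff (weak_sing g \<phi> \<theta>) (n + 2) = - 4 * diff_coeff (weak_sing g \<phi> \<theta>) n"
  by (simp add: quad_coeff_moment diff_coeff_moment field_simps)

lemma diff_coeff_diff: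
  "diff_coeff (weak_sing g \<phi> \<theta>) n - diff_coeff (weak_sing g \<phi> \<theta>) (n + 2) = cheb_coeff (weak_sing g \<phi> \<theta>) (n + 2)"
  by simp

lemma moment_tendsto_0: "(\<lambda>n. moment (2 * \<phi> - 2) (real n)) \<longlonglongrightarrow> 0"
proof -
  \<comment> \<open>Half of the available margin 2\<phi> - 1 pays for the logarithms; the other half
    leaves a negative power of n.\<close>
  define e where "e = (2 * \<phi> - 1) / 2"
  have e: "e > 0" "2 * \<phi> - 2 - e > -1" using \<phi> by (auto simp: e_def field_simps)
  from oscillatory_integral_bound[OF endpoint_class_g_sinlog[OF e(1)] e(2)] obtain C where
    C: "\<And>n. n \<ge> 1 \<Longrightarrow> \<bar>moment (2 * \<phi> - 2) (real n)\<bar> \<le> C * real n powr (- (2 * \<phi> - 2 - e) - 1)"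
    unfolding moment_def by blast
  define q where "q = - (2 * \<phi> - 2 - e) - 1"
  have q: "q < 0" using e by (simp add: q_def)
  have "(\<lambda>n. C * real n powr q) \<longlonglongrightarrow> 0" using q by real_asymp
  then show ?thesis
    by (rule Lim_null_comparison[rotated])
      (use C in \<open>auto simp: eventually_sequentially q_def intro!: exI[of _ 1]\<close>)
qed

lemma quad_coeff_tendsto_0: "quad_coeff (weak_sing g \<phi> \<theta>) \<longlonglongrightarrow> 0"
proof -
  have "(\<lambda>n. 2 / pi * moment (2 * \<phi> - 2) (real n)) \<longlonglongrightarrow> 2 / pi * 0"
    by (intro tendsto_mult tendsto_const moment_tendsto_0)
  moreover have "\<forall>\<^sub>F n in sequentially. 2 / pi * moment (2 * \<phi> - 2) (real n) = quad_coeff (weak_sing g \<phi> \<theta>) n"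
    using eventually_gt_at_top[of 0] by eventually_elim (simp add: quad_coeff_moment)
  ultimately have "quad_coeff (weak_sing g \<phi> \<theta>) \<longlonglongrightarrow> 2 / pi * 0" by (rule Lim_transform_eventually)
  then show ?thesis by simp
qed

lemma diff_coeff_tendsto_0: "diff_coeff (weak_sing g \<phi> \<theta>) \<longlonglongrightarrow> 0"
proof -
  have "(\<lambda>n. moment (2 * \<phi> - 2) (real n + 2)) \<longlonglongrightarrow> 0"
    using LIMSEQ_ignore_initial_segment[OF moment_tendsto_0, of 2] by (simp add: add.commute)
  from tendsto_divide[OF tendsto_diff[OF this moment_tendsto_0] tendsto_const[of "2 * pi"]]
  show ?thesis by (simp add: diff_coeff_moment[abs_def])
qed

text \<open>Splitting off the affine interpolant of \<open>g\<close> at \<open>\<plusminus>1\<close> reduces the leading term to \<open>g = 1\<close>.\<close>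

lemma moment_decomposition:
  obtains R C where
    "\<And>n. moment (2 * \<phi>) (real n) = (g 1 + g (-1)) / 2 * cos_moment (2 * \<phi>) \<theta> (real n)
      + (g 1 - g (-1)) / 4 * (cos_moment (2 * \<phi>) \<theta> (real n + 1) + cos_moment (2 * \<phi>) \<theta> (real n - 1)) + R n"
    "\<And>n. n \<ge> 1 \<Longrightarrow> \<bar>R n\<bar> \<le> C * real n powr (- (2 * \<phi>) - 2)"
proof -
  \<comment> \<open>The polynomial \<alpha> + \<beta> x agrees with g at both endpoints.\<close>
  define \<alpha> \<beta> where "\<alpha> = (g 1 + g (-1)) / 2" and "\<beta> = (g 1 - g (-1)) / 2"
  define D' where "D' k x = D k x - (if k = 0 then \<alpha> + \<beta> * x else if k = 1 then \<beta> else 0)" for k x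
  have D': "(D' k has_real_derivative D' (Suc k) x) (at x within {-1..1})" if "x \<in> {-1..1}" for k x
  proof -
    have "((\<lambda>x. if k = 0 then \<alpha> + \<beta> * x else if k = 1 then \<beta> else 0) has_real_derivative (if Suc k = 1 then \<beta> else 0)) (at x within {-1..1})"
      by (cases "k = 0") (auto intro!: derivative_eq_intros)
    from DERIV_diff[OF D[OF that, of k] this] show ?thesis by (simp add: D'_def[abs_def])
  qed
  have z: "D' 0 (-1) = 0" "D' 0 1 = 0" by (auto simp: D'_def D0 \<alpha>_def \<beta>_def field_simps)
  define r where "r t = D' 0 (cos t) * sinlog (2 * \<phi>) \<theta> t" for t
  \<comment> \<open>The zeros at the endpoints are worth two orders, of which one is spent on the
    logarithms; any loss below 2 would keep the remainder smaller than the main term by a power of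
    n.\<close>
  have cls: "endpoint_class K (2 * \<phi> + 1) r" for K
    using endpoint_class_mult[OF endpoint_class_smooth_cos_vanishing[of D' K, OF D' z] endpoint_class_sinlog[of 1 K "2 * \<phi>" \<theta>]]
    by (simp add: r_def[abs_def] add_ac)
  have p: "2 * \<phi> > -1" "2 * \<phi> + 1 > -1" using \<phi> by auto
  define R where "R n = integral {0..pi} (\<lambda>t. cos (real n * t) * r t)" for n
  have Rint: "((\<lambda>t. cos (real n * t) * r t) has_integral R n) {0..pi}" for n
  proof -
    have "(\<lambda>t. cos (real n * t) * r t) absolutely_integrable_on {0..pi}"
      by (intro endpoint_class_absolutely_integrable[OF cls p(2)] continuous_intros)
    then show ?thesis
      unfolding R_def by (intro integrable_integral set_lebesgue_integral_eq_integral)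
  qed
  have mom: "moment (2 * \<phi>) (real n) = \<alpha> * cos_moment (2 * \<phi>) \<theta> (real n) + \<beta> / 2 * (cos_moment (2 * \<phi>) \<theta> (real n + 1) + cos_moment (2 * \<phi>) \<theta> (real n - 1)) + R n" for n
  proof -
    have "((\<lambda>t. \<alpha> * (cos (real n * t) * sinlog (2 * \<phi>) \<theta> t) + \<beta> / 2 * (cos ((real n + 1) * t) * sinlog (2 * \<phi>) \<theta> t + cos ((real n - 1) * t) * sinlog (2 * \<phi>) \<theta> t) + cos (real n * t) * r t) has_integral
      \<alpha> * cos_moment (2 * \<phi>) \<theta> (real n) + \<beta> / 2 * (cos_moment (2 * \<phi>) \<theta> (real n + 1) + cos_moment (2 * \<phi>) \<theta> (real n - 1)) + R n) {0..pi}"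
      by (intro has_integral_add has_integral_mult_right cos_moment_has_integral p Rint)
    moreover have "\<alpha> * (cos (real n * t) * sinlog (2 * \<phi>) \<theta> t) + \<beta> / 2 * (cos ((real n + 1) * t) * sinlog (2 * \<phi>) \<theta> t + cos ((real n - 1) * t) * sinlog (2 * \<phi>) \<theta> t) + cos (real n * t) * r t
        = cos (real n * t) * (g (cos t) * sinlog (2 * \<phi>) \<theta> t)" if "t \<in> {0..pi}" for t
    proof -
      have e1: "D' 0 (cos t) = g (cos t) - (\<alpha> + \<beta> * cos t)" by (simp add: D'_def D0)
      have e2: "cos ((real n + 1) * t) = 2 * (cos (real n * t) * cos t) - cos ((real n - 1) * t)"
        by (simp add: ring_distribs cos_add cos_diff)
      show ?thesis unfolding r_def e1 e2 by (simp add: algebra_simps)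
    qed
    ultimately have "((\<lambda>t. cos (real n * t) * (g (cos t) * sinlog (2 * \<phi>) \<theta> t)) has_integral
      \<alpha> * cos_moment (2 * \<phi>) \<theta> (real n) + \<beta> / 2 * (cos_moment (2 * \<phi>) \<theta> (real n + 1) + cos_moment (2 * \<phi>) \<theta> (real n - 1)) + R n) {0..pi}"
      by (rule has_integral_eq[rotated])
    then show ?thesis using moment_has_integral[OF p(1)] by (rule has_integral_unique[symmetric])
  qed
  obtain C where C: "\<And>n. n \<ge> 1 \<Longrightarrow> \<bar>R n\<bar> \<le> C * real n powr (- (2 * \<phi> + 1) - 1)"
    using oscillatory_integral_bound[OF cls p(2)] unfolding R_def by blast
  have e: "- (2 * \<phi> + 1) - 1 = - (2 * \<phi>) - 2" by simp
  show thesis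
  proof (rule that[of R C])
    show "\<bar>R n\<bar> \<le> C * real n powr (- (2 * \<phi>) - 2)" if "n \<ge> 1" for n
      using C[OF that] unfolding e .
  qed (simp add: mom \<alpha>_def \<beta>_def)
qed

text \<open>Odd pure moments vanish, so for even n only the mean of the endpoint values contributes,
  and for odd n only half their difference, through the two even neighbours. Both cases combine into
  \<open>gamma3\<close>. The statement is a difference because \<open>gamma3\<close> may be 0 for
  one parity.\<close>

lemma cheb_coeff_limit:
  "(\<lambda>n. cheb_coeff (weak_sing g \<phi> \<theta>) n * real n powr (2 * \<phi> + 1) / amp_scale \<phi> \<theta> n
      - gamma3 g n * (- (2 * Gamma (2 * \<phi> + 1) / pi) * lead_const \<phi> \<theta>)) \<longlonglongrightarrow> 0"
proof -
  obtain R C where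
    dec: "\<And>n. moment (2 * \<phi>) (real n) = (g 1 + g (-1)) / 2 * cos_moment (2 * \<phi>) \<theta> (real n)
      + (g 1 - g (-1)) / 4 * (cos_moment (2 * \<phi>) \<theta> (real n + 1) + cos_moment (2 * \<phi>) \<theta> (real n - 1)) + R n"
    and C: "\<And>n. n \<ge> 1 \<Longrightarrow> \<bar>R n\<bar> \<le> C * real n powr (- (2 * \<phi>) - 2)"
    using moment_decomposition by blast
  have \<phi>0: "\<phi> > 0" "2 * \<phi> > -1" using \<phi> by auto
  define k where "k = log_order \<phi> \<theta>"
  define q where "q n = real n powr (2 * \<phi> + 1) / ln (real n) ^ k" for n
  define N where "N n = cos_moment (2 * \<phi>) \<theta> n" for n
  define L where "L = - 2 * Gamma (2 * \<phi> + 1) * lead_const \<phi> \<theta>"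
  have Nlim: "(\<lambda>m. N (2 * real m) * q (2 * m)) \<longlonglongrightarrow> L"
    using cos_moment_even_limit[OF \<phi>0(1) \<theta>] by (simp add: N_def q_def k_def L_def)
  have Nodd: "N (2 * real m + 1) = 0" for m unfolding N_def by (rule cos_moment_odd[OF \<phi>0(2)])
  have Rlim: "(\<lambda>n. R n * q n) \<longlonglongrightarrow> 0"
  proof (rule Lim_null_comparison)
    show "(\<lambda>n. C * (real n powr (- 1) / ln (real n) ^ k)) \<longlonglongrightarrow> 0" by real_asymp
    show "\<forall>\<^sub>F n in sequentially. norm (R n * q n) \<le> C * (real n powr (- 1) / ln (real n) ^ k)"
      using eventually_gt_at_top[of 1]
    proof eventually_elim
      case (elim n)
      have q0: "q n \<ge> 0" using elim by (simp add: q_def)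
      have "norm (R n * q n) \<le> (C * real n powr (- (2 * \<phi>) - 2)) * q n"
        unfolding norm_mult using C[of n] elim q0 by (intro mult_mono) auto
      also have "\<dots> = C * (real n powr (- (2 * \<phi>) - 2) * real n powr (2 * \<phi> + 1) / ln (real n) ^ k)"
        by (simp add: q_def)
      also have "real n powr (- (2 * \<phi>) - 2) * real n powr (2 * \<phi> + 1) = real n powr (- 1)"
        by (simp only: powr_add[symmetric]) simp
      finally show ?case .
    qed
  qed
  \<comment> \<open>For odd n the moments live at n - 1 and n + 1, so their weights must be
    exchanged for the weight at n.\<close>
  have q_ratio: "(\<lambda>m. q (2 * m + 1) / q (2 * m)) \<longlonglongrightarrow> 1" "(\<lambda>m. q (2 * m + 1) / q (2 * Suc m)) \<longlonglongrightarrow> 1"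
  proof -
    have p: "(\<lambda>m. (real (2 * m + 1) / real (2 * m)) powr (2 * \<phi> + 1)) \<longlonglongrightarrow> 1 powr (2 * \<phi> + 1)"
      "(\<lambda>m. (real (2 * m + 1) / real (2 * Suc m)) powr (2 * \<phi> + 1)) \<longlonglongrightarrow> 1 powr (2 * \<phi> + 1)"
      by (rule tendsto_powr; (real_asymp | simp))+
    have l: "(\<lambda>m. ln (real (2 * m)) ^ k / ln (real (2 * m + 1)) ^ k) \<longlonglongrightarrow> 1"
      "(\<lambda>m. ln (real (2 * Suc m)) ^ k / ln (real (2 * m + 1)) ^ k) \<longlonglongrightarrow> 1"
      by real_asymp+
    have qr: "q i / q j = (real i / real j) powr (2 * \<phi> + 1) * (ln (real j) ^ k / ln (real i) ^ k)" for i j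
      by (simp add: q_def powr_divide)
    show "(\<lambda>m. q (2 * m + 1) / q (2 * m)) \<longlonglongrightarrow> 1" "(\<lambda>m. q (2 * m + 1) / q (2 * Suc m)) \<longlonglongrightarrow> 1"
      unfolding qr using tendsto_mult[OF p(1) l(1)] tendsto_mult[OF p(2) l(2)] by simp_all
  qed
  have qnz: "\<forall>\<^sub>F m in sequentially. q (2 * m) \<noteq> 0 \<and> q (2 * Suc m) \<noteq> 0"
    using eventually_gt_at_top[of 1] by eventually_elim (auto simp: q_def)
  define f where "f n = moment (2 * \<phi>) (real n) * q n - gamma3 g n / 2 * L" for n
  have "(\<lambda>m. f (2 * m)) \<longlonglongrightarrow> 0"
  proof -
    have sub: "filterlim (\<lambda>m::nat. 2 * m) at_top sequentially"
      by (intro filterlim_subseq strict_monoI) auto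
    have "(\<lambda>m. (g 1 + g (-1)) / 2 * (N (2 * real m) * q (2 * m)) + R (2 * m) * q (2 * m) - (g 1 + g (-1)) / 2 * L)
        \<longlonglongrightarrow> (g 1 + g (-1)) / 2 * L + 0 - (g 1 + g (-1)) / 2 * L"
      by (intro tendsto_intros Nlim filterlim_compose[OF Rlim sub])
    moreover have "\<forall>\<^sub>F m in sequentially. (g 1 + g (-1)) / 2 * (N (2 * real m) * q (2 * m)) + R (2 * m) * q (2 * m) - (g 1 + g (-1)) / 2 * L = f (2 * m)"
      using eventually_gt_at_top[of 0]
    proof eventually_elim
      case (elim m)
      then have "2 * real m - 1 = 2 * real (m - 1) + 1" by simp
      then have "N (2 * real m - 1) = 0" by (simp only: Nodd)
      then have "moment (2 * \<phi>) (real (2 * m)) = (g 1 + g (-1)) / 2 * N (2 * real m) + R (2 * m)"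
        using dec[of "2 * m"] Nodd[of m] by (simp add: N_def)
      then show ?case by (simp add: f_def gamma3_def algebra_simps)
    qed
    ultimately show ?thesis by (auto intro: Lim_transform_eventually)
  qed
  moreover have "(\<lambda>m. f (2 * m + 1)) \<longlonglongrightarrow> 0"
  proof -
    have sub: "filterlim (\<lambda>m::nat. 2 * m + 1) at_top sequentially"
      by (intro filterlim_subseq strict_monoI) auto
    have "(\<lambda>m. (g 1 - g (-1)) / 4 * ((N (2 * real (Suc m)) * q (2 * Suc m)) * (q (2 * m + 1) / q (2 * Suc m))
         + (N (2 * real m) * q (2 * m)) * (q (2 * m + 1) / q (2 * m))) + R (2 * m + 1) * q (2 * m + 1) - (g 1 - g (-1)) / 2 * L)
        \<longlonglongrightarrow> (g 1 - g (-1)) / 4 * (L * 1 + L * 1) + 0 - (g 1 - g (-1)) / 2 * L"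
      by (intro tendsto_add tendsto_diff tendsto_mult tendsto_const Nlim LIMSEQ_Suc[OF Nlim] q_ratio filterlim_compose[OF Rlim sub])
    also have "(g 1 - g (-1)) / 4 * (L * 1 + L * 1) + 0 - (g 1 - g (-1)) / 2 * L = 0" by (simp add: field_simps)
    finally have "(\<lambda>m. (g 1 - g (-1)) / 4 * ((N (2 * real (Suc m)) * q (2 * Suc m)) * (q (2 * m + 1) / q (2 * Suc m))
         + (N (2 * real m) * q (2 * m)) * (q (2 * m + 1) / q (2 * m))) + R (2 * m + 1) * q (2 * m + 1) - (g 1 - g (-1)) / 2 * L)
        \<longlonglongrightarrow> 0" .
    moreover have "\<forall>\<^sub>F m in sequentially. (g 1 - g (-1)) / 4 * ((N (2 * real (Suc m)) * q (2 * Suc m)) * (q (2 * m + 1) / q (2 * Suc m))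
         + (N (2 * real m) * q (2 * m)) * (q (2 * m + 1) / q (2 * m))) + R (2 * m + 1) * q (2 * m + 1) - (g 1 - g (-1)) / 2 * L = f (2 * m + 1)"
      using qnz
    proof eventually_elim
      case (elim m)
      have "real (2 * m + 1) = 2 * real m + 1" "real (2 * m + 1) + 1 = 2 * real (Suc m)" "real (2 * m + 1) - 1 = 2 * real m" by simp_all
      then have mom: "moment (2 * \<phi>) (real (2 * m + 1)) = (g 1 - g (-1)) / 4 * (N (2 * real (Suc m)) + N (2 * real m)) + R (2 * m + 1)"
        using dec[of "2 * m + 1"] Nodd[of m] by (simp only: N_def[symmetric])
      have g3: "gamma3 g (2 * m + 1) = g 1 - g (-1)" by (simp add: gamma3_def)
      have "N (2 * real (Suc m)) * q (2 * Suc m) * (q (2 * m + 1) / q (2 * Suc m)) = N (2 * real (Suc m)) * q (2 * m + 1)"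
        "N (2 * real m) * q (2 * m) * (q (2 * m + 1) / q (2 * m)) = N (2 * real m) * q (2 * m + 1)"
        using elim by (simp_all del: of_nat_Suc mult_Suc_right)
      then show ?case unfolding f_def mom g3 by (simp only: ring_distribs mult.assoc)
    qed
    ultimately show ?thesis by (rule Lim_transform_eventually)
  qed
  ultimately have "f \<longlonglongrightarrow> 0" by (rule limseq_even_odd)
  then have "(\<lambda>n. 2 / pi * f n) \<longlonglongrightarrow> 2 / pi * 0" by (intro tendsto_mult tendsto_const)
  moreover have "\<forall>\<^sub>F n in sequentially. 2 / pi * f n =
      cheb_coeff (weak_sing g \<phi> \<theta>) n * real n powr (2 * \<phi> + 1) / amp_scale \<phi> \<theta> n
      - gamma3 g n * (- (2 * Gamma (2 * \<phi> + 1) / pi) * lead_const \<phi> \<theta>)"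
    using eventually_gt_at_top[of 0]
    by eventually_elim (simp add: cheb_coeff_moment f_def q_def amp_scale_eq k_def L_def right_diff_distrib add_divide_distrib mult_ac)
  ultimately have "(\<lambda>n. cheb_coeff (weak_sing g \<phi> \<theta>) n * real n powr (2 * \<phi> + 1) / amp_scale \<phi> \<theta> n
      - gamma3 g n * (- (2 * Gamma (2 * \<phi> + 1) / pi) * lead_const \<phi> \<theta>)) \<longlonglongrightarrow> 2 / pi * 0"
    by (rule Lim_transform_eventually)
  then show ?thesis by (simp only: mult_zero_right)
qed

end

subsection \<open>Amplitudes\<close>

lemma DERIV_Re_of_real:
  assumes "(f has_field_derivative d) (at (complex_of_real x))"
  shows "((\<lambda>t. Re (f (complex_of_real t))) has_real_derivative Re d) (at x)"
  using bounded_linear.has_vector_derivative[OF bounded_linear_Re has_vector_derivative_real_field[OF assms]]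
  by (simp add: has_real_derivative_iff_has_vector_derivative)

text \<open>Iterated real \<open>deriv\<close> says nothing without differentiability at every
  stage; a holomorphic extension supplies it for all orders at once.\<close>

lemma higher_deriv_Re_of_real:
  assumes f: "f holomorphic_on S" and S: "open S"
    and h: "\<And>t. complex_of_real t \<in> S \<Longrightarrow> h t = Re (f (complex_of_real t))"
    and x: "complex_of_real x \<in> S"
  shows "(deriv ^^ j) h x = Re ((deriv ^^ j) f (complex_of_real x))"
  using x
proof (induction j arbitrary: x)
  case 0
  then show ?case by (simp add: h)
next
  case (Suc j)
  have "((deriv ^^ j) f has_field_derivative (deriv ^^ Suc j) f (complex_of_real x)) (at (complex_of_real x))"
    by (rule has_field_derivative_higher_deriv[OF f S Suc.prems])
  then have d: "((\<lambda>t. Re ((deriv ^^ j) f (complex_of_real t))) has_real_derivative Re ((deriv ^^ Suc j) f (complex_of_real x))) (at x)"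
    by (rule DERIV_Re_of_real)
  have "open (complex_of_real -` S)" by (intro open_vimage S continuous_intros)
  with d have "((deriv ^^ j) h has_real_derivative Re ((deriv ^^ Suc j) f (complex_of_real x))) (at x)"
    by (rule has_field_derivative_transform_within_open) (use Suc in auto)
  then show ?case by (simp add: DERIV_imp_deriv)
qed

text \<open>In the Leibniz formula an affine factor leaves only two terms; at j = 0 the truncated j
  - 1 is multiplied by 0.\<close>

lemma higher_deriv_linear_mult:
  fixes f :: "complex \<Rightarrow> complex"
  assumes f: "f holomorphic_on S" and S: "open S" and z: "z \<in> S"
  shows "(deriv ^^ j) (\<lambda>w. (c + d * w) * f w) z =
    (c + d * z) * (deriv ^^ j) f z + of_nat j * d * (deriv ^^ (j - 1)) f z"
  using z
proof (induction j arbitrary: z)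
  case (Suc j)
  have D: "((deriv ^^ i) f has_field_derivative (deriv ^^ Suc i) f z) (at z)" for i
    by (rule has_field_derivative_higher_deriv[OF f S Suc.prems])
  have "((\<lambda>w. of_nat j * d * (deriv ^^ (j - 1)) f w) has_field_derivative of_nat j * d * (deriv ^^ j) f z) (at z)"
    using DERIV_cmult[OF D[of "j - 1"], of "of_nat j * d"] by (cases j) auto
  moreover have "((\<lambda>w. (c + d * w) * (deriv ^^ j) f w) has_field_derivative
      d * (deriv ^^ j) f z + (c + d * z) * (deriv ^^ Suc j) f z) (at z)"
    using D[of j] by (auto intro!: derivative_eq_intros)
  ultimately have "((\<lambda>w. (c + d * w) * (deriv ^^ j) f w + of_nat j * d * (deriv ^^ (j - 1)) f w) has_field_derivative
      d * (deriv ^^ j) f z + (c + d * z) * (deriv ^^ Suc j) f z + of_nat j * d * (deriv ^^ j) f z) (at z)"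
    by (rule DERIV_add[rotated])
  then have "((deriv ^^ j) (\<lambda>w. (c + d * w) * f w) has_field_derivative
      d * (deriv ^^ j) f z + (c + d * z) * (deriv ^^ Suc j) f z + of_nat j * d * (deriv ^^ j) f z) (at z)"
    by (rule has_field_derivative_transform_within_open[OF _ S Suc.prems]) (simp add: Suc.IH)
  then show ?case by (simp add: DERIV_imp_deriv algebra_simps)
qed simp

text \<open>The complex form of Beta (2z + 1) (n - z), whose arguments add up to n + z + 1. The
  denominator is written with the entire function \<open>rGamma\<close>, so it causes no
  poles.\<close>

definition beta_kernel :: "nat \<Rightarrow> complex \<Rightarrow> complex" where
  "beta_kernel n z = Gamma (2 * z + 1) * Gamma (of_nat n - z) * rGamma (of_nat n + z + 1)"

text \<open>The strip on which both 2z + 1 and n - z have positive real part.\<close>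

definition beta_strip :: "nat \<Rightarrow> complex set" where
  "beta_strip n = {z. - (1 / 2) < Re z} \<inter> {z. Re z < real n}"

lemma open_beta_strip: "open (beta_strip n)"
  unfolding beta_strip_def by (intro open_Int open_halfspace_Re_gt open_halfspace_Re_lt)

lemma holomorphic_beta_kernel: "beta_kernel n holomorphic_on beta_strip n"
proof -
  have "2 * z + 1 \<notin> \<int>\<^sub>\<le>\<^sub>0" "of_nat n - z \<notin> \<int>\<^sub>\<le>\<^sub>0" if "z \<in> beta_strip n" for z
    using that by (auto simp: beta_strip_def complex_eq_iff elim!: nonpos_Ints_cases)
  then show ?thesis
    unfolding beta_kernel_def by (intro holomorphic_intros) auto
qed

lemma beta_kernel_of_real:
  assumes "complex_of_real t \<in> beta_strip n"
  shows "Beta (2 * t + 1) (real n - t) = Re (beta_kernel n (complex_of_real t))"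
proof -
  have "beta_kernel n (complex_of_real t) =
      Gamma (complex_of_real (2 * t + 1)) * Gamma (complex_of_real (real n - t)) * rGamma (complex_of_real (real n + t + 1))"
    by (simp add: beta_kernel_def)
  also have "\<dots> = complex_of_real (Gamma (2 * t + 1) * Gamma (real n - t) * rGamma (real n + t + 1))"
    by (simp only: Gamma_complex_of_real rGamma_complex_of_real of_real_mult)
  also have "Gamma (2 * t + 1) * Gamma (real n - t) * rGamma (real n + t + 1) = Beta (2 * t + 1) (real n - t)"
    by (simp add: Beta_def rGamma_inverse_Gamma divide_inverse algebra_simps)
  finally show ?thesis by simp
qed

text \<open>The factors 1 and -1 are spelled out to match the pattern c + d * w of
  \<open>higher_deriv_linear_mult\<close>.\<close>

lemma beta_kernel_rec:
  assumes "z \<in> beta_strip n"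
  shows "(of_nat n + 1 + 1 * z) * beta_kernel (Suc n) z = (of_nat n + (- 1) * z) * beta_kernel n z"
proof -
  have "of_nat n - z \<notin> \<int>\<^sub>\<le>\<^sub>0"
    using assms by (auto simp: beta_strip_def complex_eq_iff elim!: nonpos_Ints_cases)
  then have G: "Gamma (of_nat n - z + 1) = (of_nat n - z) * Gamma (of_nat n - z)"
    by (intro Gamma_plus1) auto
  have rG: "(of_nat n + z + 1) * rGamma (of_nat n + z + 1 + 1) = rGamma (of_nat n + z + 1)"
    by (rule rGamma_plus1)
  have e: "of_nat (Suc n) - z = of_nat n - z + 1" "of_nat (Suc n) + z + 1 = of_nat n + z + 1 + 1" by simp_all
  have "(of_nat n + z + 1) * beta_kernel (Suc n) z =
      Gamma (2 * z + 1) * Gamma (of_nat n - z + 1) * ((of_nat n + z + 1) * rGamma (of_nat n + z + 1 + 1))"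
    unfolding beta_kernel_def e by (simp only: mult_ac)
  also have "\<dots> = (of_nat n - z) * beta_kernel n z"
    unfolding G rG beta_kernel_def by (simp only: mult_ac)
  finally have "(of_nat n + z + 1) * beta_kernel (Suc n) z = (of_nat n - z) * beta_kernel n z" .
  then show ?thesis by (simp add: algebra_simps)
qed

definition beta_deriv :: "real \<Rightarrow> nat \<Rightarrow> nat \<Rightarrow> real" where
  "beta_deriv \<phi> j n = (deriv ^^ j) (\<lambda>t. Beta (2 * t + 1) (real n - t)) \<phi>"

lemma beta_deriv_complex:
  assumes "\<phi> > 0" "real n > \<phi>"
  shows "beta_deriv \<phi> j n = Re ((deriv ^^ j) (beta_kernel n) (complex_of_real \<phi>))"
  unfolding beta_deriv_def using assms
  by (intro higher_deriv_Re_of_real[OF holomorphic_beta_kernel open_beta_strip beta_kernel_of_real])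
    (auto simp: beta_strip_def)

text \<open>The recurrence of the kernel differentiated j + 1 times in z. It coincides with the
  moment recurrence, so the same limit lemma serves both.\<close>

lemma beta_deriv_rec:
  assumes \<phi>: "\<phi> > 0" "real n > \<phi>"
  shows "beta_deriv \<phi> (Suc j) (Suc n) * (real n + 1 + \<phi>) + real (Suc j) * beta_deriv \<phi> j (Suc n) =
    beta_deriv \<phi> (Suc j) n * (real n - \<phi>) - real (Suc j) * beta_deriv \<phi> j n"
proof -
  define z where "z = complex_of_real \<phi>"
  have z: "z \<in> beta_strip n" "z \<in> beta_strip (Suc n)" using \<phi> by (auto simp: z_def beta_strip_def)
  have sub: "beta_strip n \<subseteq> beta_strip (Suc n)" by (auto simp: beta_strip_def)
  have h: "(\<lambda>w. (of_nat n + 1 + 1 * w) * beta_kernel (Suc n) w) holomorphic_on beta_strip n"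
    "(\<lambda>w. (of_nat n + (- 1) * w) * beta_kernel n w) holomorphic_on beta_strip n"
    using holomorphic_on_subset[OF holomorphic_beta_kernel sub] holomorphic_beta_kernel
    by (auto intro!: holomorphic_intros)
  have "(deriv ^^ Suc j) (\<lambda>w. (of_nat n + 1 + 1 * w) * beta_kernel (Suc n) w) z =
      (deriv ^^ Suc j) (\<lambda>w. (of_nat n + (- 1) * w) * beta_kernel n w) z"
    by (rule higher_deriv_transform_within_open[OF h open_beta_strip z(1) beta_kernel_rec])
  also have "(deriv ^^ Suc j) (\<lambda>w. (of_nat n + 1 + 1 * w) * beta_kernel (Suc n) w) z =
      (of_nat n + 1 + 1 * z) * (deriv ^^ Suc j) (beta_kernel (Suc n)) z + of_nat (Suc j) * 1 * (deriv ^^ (Suc j - 1)) (beta_kernel (Suc n)) z"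
    by (rule higher_deriv_linear_mult[OF holomorphic_beta_kernel open_beta_strip z(2)])
  also have "(deriv ^^ Suc j) (\<lambda>w. (of_nat n + (- 1) * w) * beta_kernel n w) z =
      (of_nat n + (- 1) * z) * (deriv ^^ Suc j) (beta_kernel n) z + of_nat (Suc j) * (- 1) * (deriv ^^ (Suc j - 1)) (beta_kernel n) z"
    by (rule higher_deriv_linear_mult[OF holomorphic_beta_kernel open_beta_strip z(1)])
  finally have "complex_of_real (real n + 1 + \<phi>) * (deriv ^^ Suc j) (beta_kernel (Suc n)) z
      + complex_of_real (real (Suc j)) * (deriv ^^ j) (beta_kernel (Suc n)) z =
      complex_of_real (real n - \<phi>) * (deriv ^^ Suc j) (beta_kernel n) z
      - complex_of_real (real (Suc j)) * (deriv ^^ j) (beta_kernel n) z"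
    by (simp add: z_def algebra_simps)
  from arg_cong[OF this, of Re]
  have "(real n + 1 + \<phi>) * Re ((deriv ^^ Suc j) (beta_kernel (Suc n)) z) + real (Suc j) * Re ((deriv ^^ j) (beta_kernel (Suc n)) z) =
      (real n - \<phi>) * Re ((deriv ^^ Suc j) (beta_kernel n) z) - real (Suc j) * Re ((deriv ^^ j) (beta_kernel n) z)"
    by (simp only: plus_complex.sel minus_complex.sel Re_complex_of_real Im_complex_of_real times_complex.sel mult_zero_left diff_zero)
  moreover have "real (Suc n) > \<phi>" using \<phi> by simp
  ultimately show ?thesis
    unfolding beta_deriv_complex[OF \<phi>] beta_deriv_complex[OF \<phi>(1) \<open>real (Suc n) > \<phi>\<close>] z_def
    by (simp only: mult.commute)
qed

lemma beta_deriv_limit: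
  assumes \<phi>: "\<phi> > 0"
  shows "(\<lambda>n. beta_deriv \<phi> j n * real n powr (2 * \<phi> + 1) / ln (real n) ^ j) \<longlonglongrightarrow> Gamma (2 * \<phi> + 1) * (-2) ^ j"
proof (rule log_recurrence_limit[OF \<phi>])
  have large: "\<forall>\<^sub>F n in sequentially. real n > \<phi>"
    using filterlim_real_sequentially by (simp add: filterlim_at_top_dense)
  show "\<forall>\<^sub>F n in sequentially. beta_deriv \<phi> (Suc j) (Suc n) * (real n + 1 + \<phi>) + real (Suc j) * beta_deriv \<phi> j (Suc n) =
    beta_deriv \<phi> (Suc j) n * (real n - \<phi>) - real (Suc j) * beta_deriv \<phi> j n" for j
    using large by eventually_elim (rule beta_deriv_rec[OF \<phi>])
  have "(\<lambda>n. Gamma (2 * \<phi> + 1) * (Gamma (real n - \<phi>) / Gamma (real n + \<phi> + 1) * real n powr (2 * \<phi> + 1))) \<longlonglongrightarrow> Gamma (2 * \<phi> + 1) * 1"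
    by (intro tendsto_mult tendsto_const Gamma_ratio_limit \<phi>)
  moreover have "beta_deriv \<phi> 0 n = Gamma (2 * \<phi> + 1) * (Gamma (real n - \<phi>) / Gamma (real n + \<phi> + 1))" for n
    by (simp add: beta_deriv_def Beta_def algebra_simps)
  ultimately show "(\<lambda>n. beta_deriv \<phi> 0 n * real n powr (2 * \<phi> + 1)) \<longlonglongrightarrow> Gamma (2 * \<phi> + 1)"
    by (simp add: mult.assoc)
qed

section \<open>Asymptotics of the polygamma terms\<close>

lemma Digamma_asymp:
  fixes x :: real
  shows "(\<lambda>n. Digamma (real n + x) - ln (real n)) \<longlonglongrightarrow> 0"
proof -
  \<comment> \<open>The shift moves the base point z into the positive range. There \<psi>(z + m)
    exceeds \<psi>(z) by the very sum whose difference from ln m defines \<psi>(z) in the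
    limit.\<close>
  define M where "M = nat \<lceil>\<bar>x\<bar>\<rceil> + 1"
  define z where "z = x + real M"
  have z: "z > 0" unfolding z_def M_def by linarith
  have "(\<lambda>m. ln (real m) - (\<Sum>n<m. inverse (z + real n))) \<longlonglongrightarrow> Digamma z"
    using Digamma_LIMSEQ[of z] z by simp
  from tendsto_diff[OF tendsto_const[of "Digamma z"] this]
  have "(\<lambda>m. Digamma z - (ln (real m) - (\<Sum>n<m. inverse (z + real n)))) \<longlonglongrightarrow> 0" by simp
  moreover have "(\<lambda>m. ln (real m) - ln (real (m + M))) \<longlonglongrightarrow> 0" by real_asymp
  ultimately have "(\<lambda>m. (Digamma z - (ln (real m) - (\<Sum>n<m. inverse (z + real n)))) + (ln (real m) - ln (real (m + M)))) \<longlonglongrightarrow> 0 + 0"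
    by (rule tendsto_add)
  moreover have "Digamma z - (ln (real m) - (\<Sum>n<m. inverse (z + real n))) + (ln (real m) - ln (real (m + M))) =
      Digamma (real (m + M) + x) - ln (real (m + M))" for m
  proof -
    have "\<forall>k<m. z \<noteq> - of_nat k" using z by auto
    from Polygamma_plus_of_nat[OF this, of 0]
    have "Digamma (z + real m) = Digamma z + (\<Sum>n<m. inverse (z + real n))"
      by (simp add: inverse_eq_divide)
    moreover have "z + real m = real (m + M) + x" by (simp add: z_def)
    ultimately show ?thesis by simp
  qed
  ultimately have "(\<lambda>m. Digamma (real (m + M) + x) - ln (real (m + M))) \<longlonglongrightarrow> 0" by (simp only:) simp
  then show ?thesis by (rule LIMSEQ_offset)
qed

lemma Trigamma_asymp:
  fixes x :: real
  shows "(\<lambda>n. Polygamma 1 (real n + x)) \<longlonglongrightarrow> 0"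
proof -
  define M where "M = nat \<lceil>\<bar>x\<bar>\<rceil> + 1"
  define z where "z = x + real M"
  have z: "z > 0" unfolding z_def M_def by linarith
  \<comment> \<open>The shifted trigamma value is a tail of this convergent series, hence tends to
    0.\<close>
  have "(\<lambda>k. inverse ((z + real k) ^ Suc 1)) sums Polygamma 1 z"
    using Polygamma_LIMSEQ[of z 1] z by simp
  then have "(\<lambda>m. Polygamma 1 z - (\<Sum>k<m. inverse ((z + real k) ^ Suc 1))) \<longlonglongrightarrow> Polygamma 1 z - Polygamma 1 z"
    unfolding sums_def by (intro tendsto_diff tendsto_const)
  moreover have "Polygamma 1 z - (\<Sum>k<m. inverse ((z + real k) ^ Suc 1)) = Polygamma 1 (real (m + M) + x)" for m
  proof -
    have "\<forall>k<m. z \<noteq> - of_nat k" using z by auto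
    from Polygamma_plus_of_nat[OF this, of 1]
    have "Polygamma 1 (z + real m) = Polygamma 1 z - (\<Sum>k<m. inverse ((z + real k) ^ Suc 1))"
      by (simp add: inverse_eq_divide)
    moreover have "z + real m = real (m + M) + x" by (simp add: z_def)
    ultimately show ?thesis by simp
  qed
  ultimately have "(\<lambda>m. Polygamma 1 (real (m + M) + x)) \<longlonglongrightarrow> 0" by (simp only:) simp
  then show ?thesis by (rule LIMSEQ_offset)
qed

text \<open>Each of the two digamma terms behaves like -ln n; this is the factor -2 per logarithm
  seen from the explicit formula.\<close>

lemma gamma1_limit: "(\<lambda>n. gamma1 \<phi> n / ln (real n)) \<longlonglongrightarrow> -2"
proof -
  define c where "c = 2 * Digamma (2 * \<phi> + 1)"
  have a: "(\<lambda>n. 1 / ln (real n)) \<longlonglongrightarrow> 0" by real_asymp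
  have b: "(\<lambda>n. Digamma (real n - \<phi>) - ln (real n)) \<longlonglongrightarrow> 0"
    "(\<lambda>n. Digamma (real n + \<phi> + 1) - ln (real n)) \<longlonglongrightarrow> 0"
    using Digamma_asymp[of "- \<phi>"] Digamma_asymp[of "\<phi> + 1"] by (simp_all add: add.assoc)
  have "(\<lambda>n. (c - (Digamma (real n - \<phi>) - ln (real n)) - (Digamma (real n + \<phi> + 1) - ln (real n))) * (1 / ln (real n)) - 2)
      \<longlonglongrightarrow> (c - 0 - 0) * 0 - 2"
    by (intro tendsto_diff tendsto_mult tendsto_const a b)
  moreover have "\<forall>\<^sub>F n in sequentially. (c - (Digamma (real n - \<phi>) - ln (real n)) - (Digamma (real n + \<phi> + 1) - ln (real n))) * (1 / ln (real n)) - 2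
      = gamma1 \<phi> n / ln (real n)"
    using eventually_gt_at_top[of 1] by eventually_elim (simp add: gamma1_def c_def field_simps)
  ultimately show ?thesis by (auto intro: Lim_transform_eventually)
qed

lemma gamma2_limit: "gamma2 \<phi> \<longlonglongrightarrow> 4 * Polygamma 1 (2 * \<phi> + 1)"
proof -
  have "(\<lambda>n. Polygamma 1 (real n - \<phi>)) \<longlonglongrightarrow> 0" "(\<lambda>n. Polygamma 1 (real n + \<phi> + 1)) \<longlonglongrightarrow> 0"
    using Trigamma_asymp[of "- \<phi>"] Trigamma_asymp[of "\<phi> + 1"] by (simp_all add: add.assoc)
  then have "(\<lambda>n. 4 * Polygamma 1 (2 * \<phi> + 1) + Polygamma 1 (real n - \<phi>) - Polygamma 1 (real n + \<phi> + 1))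
      \<longlonglongrightarrow> 4 * Polygamma 1 (2 * \<phi> + 1) + 0 - 0"
    by (intro tendsto_diff tendsto_add tendsto_const)
  then show ?thesis by (simp add: gamma2_def[abs_def])
qed

section \<open>The parity factor and asymptotic comparison\<close>

lemma gamma3_add_2: "gamma3 g (n + 2) = gamma3 g n"
  by (simp add: gamma3_def)

lemma gamma3_bigo: "gamma3 g \<in> O(\<lambda>_. 1)"
proof (rule bigoI)
  have "\<bar>gamma3 g n\<bar> \<le> \<bar>g (-1)\<bar> + \<bar>g 1\<bar>" for n
    unfolding gamma3_def by (rule order_trans[OF abs_triangle_ineq]) (simp add: abs_mult power_abs)
  then show "\<forall>\<^sub>F n in sequentially. norm (gamma3 g n) \<le> (\<bar>g (-1)\<bar> + \<bar>g 1\<bar>) * norm (1 :: real)"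
    by simp
qed

lemma one_bigo_gamma3: "(\<lambda>_. 1) \<in> O[nondeg g](gamma3 g)"
proof -
  \<comment> \<open>\<open>gamma3\<close> takes just two values, one per parity. A vanishing value
    is replaced by 1, so that the minimum d is positive and still bounds the nonzero values from
    below.\<close>
  define c where "c v = (if v = 0 then 1 else \<bar>v\<bar>)" for v :: real
  define d where "d = min (c (g (-1) + g 1)) (c (g 1 - g (-1)))"
  have d: "d > 0" by (auto simp: d_def c_def)
  have low: "d \<le> \<bar>gamma3 g n\<bar>" if "gamma3 g n \<noteq> 0" for n
    using that by (cases "even n") (auto simp: gamma3_def d_def c_def min_def)
  show ?thesis
  proof (rule bigoI)
    have "norm (1 :: real) \<le> 1 / d * norm (gamma3 g n)" if "gamma3 g n \<noteq> 0" for n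
      using low[OF that] d by (simp add: field_simps)
    then show "\<forall>\<^sub>F n in nondeg g. norm (1 :: real) \<le> 1 / d * norm (gamma3 g n)"
      unfolding nondeg_def eventually_inf_principal by simp
  qed
qed

lemma nondeg_le: "nondeg g \<le> sequentially"
  by (simp add: nondeg_def)

lemma tendsto_nonzero_bigtheta:
  fixes \<alpha> :: "nat \<Rightarrow> real"
  assumes "\<alpha> \<longlonglongrightarrow> L" "L \<noteq> 0"
  shows "\<alpha> \<in> \<Theta>(\<lambda>_. 1)"
proof -
  have "(\<lambda>n. \<alpha> n / 1) \<longlonglongrightarrow> L" using assms(1) by simp
  from bigthetaI_tendsto[OF assms(2) this] show ?thesis by simp
qed

text \<open>The common factor p may vanish at infinitely many indices, since both sides then vanish
  together. It will carry \<open>gamma3\<close>, which is why amplitudes can be compared along all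
  indices.\<close>

lemma tendsto_factor_asymp:
  fixes \<alpha> \<beta> p A B :: "nat \<Rightarrow> real"
  assumes A: "\<forall>\<^sub>F n in sequentially. A n = p n * \<alpha> n" and B: "\<forall>\<^sub>F n in sequentially. B n = p n * \<beta> n"
    and \<alpha>: "\<alpha> \<longlonglongrightarrow> a" "a \<noteq> 0" and \<beta>: "\<beta> \<longlonglongrightarrow> b" "b \<noteq> 0"
  shows "A \<in> \<Theta>(B)" and "a = b \<Longrightarrow> A \<sim>[sequentially] B"
proof -
  have "\<alpha> \<in> \<Theta>(\<beta>)"
    using tendsto_nonzero_bigtheta[OF \<alpha>] tendsto_nonzero_bigtheta[OF \<beta>]
    by (meson landau_theta.trans bigtheta_sym)
  then have "(\<lambda>n. p n * \<alpha> n) \<in> \<Theta>(\<lambda>n. p n * \<beta> n)"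
    by (intro landau_theta.mult_left)
  then show "A \<in> \<Theta>(B)"
    unfolding landau_theta.in_cong[OF A] landau_theta.cong[OF B] .
  assume ab: "a = b"
  have "\<alpha> \<sim>[sequentially] (\<lambda>_. a)" "\<beta> \<sim>[sequentially] (\<lambda>_. a)"
    using \<alpha> \<beta> ab by (auto intro: tendsto_imp_asymp_equiv_const)
  then have "\<alpha> \<sim>[sequentially] \<beta>" by (meson asymp_equiv_symI asymp_equiv_trans)
  then have "(\<lambda>n. p n * \<alpha> n) \<sim>[sequentially] (\<lambda>n. p n * \<beta> n)"
    by (intro asymp_equiv_mult asymp_equiv_refl)
  then show "A \<sim>[sequentially] B" using asymp_equiv_cong[OF A B] by blast
qed

text \<open>Replacing the constant L by a convergent sequence costs o(w) because
  \<open>gamma3\<close> is bounded. The relative error is small only where \<open>gamma3\<close> is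
  also bounded away from 0, which holds along \<open>nondeg\<close>.\<close>

lemma nondeg_asymp:
  fixes x T w \<tau> :: "nat \<Rightarrow> real"
  assumes x: "(\<lambda>n. x n - gamma3 g n * (L * w n)) \<in> o(w)"
    and T: "\<forall>\<^sub>F n in sequentially. T n = gamma3 g n * (\<tau> n * w n)"
    and \<tau>: "\<tau> \<longlonglongrightarrow> L" "L \<noteq> 0"
  shows "(\<lambda>n. x n - T n) \<in> o(w)" and "x \<sim>[nondeg g] T"
proof -
  have "(\<lambda>n. L - \<tau> n) \<in> o(\<lambda>_. 1)"
  proof (rule smalloI_tendsto)
    show "(\<lambda>n. (L - \<tau> n) / 1) \<longlonglongrightarrow> 0" using tendsto_diff[OF tendsto_const[of L] \<tau>(1)] by simp
  qed simp
  then have "(\<lambda>n. gamma3 g n * ((L - \<tau> n) * w n)) \<in> o(\<lambda>n. 1 * (1 * w n))"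
    by (intro landau_o.big_small_mult gamma3_bigo landau_o.small_big_mult) auto
  then have "(\<lambda>n. gamma3 g n * ((L - \<tau> n) * w n)) \<in> o(w)" by simp
  from sum_in_smallo(1)[OF x this]
  have "(\<lambda>n. (x n - gamma3 g n * (L * w n)) + gamma3 g n * ((L - \<tau> n) * w n)) \<in> o(w)" .
  moreover have ev: "\<forall>\<^sub>F n in sequentially. (x n - gamma3 g n * (L * w n)) + gamma3 g n * ((L - \<tau> n) * w n) = x n - T n"
    using T by eventually_elim (simp add: algebra_simps)
  ultimately show o: "(\<lambda>n. x n - T n) \<in> o(w)" using iffD1[OF landau_o.small.in_cong[OF ev]] by blast
  have "(\<lambda>_. 1) \<in> O(\<tau>)" using tendsto_nonzero_bigtheta[OF \<tau>] by (simp add: bigtheta_def bigomega_iff_bigo)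
  then have "(\<lambda>_. 1) \<in> O[nondeg g](\<tau>)" by (rule landau_o.big.filter_mono[OF nondeg_le])
  then have "(\<lambda>n. 1 * (1 * w n)) \<in> O[nondeg g](\<lambda>n. gamma3 g n * (\<tau> n * w n))"
    by (intro landau_o.big_mult one_bigo_gamma3) auto
  moreover have ev': "\<forall>\<^sub>F n in nondeg g. gamma3 g n * (\<tau> n * w n) = T n"
    using filter_leD[OF nondeg_le T] by eventually_elim simp
  ultimately have wT: "w \<in> O[nondeg g](T)" unfolding landau_o.big.cong[OF ev'] by simp
  have "(\<lambda>n. x n - T n) \<in> o[nondeg g](w)"
    using o by (rule landau_o.small.filter_mono[OF nondeg_le])
  from landau_o.small_big_trans[OF this wT] show "x \<sim>[nondeg g] T"
    by (rule smallo_imp_asymp_equiv)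
qed

text \<open>As \<open>x\<close> vanishes at infinity, \<open>x n\<close> is the sum of its differences at \<open>n, n + 2, n + 4, \<dots>\<close>;
  the factor \<open>1 / (2 p)\<close> comes from comparing this sum with an integral.\<close>

lemma step_two_summation:
  fixes x :: "nat \<Rightarrow> real" and p L :: real and k :: nat
  assumes p: "p > 0" and x0: "x \<longlonglongrightarrow> 0"
    and diff: "(\<lambda>n. x n - x (n + 2) - gamma3 g n * (L * (ln (real n) ^ k / real n powr (p + 1))))
      \<in> o(\<lambda>n. ln (real n) ^ k / real n powr (p + 1))"
  shows "(\<lambda>n. x n - gamma3 g n * (L / (2 * p) * (ln (real n) ^ k / real n powr p)))
      \<in> o(\<lambda>n. ln (real n) ^ k / real n powr p)"
proof (rule smallo_step_vanishing)
  define w where "w n = ln (real n) ^ k / real n powr p" for n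
  define v where "v n = ln (real n) ^ k / real n powr (p + 1)" for n
  show w0: "(\<lambda>n. ln (real n) ^ k / real n powr p) \<longlonglongrightarrow> 0" using p by real_asymp
  have dw: "(\<lambda>n. w n - w (n + 2) - 2 * p * v n) \<in> o(v)" unfolding w_def v_def using p by real_asymp
  have "v \<in> O(\<lambda>n. w n - w (n + 2))" unfolding w_def v_def using p by real_asymp
  moreover have "(\<lambda>n. x n - gamma3 g n * (L / (2 * p) * w n) - (x (n + 2) - gamma3 g (n + 2) * (L / (2 * p) * w (n + 2)))) \<in> o(v)"
  proof -
    have "(\<lambda>n. gamma3 g n * (L / (2 * p) * (w n - w (n + 2) - 2 * p * v n))) \<in> o(\<lambda>n. 1 * v n)"
    proof (rule landau_o.big_small_mult[OF gamma3_bigo])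
      have "(\<lambda>n. L / (2 * p) * (w n - w (n + 2) - 2 * p * v n)) \<in> o(\<lambda>n. 1 * v n)"
        by (rule landau_o.big_small_mult[OF _ dw]) simp
      then show "(\<lambda>n. L / (2 * p) * (w n - w (n + 2) - 2 * p * v n)) \<in> o(v)" by simp
    qed
    then have small: "(\<lambda>n. gamma3 g n * (L / (2 * p) * (w n - w (n + 2) - 2 * p * v n))) \<in> o(v)"
      by (simp only: mult_1)
    have "(\<lambda>n. x n - x (n + 2) - gamma3 g n * (L * v n)) \<in> o(v)" using diff unfolding v_def .
    from sum_in_smallo(2)[OF this small]
    have "(\<lambda>n. x n - x (n + 2) - gamma3 g n * (L * v n) - gamma3 g n * (L / (2 * p) * (w n - w (n + 2) - 2 * p * v n))) \<in> o(v)" .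
    \<comment> \<open>\<open>gamma3\<close> has period 2, so it factors out of two-step
      differences.\<close>
    moreover have "x n - x (n + 2) - gamma3 g n * (L * v n) - gamma3 g n * (L / (2 * p) * (w n - w (n + 2) - 2 * p * v n))
        = x n - gamma3 g n * (L / (2 * p) * w n) - (x (n + 2) - gamma3 g (n + 2) * (L / (2 * p) * w (n + 2)))" for n
      using p unfolding gamma3_add_2 by (simp add: field_simps)
    ultimately show ?thesis by (simp only:)
  qed
  ultimately show "(\<lambda>n. x n - gamma3 g n * (L / (2 * p) * (ln (real n) ^ k / real n powr p)) -
      (x (n + 2) - gamma3 g (n + 2) * (L / (2 * p) * (ln (real (n + 2)) ^ k / real (n + 2) powr p))))
    \<in> o(\<lambda>n. ln (real n) ^ k / real n powr p - ln (real (n + 2)) ^ k / real (n + 2) powr p)"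
    unfolding w_def by (rule landau_o.small_big_trans[rotated])
  show "\<forall>\<^sub>F n in sequentially. ln (real (n + 2)) ^ k / real (n + 2) powr p \<le> ln (real n) ^ k / real n powr p"
    using p by real_asymp
  have "(\<lambda>n. L / (2 * p) * w n) \<longlonglongrightarrow> L / (2 * p) * 0"
    unfolding w_def by (intro tendsto_mult tendsto_const w0)
  then have "(\<lambda>n. L / (2 * p) * w n) \<in> o(\<lambda>_. 1)"
    by (intro smalloI_tendsto) auto
  then have "(\<lambda>n. gamma3 g n * (L / (2 * p) * w n)) \<in> o(\<lambda>n. 1 * 1)"
    by (intro landau_o.big_small_mult gamma3_bigo)
  then have "(\<lambda>n. gamma3 g n * (L / (2 * p) * w n)) \<longlonglongrightarrow> 0" using smalloD_tendsto by fastforce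
  from tendsto_diff[OF x0 this]
  show "(\<lambda>n. x n - gamma3 g n * (L / (2 * p) * (ln (real n) ^ k / real n powr p))) \<longlonglongrightarrow> 0"
    unfolding w_def by simp
qed

section \<open>Leading terms of the amplitudes\<close>

lemma lead_const_nonzero:
  assumes "\<phi> > 0" "\<theta> > 0"
  shows "lead_const \<phi> \<theta> \<noteq> 0"
proof (cases "\<phi> \<in> \<nat>")
  case True
  then obtain k where "\<phi> = real k" by (auto elim: Nats_cases)
  then have "cos (\<phi> * pi) \<noteq> 0" by (simp add: cos_npi2 mult.commute)
  with True assms show ?thesis by (simp add: lead_const_def)
next
  case False
  with assms have "\<phi> \<notin> \<int>" by (auto elim!: Ints_cases simp: Nats_altdef1)
  with False show ?thesis by (simp add: lead_const_def sin_times_pi_eq_0)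
qed

lemma sin_Nats: "\<phi> \<in> \<nat> \<Longrightarrow> sin (\<phi> * pi) = (0::real)"
  by (auto elim!: Nats_cases simp: sin_times_pi_eq_0)

lemma amp_scale_pos: "n > 1 \<Longrightarrow> amp_scale \<phi> \<theta> n > 0"
  by (simp add: amp_scale_eq)

lemma beta_deriv_scaled_limit:
  assumes \<phi>: "\<phi> > 0" and j: "j \<le> k"
  shows "(\<lambda>n. beta_deriv \<phi> j n * real n powr (2 * \<phi> + 1) / ln (real n) ^ k)
    \<longlonglongrightarrow> (if j = k then Gamma (2 * \<phi> + 1) * (-2) ^ k else 0)"
proof (cases "j = k")
  case True
  then show ?thesis using beta_deriv_limit[OF \<phi>, of j] by simp
next
  case False
  with j obtain i where i: "k = j + Suc i" using less_imp_Suc_add[of j k] by auto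
  have "(\<lambda>n. 1 / ln (real n) ^ Suc i) \<longlonglongrightarrow> 0" by real_asymp
  from tendsto_mult[OF beta_deriv_limit[OF \<phi>, of j] this] False show ?thesis
    by (simp add: i power_add mult_ac)
qed

text \<open>The term with index k carries ln^(\<theta>-k). For non-integer \<phi> only k = 0
  survives the scaling. For integer \<phi> the terms k = 0 and (k, j) = (1, 0) vanish with the sine,
  and (1, 1) gives the cosine.\<close>

lemma amp_gen_limit:
  assumes \<phi>: "\<phi> > 0" and \<theta>: "\<theta> > 0"
  shows "(\<lambda>n. real n powr (2 * \<phi> + 1) *
       (\<Sum>k=0..\<theta>. \<Sum>j=0..k.
          real (\<theta> choose k) * real (k choose j) * pi ^ j * sin (real j / 2 * pi + \<phi> * pi) *
          ln (1 / 2) ^ (k - j) * beta_deriv \<phi> (\<theta> - k) n) / amp_scale \<phi> \<theta> n)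
    \<longlonglongrightarrow> Gamma (2 * \<phi> + 1) * lead_const \<phi> \<theta>"
proof -
  define \<kappa> where "\<kappa> = log_order \<phi> \<theta>"
  define c where "c k j = real (\<theta> choose k) * real (k choose j) * pi ^ j * sin (real j / 2 * pi + \<phi> * pi) *
          ln (1 / 2) ^ (k - j)" for k j
  define G where "G = Gamma (2 * \<phi> + 1) * (-2) ^ \<kappa>"
  have \<kappa>: "\<kappa> \<le> \<theta>" by (simp add: \<kappa>_def log_order_def)
  have summand: "(\<lambda>n. c k j * (beta_deriv \<phi> (\<theta> - k) n * real n powr (2 * \<phi> + 1) / ln (real n) ^ \<kappa>))
      \<longlonglongrightarrow> c k j * (if k = \<theta> - \<kappa> then G else 0)" if "k \<le> \<theta>" "j \<le> k" for k j
  proof (cases "\<theta> - k \<le> \<kappa>")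
    case True
    have "\<theta> - k = \<kappa> \<longleftrightarrow> k = \<theta> - \<kappa>" using that \<kappa> by auto
    then show ?thesis
      unfolding G_def using tendsto_mult[OF tendsto_const beta_deriv_scaled_limit[OF \<phi> True], of "c k j"]
      by (simp only:)
  next
    case False
    \<comment> \<open>Only the full \<theta>-th derivative can outgrow the scale, and only for
      integer \<phi>; its coefficient is then exactly 0.\<close>
    then have "\<phi> \<in> \<nat>" "k = 0" "j = 0"
      using that by (auto simp: \<kappa>_def log_order_def split: if_splits)
    then have "c k j = 0" by (simp add: c_def sin_Nats)
    then show ?thesis by simp
  qed
  have "(\<lambda>n. \<Sum>k=0..\<theta>. \<Sum>j=0..k. c k j * (beta_deriv \<phi> (\<theta> - k) n * real n powr (2 * \<phi> + 1) / ln (real n) ^ \<kappa>))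
      \<longlonglongrightarrow> (\<Sum>k=0..\<theta>. \<Sum>j=0..k. c k j * (if k = \<theta> - \<kappa> then G else 0))"
    by (intro tendsto_sum summand) auto
  also have "(\<Sum>k=0..\<theta>. \<Sum>j=0..k. c k j * (if k = \<theta> - \<kappa> then G else 0)) =
      (\<Sum>k=0..\<theta>. if k = \<theta> - \<kappa> then (\<Sum>j=0..k. c k j * G) else 0)"
    by (intro sum.cong) auto
  also have "\<dots> = (\<Sum>j=0..\<theta> - \<kappa>. c (\<theta> - \<kappa>) j) * G"
    by (simp add: sum.delta sum_distrib_right)
  also have "\<dots> = Gamma (2 * \<phi> + 1) * lead_const \<phi> \<theta>"
  proof (cases "\<phi> \<in> \<nat>")
    case True
    then have "\<theta> - \<kappa> = 1" "\<kappa> = \<theta> - 1" using \<theta> by (auto simp: \<kappa>_def log_order_def)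
    moreover have "c 1 0 = 0" using True by (simp add: c_def sin_Nats)
    moreover have "c 1 1 = real \<theta> * pi * cos (\<phi> * pi)"
      by (simp add: c_def sin_add)
    ultimately show ?thesis using True by (simp add: G_def lead_const_def numeral_2_eq_2)
  next
    case False
    then have "\<kappa> = \<theta>" by (simp add: \<kappa>_def log_order_def)
    with False show ?thesis by (simp add: G_def lead_const_def c_def)
  qed
  finally have "(\<lambda>n. \<Sum>k=0..\<theta>. \<Sum>j=0..k. c k j * (beta_deriv \<phi> (\<theta> - k) n * real n powr (2 * \<phi> + 1) / ln (real n) ^ \<kappa>))
      \<longlonglongrightarrow> Gamma (2 * \<phi> + 1) * lead_const \<phi> \<theta>" .
  moreover have "(\<Sum>k=0..\<theta>. \<Sum>j=0..k. c k j * (beta_deriv \<phi> (\<theta> - k) n * real n powr (2 * \<phi> + 1) / ln (real n) ^ \<kappa>)) =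
      real n powr (2 * \<phi> + 1) * (\<Sum>k=0..\<theta>. \<Sum>j=0..k. c k j * beta_deriv \<phi> (\<theta> - k) n) / amp_scale \<phi> \<theta> n" for n
    by (simp add: amp_scale_eq \<kappa>_def sum_distrib_left sum_divide_distrib mult_ac)
  ultimately show ?thesis by (simp add: c_def)
qed

lemma amp_one_limit:
  assumes "\<phi> > 0"
  shows "(\<lambda>n. ((gamma1 \<phi> n - ln 2) * sin (\<phi> * pi) + pi * cos (\<phi> * pi)) / amp_scale \<phi> 1 n) \<longlonglongrightarrow> lead_const \<phi> 1"
proof (cases "\<phi> \<in> \<nat>")
  case True
  then show ?thesis by (simp add: amp_scale_eq log_order_def lead_const_def sin_Nats)
next
  case False
  have a: "(\<lambda>n. 1 / ln (real n)) \<longlonglongrightarrow> 0" by real_asymp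
  have "(\<lambda>n. (gamma1 \<phi> n / ln (real n) - ln 2 * (1 / ln (real n))) * sin (\<phi> * pi) + pi * cos (\<phi> * pi) * (1 / ln (real n)))
      \<longlonglongrightarrow> (-2 - ln 2 * 0) * sin (\<phi> * pi) + pi * cos (\<phi> * pi) * 0"
    by (intro tendsto_intros gamma1_limit a)
  moreover have "(gamma1 \<phi> n / ln (real n) - ln 2 * (1 / ln (real n))) * sin (\<phi> * pi) + pi * cos (\<phi> * pi) * (1 / ln (real n)) =
      ((gamma1 \<phi> n - ln 2) * sin (\<phi> * pi) + pi * cos (\<phi> * pi)) / amp_scale \<phi> 1 n" for n
    using False by (simp add: amp_scale_eq log_order_def add_divide_distrib diff_divide_distrib ring_distribs)
  ultimately show ?thesis using False by (simp add: lead_const_def)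
qed

text \<open>Dominant terms: the square of \<open>gamma1\<close>, about 4 ln^2 n, in the sine part,
  and for integer \<phi> the term 2 \<pi> \<open>gamma1\<close>, about -4 \<pi> ln n, in the cosine
  part.\<close>

lemma amp_two_limit:
  assumes "\<phi> > 0"
  shows "(\<lambda>n. (((gamma1 \<phi> n)\<^sup>2 + gamma2 \<phi> n - 2 * ln 2 * gamma1 \<phi> n + (ln 2)\<^sup>2 - pi\<^sup>2) * sin (\<phi> * pi)
        + 2 * pi * (gamma1 \<phi> n - ln 2) * cos (\<phi> * pi)) / amp_scale \<phi> 2 n) \<longlonglongrightarrow> lead_const \<phi> 2"
proof -
  define l where "l n = 1 / ln (real n)" for n
  have a: "l \<longlonglongrightarrow> 0" unfolding l_def by real_asymp
  have g1: "(\<lambda>n. gamma1 \<phi> n * l n) \<longlonglongrightarrow> -2" using gamma1_limit[of \<phi>] by (simp add: l_def)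
  show ?thesis
  proof (cases "\<phi> \<in> \<nat>")
    case True
    have "(\<lambda>n. 2 * pi * (gamma1 \<phi> n * l n - ln 2 * l n) * cos (\<phi> * pi))
        \<longlonglongrightarrow> 2 * pi * (-2 - ln 2 * 0) * cos (\<phi> * pi)"
      by (intro tendsto_intros g1 a)
    then show ?thesis
      using True by (simp add: amp_scale_eq log_order_def lead_const_def sin_Nats l_def diff_divide_distrib ring_distribs)
  next
    case False
    have "(\<lambda>n. ((gamma1 \<phi> n * l n)\<^sup>2 + gamma2 \<phi> n * l n * l n - 2 * ln 2 * (gamma1 \<phi> n * l n) * l n + (ln 2)\<^sup>2 * l n * l n - pi\<^sup>2 * l n * l n) * sin (\<phi> * pi)
          + 2 * pi * (gamma1 \<phi> n * l n - ln 2 * l n) * cos (\<phi> * pi) * l n)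
        \<longlonglongrightarrow> ((-2)\<^sup>2 + 4 * Polygamma 1 (2 * \<phi> + 1) * 0 * 0 - 2 * ln 2 * (-2) * 0 + (ln 2)\<^sup>2 * 0 * 0 - pi\<^sup>2 * 0 * 0) * sin (\<phi> * pi)
          + 2 * pi * (-2 - ln 2 * 0) * cos (\<phi> * pi) * 0"
      by (intro tendsto_intros g1 a gamma2_limit)
    moreover have "((gamma1 \<phi> n * l n)\<^sup>2 + gamma2 \<phi> n * l n * l n - 2 * ln 2 * (gamma1 \<phi> n * l n) * l n + (ln 2)\<^sup>2 * l n * l n - pi\<^sup>2 * l n * l n) * sin (\<phi> * pi)
          + 2 * pi * (gamma1 \<phi> n * l n - ln 2 * l n) * cos (\<phi> * pi) * l n =
        (((gamma1 \<phi> n)\<^sup>2 + gamma2 \<phi> n - 2 * ln 2 * gamma1 \<phi> n + (ln 2)\<^sup>2 - pi\<^sup>2) * sin (\<phi> * pi)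
        + 2 * pi * (gamma1 \<phi> n - ln 2) * cos (\<phi> * pi)) / amp_scale \<phi> 2 n" for n
    proof -
      have "1 / amp_scale \<phi> 2 n = l n * l n"
        using False by (simp add: amp_scale_eq log_order_def l_def power2_eq_square)
      then have "X / amp_scale \<phi> 2 n = X * (l n * l n)" for X by (metis times_divide_eq_right mult.right_neutral)
      then show ?thesis by (simp add: power2_eq_square algebra_simps)
    qed
    ultimately show ?thesis using False by (simp add: lead_const_def)
  qed
qed

section \<open>Leading terms of the three coefficient sequences\<close>

context weak_singularity
begin

lemma cheb_coeff_smallo:
  "(\<lambda>n. cheb_coeff (weak_sing g \<phi> \<theta>) n - gamma3 g n * (- (2 * Gamma (2 * \<phi> + 1) / pi) * lead_const \<phi> \<theta> *
      (ln (real n) ^ log_order \<phi> \<theta> / real n powr (2 * \<phi> + 1))))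
    \<in> o(\<lambda>n. ln (real n) ^ log_order \<phi> \<theta> / real n powr (2 * \<phi> + 1))"
proof (rule smalloI_tendsto)
  show ne: "\<forall>\<^sub>F n in sequentially. ln (real n) ^ log_order \<phi> \<theta> / real n powr (2 * \<phi> + 1) \<noteq> 0"
    using eventually_gt_at_top[of 1] by eventually_elim auto
  show "(\<lambda>n. (cheb_coeff (weak_sing g \<phi> \<theta>) n - gamma3 g n * (- (2 * Gamma (2 * \<phi> + 1) / pi) * lead_const \<phi> \<theta> *
      (ln (real n) ^ log_order \<phi> \<theta> / real n powr (2 * \<phi> + 1)))) / (ln (real n) ^ log_order \<phi> \<theta> / real n powr (2 * \<phi> + 1))) \<longlonglongrightarrow> 0"
  proof (rule Lim_transform_eventually[OF cheb_coeff_limit])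
    show "\<forall>\<^sub>F n in sequentially. cheb_coeff (weak_sing g \<phi> \<theta>) n * real n powr (2 * \<phi> + 1) / amp_scale \<phi> \<theta> n
      - gamma3 g n * (- (2 * Gamma (2 * \<phi> + 1) / pi) * lead_const \<phi> \<theta>) =
      (cheb_coeff (weak_sing g \<phi> \<theta>) n - gamma3 g n * (- (2 * Gamma (2 * \<phi> + 1) / pi) * lead_const \<phi> \<theta> *
      (ln (real n) ^ log_order \<phi> \<theta> / real n powr (2 * \<phi> + 1)))) / (ln (real n) ^ log_order \<phi> \<theta> / real n powr (2 * \<phi> + 1))"
      using ne
    proof eventually_elim
      case (elim n)
      have "x * P / s - y * E = (x - y * (E * (s / P))) / (s / P)" if "s / P \<noteq> 0" for x P s y E :: real
        using that by (simp add: field_simps)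
      from this[OF elim] show ?case by (simp only: amp_scale_eq)
    qed
  qed
qed

text \<open>Summation in steps of two with p = 2\<phi> divides the constant of a by 2p =
  4\<phi>.\<close>

lemma diff_coeff_smallo:
  "(\<lambda>n. diff_coeff (weak_sing g \<phi> \<theta>) n - gamma3 g n * (- (2 * Gamma (2 * \<phi> + 1) / pi) * lead_const \<phi> \<theta> / (2 * (2 * \<phi>)) *
      (ln (real n) ^ log_order \<phi> \<theta> / real n powr (2 * \<phi>))))
    \<in> o(\<lambda>n. ln (real n) ^ log_order \<phi> \<theta> / real n powr (2 * \<phi>))"
proof (rule step_two_summation)
  define E where "E = - (2 * Gamma (2 * \<phi> + 1) / pi) * lead_const \<phi> \<theta>"
  define k where "k = log_order \<phi> \<theta>"
  define v where "v n = ln (real n) ^ k / real n powr (2 * \<phi> + 1)" for n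
  show "2 * \<phi> > 0" using \<phi> by simp
  show "diff_coeff (weak_sing g \<phi> \<theta>) \<longlonglongrightarrow> 0" by (rule diff_coeff_tendsto_0)
  have vO: "(\<lambda>n. v (n + 2)) \<in> O(v)" unfolding v_def by real_asymp
  \<comment> \<open>The difference of b at n is the Chebyshev coefficient at n + 2; moving its
    weight back to n costs only o(v).\<close>
  have vo: "(\<lambda>n. v (n + 2) - v n) \<in> o(v)" unfolding v_def by real_asymp
  have "(\<lambda>n. cheb_coeff (weak_sing g \<phi> \<theta>) (n + 2) - gamma3 g (n + 2) * (E * v (n + 2))) \<in> o(\<lambda>n. v (n + 2))"
    unfolding E_def v_def k_def
    by (rule landau_o.small.compose[OF cheb_coeff_smallo filterlim_add_const_nat_at_top])
  then have s1: "(\<lambda>n. cheb_coeff (weak_sing g \<phi> \<theta>) (n + 2) - gamma3 g (n + 2) * (E * v (n + 2))) \<in> o(v)"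
    using vO by (rule landau_o.small_big_trans)
  have "(\<lambda>n. gamma3 g n * (E * (v (n + 2) - v n))) \<in> o(\<lambda>n. 1 * (1 * v n))"
    by (intro landau_o.big_small_mult[OF gamma3_bigo] landau_o.big_small_mult[OF _ vo]) auto
  then have s2: "(\<lambda>n. gamma3 g n * (E * (v (n + 2) - v n))) \<in> o(v)" by simp
  have "(\<lambda>n. cheb_coeff (weak_sing g \<phi> \<theta>) (n + 2) - gamma3 g (n + 2) * (E * v (n + 2)) + gamma3 g n * (E * (v (n + 2) - v n))) \<in> o(v)"
    by (rule sum_in_smallo(1)[OF s1 s2])
  moreover have "cheb_coeff (weak_sing g \<phi> \<theta>) (n + 2) - gamma3 g (n + 2) * (E * v (n + 2)) + gamma3 g n * (E * (v (n + 2) - v n)) =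
      diff_coeff (weak_sing g \<phi> \<theta>) n - diff_coeff (weak_sing g \<phi> \<theta>) (n + 2) - gamma3 g n * (E * v n)" for n
    unfolding gamma3_add_2 diff_coeff_diff by (simp add: algebra_simps)
  ultimately show "(\<lambda>n. diff_coeff (weak_sing g \<phi> \<theta>) n - diff_coeff (weak_sing g \<phi> \<theta>) (n + 2) -
      gamma3 g n * (- (2 * Gamma (2 * \<phi> + 1) / pi) * lead_const \<phi> \<theta> * (ln (real n) ^ log_order \<phi> \<theta> / real n powr (2 * \<phi> + 1))))
    \<in> o(\<lambda>n. ln (real n) ^ log_order \<phi> \<theta> / real n powr (2 * \<phi> + 1))"
    unfolding E_def[symmetric] k_def[symmetric] v_def[symmetric] by (simp only:)
qed

text \<open>The factor -4 relates the differences of c to b, and p = 2\<phi> - 1 divides by 2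
  (2\<phi> - 1); with the 4\<phi> from b this gives -1 / ((2\<phi> - 1) (2\<phi>)).\<close>

lemma quad_coeff_smallo:
  "(\<lambda>n. quad_coeff (weak_sing g \<phi> \<theta>) n - gamma3 g n *
      (- 4 * (- (2 * Gamma (2 * \<phi> + 1) / pi) * lead_const \<phi> \<theta> / (2 * (2 * \<phi>))) / (2 * (2 * \<phi> - 1)) *
      (ln (real n) ^ log_order \<phi> \<theta> / real n powr (2 * \<phi> - 1))))
    \<in> o(\<lambda>n. ln (real n) ^ log_order \<phi> \<theta> / real n powr (2 * \<phi> - 1))"
proof (rule step_two_summation)
  define E where "E = - (2 * Gamma (2 * \<phi> + 1) / pi) * lead_const \<phi> \<theta> / (2 * (2 * \<phi>))"
  define v where "v n = ln (real n) ^ log_order \<phi> \<theta> / real n powr (2 * \<phi>)" for n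
  show "2 * \<phi> - 1 > 0" using \<phi> by simp
  show "quad_coeff (weak_sing g \<phi> \<theta>) \<longlonglongrightarrow> 0" by (rule quad_coeff_tendsto_0)
  have "(\<lambda>n. - 4 * (diff_coeff (weak_sing g \<phi> \<theta>) n - gamma3 g n * (E * v n))) \<in> o(\<lambda>n. 1 * v n)"
    by (rule landau_o.big_small_mult) (use diff_coeff_smallo in \<open>simp_all add: E_def v_def\<close>)
  moreover have ev: "\<forall>\<^sub>F n in sequentially. - 4 * (diff_coeff (weak_sing g \<phi> \<theta>) n - gamma3 g n * (E * v n)) =
      quad_coeff (weak_sing g \<phi> \<theta>) n - quad_coeff (weak_sing g \<phi> \<theta>) (n + 2) - gamma3 g n * (- 4 * E * v n)"
    using eventually_gt_at_top[of 0]
  proof eventually_elim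
    case (elim n)
    show ?case unfolding quad_coeff_diff[OF elim] by (simp add: algebra_simps)
  qed
  ultimately have "(\<lambda>n. quad_coeff (weak_sing g \<phi> \<theta>) n - quad_coeff (weak_sing g \<phi> \<theta>) (n + 2) - gamma3 g n * (- 4 * E * v n)) \<in> o(v)"
    unfolding landau_o.small.in_cong[OF ev] by simp
  moreover have "2 * \<phi> - 1 + 1 = 2 * \<phi>" by simp
  ultimately show "(\<lambda>n. quad_coeff (weak_sing g \<phi> \<theta>) n - quad_coeff (weak_sing g \<phi> \<theta>) (n + 2) -
      gamma3 g n * (- 4 * (- (2 * Gamma (2 * \<phi> + 1) / pi) * lead_const \<phi> \<theta> / (2 * (2 * \<phi>))) *
        (ln (real n) ^ log_order \<phi> \<theta> / real n powr (2 * \<phi> - 1 + 1))))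
    \<in> o(\<lambda>n. ln (real n) ^ log_order \<phi> \<theta> / real n powr (2 * \<phi> - 1 + 1))"
    unfolding E_def[symmetric] v_def by (simp only:)
qed

end

text \<open>All admissible amplitudes have the same factorization with the same limit, so the
  theorem can be proved once for a single A.\<close>

lemma amplitude_factor:
  assumes \<phi>: "\<phi> > 0" and \<theta>: "\<theta> > 0"
    and A: "A = amp_gen g \<phi> \<theta> \<or> (\<theta> = 1 \<and> A = amp_one g \<phi>) \<or> (\<theta> = 2 \<and> A = amp_two g \<phi>)"
  obtains \<alpha> where "\<forall>\<^sub>F n in sequentially. A n = gamma3 g n * amp_scale \<phi> \<theta> n * \<alpha> n"
    "\<alpha> \<longlonglongrightarrow> - (2 * Gamma (2 * \<phi> + 1) / pi) * lead_const \<phi> \<theta>"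
proof -
  note result = that
  have s: "\<forall>\<^sub>F n in sequentially. amp_scale \<phi> \<theta> n \<noteq> 0"
    using eventually_gt_at_top[of 1] by eventually_elim (metis amp_scale_pos less_irrefl)
  have main: thesis if "X \<longlonglongrightarrow> L" "c * L = - (2 * Gamma (2 * \<phi> + 1) / pi) * lead_const \<phi> \<theta>"
    "\<And>n. A n = c * gamma3 g n * Y n" "\<And>n. X n = Y n / amp_scale \<phi> \<theta> n" for X Y c L
  proof (rule result[of "\<lambda>n. c * X n"])
    show "\<forall>\<^sub>F n in sequentially. A n = gamma3 g n * amp_scale \<phi> \<theta> n * (c * X n)"
      using s by eventually_elim (simp add: that)
    show "(\<lambda>n. c * X n) \<longlonglongrightarrow> - (2 * Gamma (2 * \<phi> + 1) / pi) * lead_const \<phi> \<theta>"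
      unfolding that(2)[symmetric] by (intro tendsto_mult tendsto_const that)
  qed
  from A show thesis
  proof (elim disjE conjE)
    assume A: "A = amp_gen g \<phi> \<theta>"
    show thesis
    proof (rule main[OF amp_gen_limit[OF \<phi> \<theta>]])
      show "- (2 / pi) * (Gamma (2 * \<phi> + 1) * lead_const \<phi> \<theta>) = - (2 * Gamma (2 * \<phi> + 1) / pi) * lead_const \<phi> \<theta>"
        by simp
      show "A n = - (2 / pi) * gamma3 g n * (real n powr (2 * \<phi> + 1) *
       (\<Sum>k=0..\<theta>. \<Sum>j=0..k.
          real (\<theta> choose k) * real (k choose j) * pi ^ j * sin (real j / 2 * pi + \<phi> * pi) *
          ln (1 / 2) ^ (k - j) * beta_deriv \<phi> (\<theta> - k) n))" for n
        unfolding A amp_gen_def beta_deriv_def by (simp only: mult.assoc)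
    qed (rule refl)
  next
    assume \<theta>: "\<theta> = 1" and A: "A = amp_one g \<phi>"
    show thesis unfolding \<theta>
      by (rule main[unfolded \<theta>, OF amp_one_limit[OF \<phi>] refl _ refl]) (simp only: A amp_one_def)
  next
    assume \<theta>: "\<theta> = 2" and A: "A = amp_two g \<phi>"
    show thesis unfolding \<theta>
      by (rule main[unfolded \<theta>, OF amp_two_limit[OF \<phi>] refl _ refl]) (simp only: A amp_two_def)
  qed
qed

theorem theorem1:
  fixes \<phi> :: real and \<theta> :: nat and g u :: "real \<Rightarrow> real" and G :: "complex \<Rightarrow> complex"
    and a b c A :: "nat \<Rightarrow> real"
  assumes \<phi>: "\<phi> > 1 / 2" and \<theta>: "\<theta> > 0"
    and g: "G analytic_on complex_of_real ` {-1..1}"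
           "\<And>x. x \<in> {-1..1} \<Longrightarrow> G (complex_of_real x) = complex_of_real (g x)"
    and u: "u = weak_sing g \<phi> \<theta>"
    and coeffs: "a = cheb_coeff u" "b = diff_coeff u" "c = quad_coeff u"
    and A: "A = amp_gen g \<phi> \<theta> \<or> (\<theta> = 1 \<and> A = amp_one g \<phi>) \<or> (\<theta> = 2 \<and> A = amp_two g \<phi>)"
  shows
    \<comment> \<open>leading asymptotics\<close>
    "a \<sim>[nondeg g] (\<lambda>n. A n / real n powr (2 * \<phi> + 1))
     \<and> b \<sim>[nondeg g] (\<lambda>n. A n / (4 * \<phi>) * (1 / real n powr (2 * \<phi>)))
     \<and> c \<sim>[nondeg g] (\<lambda>n. - (A n / ((2 * \<phi> - 1) * (2 * \<phi>))) * (1 / real n powr (2 * \<phi> - 1)))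
    \<comment> \<open>the same along all indices, including those with \<open>gamma3 g n = 0\<close>\<close>
     \<and> (\<lambda>n. a n - A n / real n powr (2 * \<phi> + 1))
         \<in> o(\<lambda>n. amp_scale \<phi> \<theta> n / real n powr (2 * \<phi> + 1))
     \<and> (\<lambda>n. b n - A n / (4 * \<phi>) * (1 / real n powr (2 * \<phi>)))
         \<in> o(\<lambda>n. amp_scale \<phi> \<theta> n / real n powr (2 * \<phi>))
     \<and> (\<lambda>n. c n - (- (A n / ((2 * \<phi> - 1) * (2 * \<phi>))) * (1 / real n powr (2 * \<phi> - 1))))
         \<in> o(\<lambda>n. amp_scale \<phi> \<theta> n / real n powr (2 * \<phi> - 1))
    \<comment> \<open>\<open>A\<close> varies more slowly than any power\<close>
     \<and> (\<forall>\<epsilon>>0. A \<in> o(\<lambda>n. real n powr \<epsilon>) \<and> (\<lambda>n. real n powr (- \<epsilon>)) \<in> o[nondeg g](A))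
     \<and> (\<phi> \<in> \<nat> \<longrightarrow> A \<in> O(\<lambda>n. ln (real n) ^ (\<theta> - 1)))
     \<and> (\<phi> \<notin> \<nat> \<longrightarrow> A \<in> O(\<lambda>n. ln (real n) ^ \<theta>))
    \<comment> \<open>simplified form of \<open>A\<close>: order of magnitude, and with the numerical constants\<close>
     \<and> A \<in> \<Theta>(\<lambda>n. - (2 * Gamma (2 * \<phi> + 1) / pi) * gamma3 g n *
             (ln (real n) ^ \<theta> * sin (\<phi> * pi) + ln (real n) ^ (\<theta> - 1) * cos (\<phi> * pi)))
     \<and> A \<sim>[sequentially] (\<lambda>n. - (2 * Gamma (2 * \<phi> + 1) / pi) * gamma3 g n *
             ((-2) ^ \<theta> * ln (real n) ^ \<theta> * sin (\<phi> * pi)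
              + real \<theta> * pi * (-2) ^ (\<theta> - 1) * ln (real n) ^ (\<theta> - 1) * cos (\<phi> * pi)))"
proof -
  \<comment> \<open>Taking real parts of the complex derivatives yields derivatives even at the
    endpoints, because the extension is analytic in a neighbourhood of the interval.\<close>
  define D where "D k x = Re ((deriv ^^ k) G (complex_of_real x))" for k x
  interpret weak_singularity g D \<phi> \<theta>
  proof
    show "D 0 x = g x" if "x \<in> {-1..1}" for x using g(2)[OF that] by (simp add: D_def)
    show "(D k has_real_derivative D (Suc k) x) (at x within {-1..1})" if "x \<in> {-1..1}" for k x
    proof -
      have "(deriv ^^ k) G analytic_on {complex_of_real x}"
        using analytic_higher_deriv[OF g(1)] by (rule analytic_on_subset) (use that in auto)
      then have "((deriv ^^ k) G has_field_derivative deriv ((deriv ^^ k) G) (complex_of_real x)) (at (complex_of_real x))"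
        by (rule analytic_derivI)
      from DERIV_Re_of_real[OF this] show ?thesis
        by (simp add: D_def[abs_def] has_field_derivative_at_within)
    qed
  qed (fact \<phi> \<theta>)+
  have \<phi>0: "\<phi> > 0" using \<phi> by simp
  define s where "s = amp_scale \<phi> \<theta>"
  define E where "E = - (2 * Gamma (2 * \<phi> + 1) / pi) * lead_const \<phi> \<theta>"
  have s_eq: "s n = ln (real n) ^ log_order \<phi> \<theta>" for n by (simp add: s_def amp_scale_eq)
  have Gpos: "Gamma (2 * \<phi> + 1) > 0" using \<phi> by (intro Gamma_real_pos) auto
  have E0: "E \<noteq> 0" using Gpos lead_const_nonzero[OF \<phi>0 \<theta>] by (simp add: E_def)
  obtain \<alpha> where \<alpha>: "\<forall>\<^sub>F n in sequentially. A n = gamma3 g n * s n * \<alpha> n" "\<alpha> \<longlonglongrightarrow> E"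
    using amplitude_factor[OF \<phi>0 \<theta> A] unfolding s_def E_def by blast

  have a1: "(\<lambda>n. a n - A n / real n powr (2 * \<phi> + 1)) \<in> o(\<lambda>n. s n / real n powr (2 * \<phi> + 1))"
    and a2: "a \<sim>[nondeg g] (\<lambda>n. A n / real n powr (2 * \<phi> + 1))"
  proof -
    have x: "(\<lambda>n. a n - gamma3 g n * (E * (s n / real n powr (2 * \<phi> + 1)))) \<in> o(\<lambda>n. s n / real n powr (2 * \<phi> + 1))"
      using cheb_coeff_smallo by (simp add: coeffs u E_def s_eq)
    have T: "\<forall>\<^sub>F n in sequentially. A n / real n powr (2 * \<phi> + 1) = gamma3 g n * (\<alpha> n * (s n / real n powr (2 * \<phi> + 1)))"
      using \<alpha>(1) by eventually_elim simp
    show "(\<lambda>n. a n - A n / real n powr (2 * \<phi> + 1)) \<in> o(\<lambda>n. s n / real n powr (2 * \<phi> + 1))"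
      "a \<sim>[nondeg g] (\<lambda>n. A n / real n powr (2 * \<phi> + 1))"
      by (rule nondeg_asymp[OF x T \<alpha>(2) E0])+
  qed
  have b1: "(\<lambda>n. b n - A n / (4 * \<phi>) * (1 / real n powr (2 * \<phi>))) \<in> o(\<lambda>n. s n / real n powr (2 * \<phi>))"
    and b2: "b \<sim>[nondeg g] (\<lambda>n. A n / (4 * \<phi>) * (1 / real n powr (2 * \<phi>)))"
  proof -
    have x: "(\<lambda>n. b n - gamma3 g n * (E / (4 * \<phi>) * (s n / real n powr (2 * \<phi>)))) \<in> o(\<lambda>n. s n / real n powr (2 * \<phi>))"
      using diff_coeff_smallo by (simp add: coeffs u E_def s_eq)
    have T: "\<forall>\<^sub>F n in sequentially. A n / (4 * \<phi>) * (1 / real n powr (2 * \<phi>)) = gamma3 g n * (\<alpha> n / (4 * \<phi>) * (s n / real n powr (2 * \<phi>)))"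
      using \<alpha>(1) by eventually_elim simp
    have l: "(\<lambda>n. \<alpha> n / (4 * \<phi>)) \<longlonglongrightarrow> E / (4 * \<phi>)" "E / (4 * \<phi>) \<noteq> 0"
      using \<phi> E0 by (auto intro!: tendsto_intros \<alpha>)
    show "(\<lambda>n. b n - A n / (4 * \<phi>) * (1 / real n powr (2 * \<phi>))) \<in> o(\<lambda>n. s n / real n powr (2 * \<phi>))"
      "b \<sim>[nondeg g] (\<lambda>n. A n / (4 * \<phi>) * (1 / real n powr (2 * \<phi>)))"
      by (rule nondeg_asymp[OF x T l])+
  qed
  have c1: "(\<lambda>n. c n - (- (A n / ((2 * \<phi> - 1) * (2 * \<phi>))) * (1 / real n powr (2 * \<phi> - 1)))) \<in> o(\<lambda>n. s n / real n powr (2 * \<phi> - 1))"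
    and c2: "c \<sim>[nondeg g] (\<lambda>n. - (A n / ((2 * \<phi> - 1) * (2 * \<phi>))) * (1 / real n powr (2 * \<phi> - 1)))"
  proof -
    have "- 4 * (E / (2 * (2 * \<phi>))) / (2 * (2 * \<phi> - 1)) = - E / ((2 * \<phi> - 1) * (2 * \<phi>))"
      using \<phi> by (simp add: field_simps)
    with quad_coeff_smallo[folded E_def]
    have x: "(\<lambda>n. c n - gamma3 g n * (- E / ((2 * \<phi> - 1) * (2 * \<phi>)) * (s n / real n powr (2 * \<phi> - 1)))) \<in> o(\<lambda>n. s n / real n powr (2 * \<phi> - 1))"
      by (simp only: coeffs u s_eq)
    have T: "\<forall>\<^sub>F n in sequentially. - (A n / ((2 * \<phi> - 1) * (2 * \<phi>))) * (1 / real n powr (2 * \<phi> - 1))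
        = gamma3 g n * (- \<alpha> n / ((2 * \<phi> - 1) * (2 * \<phi>)) * (s n / real n powr (2 * \<phi> - 1)))"
      using \<alpha>(1) by eventually_elim simp
    have l: "(\<lambda>n. - \<alpha> n / ((2 * \<phi> - 1) * (2 * \<phi>))) \<longlonglongrightarrow> - E / ((2 * \<phi> - 1) * (2 * \<phi>))" "- E / ((2 * \<phi> - 1) * (2 * \<phi>)) \<noteq> 0"
      using \<phi> E0 by (auto intro!: tendsto_intros \<alpha>)
    show "(\<lambda>n. c n - (- (A n / ((2 * \<phi> - 1) * (2 * \<phi>))) * (1 / real n powr (2 * \<phi> - 1)))) \<in> o(\<lambda>n. s n / real n powr (2 * \<phi> - 1))"
      "c \<sim>[nondeg g] (\<lambda>n. - (A n / ((2 * \<phi> - 1) * (2 * \<phi>))) * (1 / real n powr (2 * \<phi> - 1)))"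
      by (rule nondeg_asymp[OF x T l])+
  qed

  have \<alpha>\<Theta>: "\<alpha> \<in> \<Theta>(\<lambda>_. 1)" by (rule tendsto_nonzero_bigtheta[OF \<alpha>(2) E0])
  have As: "A \<in> O(s)"
  proof -
    have "(\<lambda>n. gamma3 g n * s n * \<alpha> n) \<in> O(\<lambda>n. 1 * s n * 1)"
      using \<alpha>\<Theta> by (intro landau_o.big_mult gamma3_bigo) auto
    then show ?thesis unfolding landau_o.big.in_cong[OF \<alpha>(1)] by simp
  qed
  have sA: "s \<in> O[nondeg g](A)"
  proof -
    have "(\<lambda>_. 1) \<in> O(\<alpha>)" using \<alpha>\<Theta> by (simp add: bigtheta_def bigomega_iff_bigo)
    then have "(\<lambda>n. 1 * s n * 1) \<in> O[nondeg g](\<lambda>n. gamma3 g n * s n * \<alpha> n)"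
      by (intro landau_o.big_mult one_bigo_gamma3 landau_o.big.filter_mono[OF nondeg_le]) auto
    then show ?thesis
      unfolding landau_o.big.cong[OF filter_leD[OF nondeg_le \<alpha>(1)]] by simp
  qed
  have slow: "A \<in> o(\<lambda>n. real n powr \<epsilon>) \<and> (\<lambda>n. real n powr (- \<epsilon>)) \<in> o[nondeg g](A)" if \<epsilon>: "\<epsilon> > 0" for \<epsilon>
  proof
    have "s \<in> o(\<lambda>n. real n powr \<epsilon>)" unfolding s_eq[abs_def] using \<epsilon> by real_asymp
    with As show "A \<in> o(\<lambda>n. real n powr \<epsilon>)" by (rule landau_o.big_small_trans)
    have "(\<lambda>n. real n powr (- \<epsilon>)) \<in> o(s)" unfolding s_eq[abs_def] using \<epsilon> by real_asymp
    then have "(\<lambda>n. real n powr (- \<epsilon>)) \<in> o[nondeg g](s)" by (rule landau_o.small.filter_mono[OF nondeg_le])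
    then show "(\<lambda>n. real n powr (- \<epsilon>)) \<in> o[nondeg g](A)" using sA by (rule landau_o.small_big_trans)
  qed
  have O1: "A \<in> O(\<lambda>n. ln (real n) ^ (\<theta> - 1))" if "\<phi> \<in> \<nat>"
    using As that unfolding s_eq[abs_def] by (simp add: log_order_def)
  have O2: "A \<in> O(\<lambda>n. ln (real n) ^ \<theta>)" if "\<phi> \<notin> \<nat>"
    using As that unfolding s_eq[abs_def] by (simp add: log_order_def)

  define P where "P = - (2 * Gamma (2 * \<phi> + 1) / pi)"
  have P0: "P \<noteq> 0" using Gpos by (simp add: P_def)
  \<comment> \<open>The weights \<mu> and \<nu> cover both short forms of A: 1 and 1 for the order
    of magnitude, the numerical constants for the equivalence. Only the \<nu> term is left for
    integer \<phi>; otherwise the \<mu> term dominates.\<close>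
  have log_form: "\<exists>\<beta>. (\<forall>\<^sub>F n in sequentially. P * gamma3 g n * (\<mu> * ln (real n) ^ \<theta> * sin (\<phi> * pi) + \<nu> * ln (real n) ^ (\<theta> - 1) * cos (\<phi> * pi))
      = gamma3 g n * s n * \<beta> n) \<and> \<beta> \<longlonglongrightarrow> P * (if \<phi> \<in> \<nat> then \<nu> * cos (\<phi> * pi) else \<mu> * sin (\<phi> * pi))" for \<mu> \<nu>
  proof (cases "\<phi> \<in> \<nat>")
    case True
    then show ?thesis
      by (intro exI[of _ "\<lambda>_. P * (\<nu> * cos (\<phi> * pi))"]) (simp add: sin_Nats s_eq log_order_def)
  next
    case False
    show ?thesis
    proof (intro exI conjI)
      have "(\<lambda>n. 1 / ln (real n)) \<longlonglongrightarrow> 0" by real_asymp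
      then have "(\<lambda>n. P * (\<mu> * sin (\<phi> * pi) + \<nu> * cos (\<phi> * pi) * (1 / ln (real n)))) \<longlonglongrightarrow> P * (\<mu> * sin (\<phi> * pi) + \<nu> * cos (\<phi> * pi) * 0)"
        by (intro tendsto_mult tendsto_add tendsto_const)
      with False show "(\<lambda>n. P * (\<mu> * sin (\<phi> * pi) + \<nu> * cos (\<phi> * pi) * (1 / ln (real n)))) \<longlonglongrightarrow> P * (if \<phi> \<in> \<nat> then \<nu> * cos (\<phi> * pi) else \<mu> * sin (\<phi> * pi))"
        by simp
      obtain m where m: "\<theta> = Suc m" using \<theta> by (cases \<theta>) auto
      show "\<forall>\<^sub>F n in sequentially. P * gamma3 g n * (\<mu> * ln (real n) ^ \<theta> * sin (\<phi> * pi) + \<nu> * ln (real n) ^ (\<theta> - 1) * cos (\<phi> * pi))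
        = gamma3 g n * s n * (P * (\<mu> * sin (\<phi> * pi) + \<nu> * cos (\<phi> * pi) * (1 / ln (real n))))"
        using eventually_gt_at_top[of 1]
      proof eventually_elim
        case (elim n)
        then have "ln (real n) > 0" by simp
        with False show ?case by (simp add: s_eq log_order_def m field_simps)
      qed
    qed
  qed
  have trig: "\<phi> \<in> \<nat> \<Longrightarrow> cos (\<phi> * pi) \<noteq> 0" "\<phi> \<notin> \<nat> \<Longrightarrow> sin (\<phi> * pi) \<noteq> 0"
    using lead_const_nonzero[OF \<phi>0 \<theta>] by (auto simp: lead_const_def)
  have th: "A \<in> \<Theta>(\<lambda>n. P * gamma3 g n * (ln (real n) ^ \<theta> * sin (\<phi> * pi) + ln (real n) ^ (\<theta> - 1) * cos (\<phi> * pi)))"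
  proof -
    obtain \<beta> where \<beta>: "\<forall>\<^sub>F n in sequentially. P * gamma3 g n * (ln (real n) ^ \<theta> * sin (\<phi> * pi) + ln (real n) ^ (\<theta> - 1) * cos (\<phi> * pi))
      = gamma3 g n * s n * \<beta> n" "\<beta> \<longlonglongrightarrow> P * (if \<phi> \<in> \<nat> then cos (\<phi> * pi) else sin (\<phi> * pi))"
      using log_form[of 1 1] by (auto simp only: mult_1)
    show ?thesis
      by (rule tendsto_factor_asymp(1)[OF \<alpha>(1) \<beta>(1) \<alpha>(2) E0 \<beta>(2)]) (use P0 trig in auto)
  qed
  have sim: "A \<sim>[sequentially] (\<lambda>n. P * gamma3 g n * ((-2) ^ \<theta> * ln (real n) ^ \<theta> * sin (\<phi> * pi)
      + real \<theta> * pi * (-2) ^ (\<theta> - 1) * ln (real n) ^ (\<theta> - 1) * cos (\<phi> * pi)))"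
  proof -
    \<comment> \<open>With these weights the limit equals that of A itself, which turns the order
      estimate into an equivalence.\<close>
    have L: "P * (if \<phi> \<in> \<nat> then real \<theta> * pi * (-2) ^ (\<theta> - 1) * cos (\<phi> * pi) else (-2) ^ \<theta> * sin (\<phi> * pi)) = E"
      by (simp add: E_def P_def lead_const_def)
    obtain \<beta> where \<beta>: "\<forall>\<^sub>F n in sequentially. P * gamma3 g n * ((-2) ^ \<theta> * ln (real n) ^ \<theta> * sin (\<phi> * pi)
      + real \<theta> * pi * (-2) ^ (\<theta> - 1) * ln (real n) ^ (\<theta> - 1) * cos (\<phi> * pi)) = gamma3 g n * s n * \<beta> n" "\<beta> \<longlonglongrightarrow> E"
      using log_form[of "(-2) ^ \<theta>" "real \<theta> * pi * (-2) ^ (\<theta> - 1)"] unfolding L by blast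
    show ?thesis
      by (rule tendsto_factor_asymp(2)[OF \<alpha>(1) \<beta>(1) \<alpha>(2) E0 \<beta>(2) E0 refl])
  qed
  show ?thesis
    using a1 a2 b1 b2 c1 c2 slow O1 O2 th sim unfolding s_def P_def by blast
qed

end
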